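(* Let $(M,g)$ and $(N,h)$ be two oriented Riemannian manifolds and let $p:(M,g)\to(N,h)$ be a proper lipschitz submersion. Then the Fiber Volume of $p$ satisfies, for $q\in N$, $$\mathrm{Vol}_{p,g,h}(q)=\int_{F}\frac{Vol_M}{p^*Vol_N}(q)\quad\text{if }q\in p(M),\qquad \mathrm{Vol}_{p,g,h}(q)=0\quad\text{otherwise},$$ where the integral is over the fiber $F=p^{-1}(q)$.
   Context: The Fiber Volume of $p$ is the Radon–Nikodym derivative $\mathrm{Vol}_{p,g,h}=\partial(p_\star\mu_M)/\partial\mu_N$ of the pushforward of the Riemannian measure of $M$ with respect to the Riemannian measure of $N$ (defined up to null sets). $Vol_M,Vol_N$ are the Riemannian volume forms. A quotient $\frac{\alpha}{\beta}$ of differential forms is any (not necessarily continuous) section $\xi$ of the exterior bundle such that $\alpha=\beta\wedge\xi$; for a submersion $p$ a quotient $\frac{Vol_M}{p^*Vol_N}$ exists and its restriction to each fiber $p^{-1}(q)$ is a smooth form not depending on the choice. Fibers are oriented so that $\int_{p^{-1}(q)}\frac{Vol_M}{p^*Vol_N}>0$. *)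

theory Defs
  imports "HOL-Analysis.Analysis"
begin

section \<open>Smooth maps on open subsets of Euclidean space\<close>

primrec Ck_on :: "nat \<Rightarrow> ('a::euclidean_space \<Rightarrow> 'b::real_normed_vector) \<Rightarrow> 'a set \<Rightarrow> bool" where
  "Ck_on 0 f S \<longleftrightarrow> continuous_on S f"
| "Ck_on (Suc r) f S \<longleftrightarrow>
     (\<forall>x\<in>S. f differentiable (at x)) \<and> (\<forall>v. Ck_on r (\<lambda>x. frechet_derivative f (at x) v) S)"

definition smooth_on :: "'a set \<Rightarrow> ('a::euclidean_space \<Rightarrow> 'b::real_normed_vector) \<Rightarrow> bool" where
  "smooth_on S f \<longleftrightarrow> (\<forall>r. Ck_on r f S)"


section \<open>Oriented Riemannian manifolds\<close>

text \<open>
  The points of a manifold are the elements of a second countable Hausdorff type.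
  A chart is a pair \<open>(U, \<phi>)\<close>; only the values of \<open>\<phi>\<close> on \<open>U\<close> matter.
  Tensor fields are given by their components in every chart of the atlas, subject to the
  usual transformation rule; so a tangent vector at \<open>x\<close> is represented, in a chart
  around \<open>x\<close>, by its coordinate vector.
\<close>

type_synonym ('p, 'n) chart = "'p set \<times> ('p \<Rightarrow> real ^ 'n)"

definition chart_inv :: "('p, 'n::finite) chart \<Rightarrow> real ^ 'n \<Rightarrow> 'p" where
  "chart_inv c = inv_into (fst c) (snd c)"

definition is_chart :: "('p::topological_space, 'n::finite) chart \<Rightarrow> bool" where
  "is_chart c \<longleftrightarrow> open (fst c) \<and> open (snd c ` fst c) \<and>
     homeomorphism (fst c) (snd c ` fst c) (snd c) (chart_inv c)"

definition local_rep ::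
  "('p, 'm::finite) chart \<Rightarrow> ('q, 'n::finite) chart \<Rightarrow> ('p \<Rightarrow> 'q) \<Rightarrow> real ^ 'm \<Rightarrow> real ^ 'n" where
  "local_rep c d f = snd d \<circ> f \<circ> chart_inv c"

definition differential ::
  "('p, 'm::finite) chart \<Rightarrow> ('q, 'n::finite) chart \<Rightarrow> ('p \<Rightarrow> 'q) \<Rightarrow> 'p \<Rightarrow> real ^ 'm \<Rightarrow> real ^ 'n" where
  "differential c d f x = frechet_derivative (local_rep c d f) (at (snd c x))"

definition smooth_wrt ::
  "('p::topological_space, 'm::finite) chart set \<Rightarrow> ('q::topological_space, 'n::finite) chart set \<Rightarrow>
   ('p \<Rightarrow> 'q) \<Rightarrow> bool" where
  "smooth_wrt A B f \<longleftrightarrow> continuous_on UNIV f \<and>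
     (\<forall>c\<in>A. \<forall>d\<in>B. smooth_on (snd c ` (fst c \<inter> f -` fst d)) (local_rep c d f))"

definition smooth_atlas :: "('p::topological_space, 'n::finite) chart set \<Rightarrow> bool" where
  "smooth_atlas A \<longleftrightarrow> (\<forall>c\<in>A. is_chart c) \<and> (\<Union>c\<in>A. fst c) = UNIV \<and> smooth_wrt A A id"

definition oriented_atlas :: "('p::topological_space, 'n::finite) chart set \<Rightarrow> bool" where
  "oriented_atlas A \<longleftrightarrow> smooth_atlas A \<and>
     (\<forall>c\<in>A. \<forall>d\<in>A. \<forall>x \<in> fst c \<inter> fst d. det (matrix (differential c d id x)) > 0)"

record ('p, 'n) manifold =
  atlas :: "('p, 'n) chart set"
  metric :: "('p, 'n) chart \<Rightarrow> 'p \<Rightarrow> real ^ 'n ^ 'n"  \<comment> \<open>Gram matrix \<open>g\<^sub>i\<^sub>j\<close> in the given chart\<close>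

definition riemannian_metric :: "('p::topological_space, 'n::finite) manifold \<Rightarrow> bool" where
  "riemannian_metric M \<longleftrightarrow> (\<forall>c\<in>atlas M.
     smooth_on (snd c ` fst c) (\<lambda>y. metric M c (chart_inv c y)) \<and>
     (\<forall>x\<in>fst c.
        transpose (metric M c x) = metric M c x \<and>
        (\<forall>v. v \<noteq> 0 \<longrightarrow> v \<bullet> (metric M c x *v v) > 0) \<and>
        (\<forall>d\<in>atlas M. x \<in> fst d \<longrightarrow>
           (\<forall>v w. v \<bullet> (metric M c x *v w) =
              differential c d id x v \<bullet> (metric M d x *v differential c d id x w)))))"

definition oriented_riemannian_manifold ::
  "('p::{second_countable_topology,t2_space}, 'n::finite) manifold \<Rightarrow> bool" where
  "oriented_riemannian_manifold M \<longleftrightarrow> oriented_atlas (atlas M) \<and> riemannian_metric M"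

text \<open>
  Below, an arbitrary chart around a point is chosen to evaluate expressions that do not depend on
  the choice.
\<close>

definition chart_at :: "('p, 'n::finite) manifold \<Rightarrow> 'p \<Rightarrow> ('p, 'n) chart" where
  "chart_at M x = (SOME c. c \<in> atlas M \<and> x \<in> fst c)"

definition submersion ::
  "('p::topological_space, 'm::finite) manifold \<Rightarrow> ('q::topological_space, 'n::finite) manifold \<Rightarrow>
   ('p \<Rightarrow> 'q) \<Rightarrow> bool" where
  "submersion M N f \<longleftrightarrow> smooth_wrt (atlas M) (atlas N) f \<and>
     (\<forall>c\<in>atlas M. \<forall>d\<in>atlas N. \<forall>x \<in> fst c \<inter> f -` fst d. surj (differential c d f x))"


section \<open>Riemannian distance and Riemannian measure\<close>

definition piecewise_C1_curve ::
  "('p::topological_space, 'n::finite) manifold \<Rightarrow> (real \<Rightarrow> 'p) \<Rightarrow> bool" where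
  "piecewise_C1_curve M \<gamma> \<longleftrightarrow> continuous_on {0..1} \<gamma> \<and>
     (\<exists>S. finite S \<and>
        (\<forall>c\<in>atlas M. (snd c \<circ> \<gamma>) C1_differentiable_on (({0..1} - S) \<inter> \<gamma> -` fst c)))"

definition curve_speed :: "('p, 'n::finite) manifold \<Rightarrow> (real \<Rightarrow> 'p) \<Rightarrow> real \<Rightarrow> real" where
  "curve_speed M \<gamma> t =
     (let c = chart_at M (\<gamma> t); v = vector_derivative (snd c \<circ> \<gamma>) (at t)
      in sqrt (v \<bullet> (metric M c (\<gamma> t) *v v)))"

definition curve_length :: "('p, 'n::finite) manifold \<Rightarrow> (real \<Rightarrow> 'p) \<Rightarrow> ennreal" where
  "curve_length M \<gamma> = (\<integral>\<^sup>+ t\<in>{0..1}. ennreal (curve_speed M \<gamma> t) \<partial>lborel)"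

text \<open>The distance between points in different connected components is \<open>\<infinity>\<close>.\<close>

definition riemannian_dist ::
  "('p::topological_space, 'n::finite) manifold \<Rightarrow> 'p \<Rightarrow> 'p \<Rightarrow> ennreal" where
  "riemannian_dist M x y =
     (INF \<gamma> \<in> {\<gamma>. piecewise_C1_curve M \<gamma> \<and> \<gamma> 0 = x \<and> \<gamma> 1 = y}. curve_length M \<gamma>)"

definition riemannian_lipschitz ::
  "('p::topological_space, 'm::finite) manifold \<Rightarrow> ('q::topological_space, 'n::finite) manifold \<Rightarrow>
   ('p \<Rightarrow> 'q) \<Rightarrow> bool" where
  "riemannian_lipschitz M N f \<longleftrightarrow>
     (\<exists>L::real. L > 0 \<and> (\<forall>x y. riemannian_dist N (f x) (f y) \<le> ennreal L * riemannian_dist M x y))"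

text \<open>
  The unique Borel measure whose density with respect to Lebesgue measure, in every chart, is
  the square root of the Gram determinant.
\<close>

definition riemannian_measure :: "('p::topological_space, 'n::finite) manifold \<Rightarrow> 'p measure" where
  "riemannian_measure M = (THE \<mu>. sets \<mu> = sets borel \<and>
     (\<forall>c\<in>atlas M. \<forall>A\<in>sets borel. A \<subseteq> fst c \<longrightarrow>
        emeasure \<mu> A =
          (\<integral>\<^sup>+ y \<in> snd c ` A. ennreal (sqrt (det (metric M c (chart_inv c y)))) \<partial>lborel)))"

definition fiber_volume ::
  "('p::topological_space, 'm::finite) manifold \<Rightarrow> ('q::topological_space, 'n::finite) manifold \<Rightarrow>
   ('p \<Rightarrow> 'q) \<Rightarrow> 'q \<Rightarrow> ennreal" where
  "fiber_volume M N f = RN_deriv (riemannian_measure N) (distr (riemannian_measure M) borel f)"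


section \<open>Differential forms\<close>

text \<open>
  A \<open>k\<close>-form takes a sequence of tangent vectors, of which only the entries with index below
  \<open>k\<close> are relevant. No regularity in the base point is required.
\<close>

type_synonym ('p, 'n) form = "('p, 'n) chart \<Rightarrow> 'p \<Rightarrow> (nat \<Rightarrow> real ^ 'n) \<Rightarrow> real"

definition alternating :: "nat \<Rightarrow> ((nat \<Rightarrow> 'a::real_vector) \<Rightarrow> real) \<Rightarrow> bool" where
  "alternating k \<omega> \<longleftrightarrow>
     (\<forall>v. \<forall>i<k. linear (\<lambda>u. \<omega> (v(i := u)))) \<and>
     (\<forall>v. \<forall>i<k. \<forall>j<k. i \<noteq> j \<and> v i = v j \<longrightarrow> \<omega> v = 0) \<and>
     (\<forall>v w. (\<forall>i<k. v i = w i) \<longrightarrow> \<omega> v = \<omega> w)"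

definition differential_form :: "('p, 'n::finite) manifold \<Rightarrow> nat \<Rightarrow> ('p, 'n) form \<Rightarrow> bool" where
  "differential_form M k \<omega> \<longleftrightarrow> (\<forall>c\<in>atlas M. \<forall>x\<in>fst c.
     alternating k (\<omega> c x) \<and>
     (\<forall>d\<in>atlas M. x \<in> fst d \<longrightarrow> (\<forall>v. \<omega> c x v = \<omega> d x (\<lambda>i. differential c d id x (v i)))))"

text \<open>
  The type class \<open>wellorder\<close> merely numbers the coordinates: \<open>card {..<j}\<close> is the
  position of the coordinate \<open>j\<close>.
\<close>

definition vol_form :: "('p, 'n::{finite,wellorder}) manifold \<Rightarrow> ('p, 'n) form" where
  "vol_form M c x v = sqrt (det (metric M c x)) * det (\<chi> i j. v (card {..<j}) $ i)"

definition pullback ::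
  "('q, 'n::finite) manifold \<Rightarrow> ('p \<Rightarrow> 'q) \<Rightarrow> ('q, 'n) form \<Rightarrow> ('p, 'm::finite) form" where
  "pullback N f \<beta> c x v =
     (let d = chart_at N (f x) in \<beta> d (f x) (\<lambda>i. differential c d f x (v i)))"

definition wedge :: "nat \<Rightarrow> nat \<Rightarrow> ((nat \<Rightarrow> 'a) \<Rightarrow> real) \<Rightarrow> ((nat \<Rightarrow> 'a) \<Rightarrow> real) \<Rightarrow> (nat \<Rightarrow> 'a) \<Rightarrow> real" where
  "wedge a b \<beta> \<xi> v =
     (\<Sum>\<sigma> | \<sigma> permutes {..<a+b}.
        of_int (sign \<sigma>) * \<beta> (\<lambda>i. v (\<sigma> i)) * \<xi> (\<lambda>i. v (\<sigma> (a + i)))) / (fact a * fact b)"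

text \<open>\<open>\<xi>\<close> is a form of degree \<open>b\<close> with \<open>\<alpha> = \<beta> \<and> \<xi>\<close>, and \<open>\<beta>\<close> has degree \<open>a\<close>.\<close>

definition is_quotient ::
  "('p, 'n::finite) manifold \<Rightarrow> nat \<Rightarrow> nat \<Rightarrow> ('p, 'n) form \<Rightarrow> ('p, 'n) form \<Rightarrow> ('p, 'n) form \<Rightarrow> bool" where
  "is_quotient M a b \<alpha> \<beta> \<xi> \<longleftrightarrow> differential_form M b \<xi> \<and>
     (\<forall>c\<in>atlas M. \<forall>x\<in>fst c. \<forall>v. \<alpha> c x v = wedge a b (\<beta> c x) (\<xi> c x) v)"


section \<open>Integration of forms over compact submanifolds\<close>

text \<open>
  The dimension \<open>k\<close> of a submanifold may be \<open>0\<close>, so it is parametrised by open subsets of the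
  \<open>k\<close>-dimensional space \<^const>\<open>Euclidean_space\<close> of sequences that vanish from index \<open>k\<close> on.
\<close>

definition lborel_nat :: "nat \<Rightarrow> (nat \<Rightarrow> real) measure" where
  "lborel_nat k = distr (\<Pi>\<^sub>M i\<in>{..<k}. lborel) borel (\<lambda>y i. if i < k then y i else 0)"

definition partial_deriv ::
  "nat \<Rightarrow> ((nat \<Rightarrow> real) \<Rightarrow> 'b::real_normed_vector) \<Rightarrow> (nat \<Rightarrow> real) \<Rightarrow> 'b" where
  "partial_deriv i f y = vector_derivative (\<lambda>t. f (y(i := t))) (at (y i))"

primrec Ck_nat_on ::
  "nat \<Rightarrow> nat \<Rightarrow> ((nat \<Rightarrow> real) \<Rightarrow> 'b::real_normed_vector) \<Rightarrow> (nat \<Rightarrow> real) set \<Rightarrow> bool" where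
  "Ck_nat_on k 0 f S \<longleftrightarrow> continuous_on S f"
| "Ck_nat_on k (Suc r) f S \<longleftrightarrow> continuous_on S f \<and>
     (\<forall>i<k. (\<forall>y\<in>S. (\<lambda>t. f (y(i := t))) differentiable (at (y i))) \<and>
            Ck_nat_on k r (partial_deriv i f) S)"

text \<open>A smooth parametrisation of a relatively open piece of a \<open>k\<close>-dimensional submanifold \<open>F\<close>.\<close>

definition local_param ::
  "('p::topological_space, 'n::finite) manifold \<Rightarrow> nat \<Rightarrow> 'p set \<Rightarrow>
   (nat \<Rightarrow> real) set \<Rightarrow> ((nat \<Rightarrow> real) \<Rightarrow> 'p) \<Rightarrow> bool" where
  "local_param M k F W \<psi> \<longleftrightarrow>
     openin (Euclidean_space k) W \<and> openin (top_of_set F) (\<psi> ` W) \<and>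
     (\<exists>\<phi>. homeomorphism W (\<psi> ` W) \<psi> \<phi>) \<and>
     (\<forall>c\<in>atlas M.
        (\<forall>r. Ck_nat_on k r (snd c \<circ> \<psi>) (W \<inter> \<psi> -` fst c)) \<and>
        (\<forall>y \<in> W \<inter> \<psi> -` fst c. \<forall>a::nat \<Rightarrow> real.
           (\<Sum>i<k. a i *\<^sub>R partial_deriv i (snd c \<circ> \<psi>) y) = 0 \<longrightarrow> (\<forall>i<k. a i = 0)))"

text \<open>The coefficient \<open>\<omega>(\<partial>\<^sub>0\<psi>, \<dots>, \<partial>\<^sub>k\<^sub>-\<^sub>1\<psi>)\<close> of the pulled back form \<open>\<psi>\<^sup>*\<omega>\<close>.\<close>

definition param_coeff ::
  "('p, 'n::finite) manifold \<Rightarrow> ('p, 'n) form \<Rightarrow> ((nat \<Rightarrow> real) \<Rightarrow> 'p) \<Rightarrow> (nat \<Rightarrow> real) \<Rightarrow> real" where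
  "param_coeff M \<omega> \<psi> y =
     (let c = chart_at M (\<psi> y) in \<omega> c (\<psi> y) (\<lambda>i. partial_deriv i (snd c \<circ> \<psi>) y))"

text \<open>
  The integral of a \<open>k\<close>-form \<open>\<omega>\<close> over a compact \<open>k\<close>-dimensional submanifold \<open>F\<close>, by means of
  a partition of unity. The orientation of \<open>F\<close> is the one given by a form \<open>\<tau>\<close> whose restriction
  to \<open>F\<close> is continuous and nowhere zero: the factor \<open>sgn\<close> is \<open>1\<close> or \<open>-1\<close> according as
  \<open>\<psi>\<close> preserves or reverses the orientation (for \<open>k = 0\<close>, it is the sign of the point).
\<close>

definition has_form_integral ::
  "('p::topological_space, 'n::finite) manifold \<Rightarrow> nat \<Rightarrow> 'p set \<Rightarrow> ('p, 'n) form \<Rightarrow> ('p, 'n) form \<Rightarrow>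
   real \<Rightarrow> bool" where
  "has_form_integral M k F \<tau> \<omega> I \<longleftrightarrow>
     (\<exists>(n::nat) \<rho> W \<psi>.
        (\<forall>j<n. local_param M k F (W j) (\<psi> j) \<and>
               continuous_on F (\<rho> j) \<and> (\<forall>x\<in>F. 0 \<le> \<rho> j x) \<and>
               compact (closure {x\<in>F. \<rho> j x \<noteq> 0}) \<and> closure {x\<in>F. \<rho> j x \<noteq> 0} \<subseteq> \<psi> j ` W j) \<and>
        (\<forall>x\<in>F. (\<Sum>j<n. \<rho> j x) = 1) \<and>
        I = (\<Sum>j<n. LINT y:W j|lborel_nat k.
               \<rho> j (\<psi> j y) * sgn (param_coeff M \<tau> (\<psi> j) y) * param_coeff M \<omega> (\<psi> j) y))"

definition form_integral ::
  "('p::topological_space, 'n::finite) manifold \<Rightarrow> nat \<Rightarrow> 'p set \<Rightarrow> ('p, 'n) form \<Rightarrow> ('p, 'n) form \<Rightarrow> real" where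
  "form_integral M k F \<tau> \<omega> = (THE I. has_form_integral M k F \<tau> \<omega> I)"

text \<open>
  The fiber over \<open>y\<close> is oriented by \<open>\<xi>\<close> itself, that is, such that the restriction of \<open>\<xi>\<close> to the
  fiber is positive. For \<open>\<xi>\<close> a quotient of volume forms this restriction is nowhere zero.
\<close>

definition fiber_integral ::
  "('p::topological_space, 'n::finite) manifold \<Rightarrow> nat \<Rightarrow> ('p \<Rightarrow> 'q) \<Rightarrow> ('p, 'n) form \<Rightarrow> 'q \<Rightarrow> real" where
  "fiber_integral M k f \<xi> y = form_integral M k (f -` {y}) \<xi> \<xi>"

end

theory Submission
  imports Defs "HOL-Combinatorics.Permutations"
begin

text \<open>
  Around every point of \<open>M\<close> the implicit function theorem gives coordinates \<open>(u, w)\<close>, with \<open>u\<close> coordinates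
  of \<open>N\<close>, in which \<open>p\<close> is the projection to \<open>u\<close>. Let \<open>\<Psi>\<close> be the inverse of these coordinates.
  Evaluating \<open>Vol\<^sub>M = p\<^sup>*Vol\<^sub>N \<and> \<xi>\<close> on the basis \<open>\<partial>\<^sub>u\<Psi>, \<partial>\<^sub>w\<Psi>\<close> shows that the restriction of \<open>\<xi>\<close> to the fiber
  has density \<open>G = \<surd>g \<bar>det D\<Psi>\<bar> / \<surd>h\<close> in \<open>w\<close>, for every quotient \<open>\<xi>\<close>. Change of variables and Fubini then give
  \<open>\<mu>\<^sub>M(A \<inter> p\<^sup>-\<^sup>1 B) = \<integral>\<^sub>B \<integral> 1\<^sub>A G dw d\<mu>\<^sub>N\<close> for \<open>A\<close> inside the chart domain, and summing over a countable
  partition of \<open>M\<close> into such sets gives a density \<open>F\<close> of \<open>p\<^sub>*\<mu>\<^sub>M\<close>. As the fibers are compact,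
  \<open>F\<close> is almost everywhere finite, and comparing an arbitrary parametrisation of the fiber with the charts
  identifies \<open>F\<close> with the fiber integral computed from any partition of unity.
\<close>

section \<open>Enumeration of the coordinates\<close>

text \<open>A quotient \<xi> is neither unique nor continuous in general; only its values on vectors
  tangent to the fibers are under control. The density G is therefore built from \<Psi> and the two
  metrics alone, and \<xi> enters only through \<open>coeff_eq\<close>. As the fiber is oriented by
  \<xi> itself, the factor \<open>sgn\<close> replaces each coefficient by its absolute value, so
  all integrands are nonnegative and \<open>nn_integral\<close> applies. The fiber integral is a
  \<open>THE\<close>: it has a value only after a partition of unity has been found and all choices
  have been shown to give the same number. Each choice is compared with F, never with another
  choice. This needs F to be finite, because the Bochner integral of a nonintegrable function is 0.
  Finiteness comes from chart domains of finite volume: their kernels are integrable over N, and a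
  compact fiber meets only finitely many pieces. F does not mention \<xi>, so one null set serves
  all quotients. The dimension k of the fibers is a number and not a type, and it may be 0; hence
  fiber coordinates are sequences, and \<real>^m is split by \<open>base\<close>, \<open>fib\<close>
  and \<open>join\<close>.\<close>

definition pos :: "'a::{finite,wellorder} \<Rightarrow> nat" where
  "pos j = card {..<j}"

definition coord :: "nat \<Rightarrow> 'a::{finite,wellorder}" where
  "coord = inv_into UNIV pos"

lemma pos_less_mono: "i < j \<Longrightarrow> pos (i::'a::{finite,wellorder}) < pos j"
  unfolding pos_def by (rule psubset_card_mono) auto

lemma inj_pos: "inj (pos :: 'a::{finite,wellorder} \<Rightarrow> nat)"
  by (metis injI less_irrefl linorder_neqE pos_less_mono)

lemma pos_less [simp]: "pos (j::'a::{finite,wellorder}) < CARD('a)"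
  unfolding pos_def by (rule psubset_card_mono) auto

lemma bij_betw_pos: "bij_betw (pos :: 'a::{finite,wellorder} \<Rightarrow> nat) UNIV {..<CARD('a)}"
proof -
  have "card (range (pos :: 'a \<Rightarrow> nat)) = CARD('a)"
    by (simp add: card_image inj_pos)
  then have "range (pos :: 'a \<Rightarrow> nat) = {..<CARD('a)}"
    by (intro card_subset_eq) auto
  then show ?thesis by (simp add: bij_betw_def inj_pos)
qed

lemma coord_pos [simp]: "coord (pos j) = j"
  by (simp add: coord_def inj_pos)

lemma pos_coord [simp]: "i < CARD('a) \<Longrightarrow> pos (coord i :: 'a::{finite,wellorder}) = i"
  unfolding coord_def using bij_betw_pos[where 'a='a] by (metis bij_betw_imp_surj_on f_inv_into_f lessThan_iff)

lemma pos_eq_iff [simp]: "pos i = pos j \<longleftrightarrow> i = j"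
  using inj_pos by (auto dest: injD)

lemma coord_eq_iff: "i < CARD('a) \<Longrightarrow> coord i = (j::'a::{finite,wellorder}) \<longleftrightarrow> i = pos j"
  by auto

section \<open>Alternating forms\<close>

lemma alternating_cong: "alternating k \<omega> \<Longrightarrow> (\<And>i. i < k \<Longrightarrow> v i = w i) \<Longrightarrow> \<omega> v = \<omega> w"
  unfolding alternating_def by blast

lemma alternating_linear: "alternating k \<omega> \<Longrightarrow> i < k \<Longrightarrow> linear (\<lambda>u. \<omega> (v(i := u)))"
  unfolding alternating_def by blast

lemma alternating_eq_0: "alternating k \<omega> \<Longrightarrow> i < k \<Longrightarrow> j < k \<Longrightarrow> i \<noteq> j \<Longrightarrow> v i = v j \<Longrightarrow> \<omega> v = 0"
  unfolding alternating_def by blast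

lemma alternating_zero:
  assumes "alternating k \<omega>" "i < k" "v i = 0" shows "\<omega> v = 0"
  using linear_0[OF alternating_linear[OF assms(1,2), of v]] assms(3) by (metis fun_upd_triv)

text \<open>Polarisation: with \<open>v i + v j\<close> in both slots the form vanishes, and of the
  four terms of the expansion only the two with distinct entries survive.\<close>

lemma alternating_transpose:
  assumes "alternating k \<omega>" "i < k" "j < k" "i \<noteq> j"
  shows "\<omega> (v \<circ> Transposition.transpose i j) = - \<omega> v"
proof -
  let ?s = "v i + v j"
  have L: "linear (\<lambda>u. \<omega> ((v(j := w))(i := u)))" "linear (\<lambda>u. \<omega> ((v(i := w))(j := u)))" for w
    using assms alternating_linear by blast+
  have "0 = \<omega> (v(i := ?s, j := ?s))"
    using assms by (intro alternating_eq_0[symmetric, of k _ i j]) auto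
  also have "\<dots> = \<omega> (v(i := ?s, j := v i)) + \<omega> (v(i := ?s, j := v j))"
    using linear_add[OF L(2)[of ?s]] by simp
  also have "v(i := ?s, j := v i) = v(j := v i, i := ?s)"
    using assms(4) by (rule fun_upd_twist)
  also have "\<omega> \<dots> = \<omega> (v(j := v i, i := v i)) + \<omega> (v(j := v i, i := v j))"
    using linear_add[OF L(1)[of "v i"]] by simp
  also have "\<omega> (v(j := v i, i := v i)) = 0"
    using assms by (intro alternating_eq_0[of k _ i j]) auto
  also have "v(i := ?s, j := v j) = v(j := v j, i := ?s)"
    using assms(4) by (rule fun_upd_twist)
  also have "\<omega> \<dots> = \<omega> (v(j := v j, i := v i)) + \<omega> (v(j := v j, i := v j))"
    using linear_add[OF L(1)[of "v j"]] by simp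
  also have "\<omega> (v(j := v j, i := v j)) = 0"
    using assms by (intro alternating_eq_0[of k _ i j]) auto
  also have "v(j := v j, i := v i) = v" by auto
  also have "v(j := v i, i := v j) = v \<circ> Transposition.transpose i j"
    using assms(4) by (auto simp: fun_eq_iff Transposition.transpose_def)
  finally show ?thesis by (simp add: o_def)
qed

text \<open>The shifted window is the shape in which the second factor of a wedge sees its
  arguments. One more transposition amounts to composing \<open>v\<close> with it, hence the
  induction with \<open>v\<close> arbitrary.\<close>

lemma alternating_permutes:
  assumes alt: "alternating b \<omega>" and "\<tau> permutes {a..<a+b}"
  shows "\<omega> (\<lambda>i. v (\<tau> (a + i))) = of_int (sign \<tau>) * \<omega> (\<lambda>i. v (a + i))"
  using assms(2) finite_atLeastLessThan
proof (induction arbitrary: v rule: permutes_induct)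
  case id
  then show ?case by simp
next
  case (swap x y p)
  let ?t = "Transposition.transpose x y"
  have "permutation p" using swap by (auto simp: permutation_permutes)
  then have sg: "sign (?t \<circ> p) = - sign p"
    using swap by (simp add: sign_compose permutation_swap_id sign_swap_id)
  have "\<omega> (\<lambda>i. v ((?t \<circ> p) (a + i))) = of_int (sign p) * \<omega> (\<lambda>i. (v \<circ> ?t) (a + i))"
    using swap.IH[of "v \<circ> ?t"] by (simp add: o_def)
  also have "\<omega> (\<lambda>i. (v \<circ> ?t) (a + i)) = \<omega> ((\<lambda>i. v (a + i)) \<circ> Transposition.transpose (x - a) (y - a))"
    using swap by (intro alternating_cong[OF alt]) (auto simp: Transposition.transpose_def)
  also have "\<dots> = - \<omega> (\<lambda>i. v (a + i))"
    using swap by (intro alternating_transpose[OF alt]) auto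
  finally show ?case unfolding sg by simp
qed

lemma alternating_permutes0:
  assumes "alternating k \<omega>" and "\<pi> permutes {..<k}"
  shows "\<omega> (\<lambda>i. v (\<pi> i)) = of_int (sign \<pi>) * \<omega> v"
  using alternating_permutes[of k \<omega> \<pi> 0 v] assms by (simp add: atLeast0LessThan)

text \<open>A permutation that sends an index below \<open>a\<close> into the second block puts a
  vector of \<open>K\<close> into \<beta> and contributes 0. The others are products of a
  permutation of each block. Both signs occur twice and cancel, so all of these contribute the same,
  and their number \<open>fact a * fact b\<close> is the normalisation in \<open>wedge\<close>. In
  the applications \<open>K\<close> is the kernel of a differential.\<close>

lemma wedge_eval:
  assumes altb: "alternating a \<beta>" and altx: "alternating b \<xi>"
    and zero: "\<And>w i. i < a \<Longrightarrow> w i \<in> K \<Longrightarrow> \<beta> w = 0"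
    and K: "\<And>i. a \<le> i \<Longrightarrow> i < a + b \<Longrightarrow> v i \<in> K"
  shows "wedge a b \<beta> \<xi> v = \<beta> v * \<xi> (\<lambda>i. v (a + i))"
proof -
  let ?P = "{\<pi>. \<pi> permutes {..<a}}" and ?T = "{\<tau>. \<tau> permutes {a..<a+b}}"
  let ?S = "{\<sigma>. \<sigma> permutes {..<a+b}}"
  let ?G = "{\<sigma>. \<sigma> permutes {..<a+b} \<and> (\<forall>i<a. \<sigma> i < a)}"
  let ?f = "\<lambda>\<sigma>. of_int (sign \<sigma>) * \<beta> (\<lambda>i. v (\<sigma> i)) * \<xi> (\<lambda>i. v (\<sigma> (a + i)))"
  have vanish: "?f \<sigma> = 0" if mem: "\<sigma> \<in> ?S - ?G" for \<sigma>
  proof -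
    obtain i where i: "i < a" "\<not> \<sigma> i < a" and s: "\<sigma> permutes {..<a+b}" using mem by blast
    have "\<sigma> i < a + b" using permutes_in_image[OF s, of i] i by simp
    then have "v (\<sigma> i) \<in> K" using i K by auto
    then show ?thesis using zero[OF i(1), of "\<lambda>i. v (\<sigma> i)"] by simp
  qed
  have bij: "bij_betw (\<lambda>(\<pi>,\<tau>). \<pi> \<circ> \<tau>) (?P \<times> ?T) ?G"
  proof (rule bij_betw_byWitness[where f' = "\<lambda>\<sigma>. (\<lambda>i. if i < a then \<sigma> i else i, \<lambda>i. if i < a then i else \<sigma> i)"])
    have fix1: "\<pi> i = i" if "\<pi> permutes {..<a}" "\<not> i < a" for \<pi> i
      using that by (auto simp: permutes_def)
    have fix2: "\<tau> i = i" if "\<tau> permutes {a..<a+b}" "i < a" for \<tau> i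
      using that by (auto simp: permutes_def)
    have ge: "a \<le> \<tau> i" if "\<tau> permutes {a..<a+b}" "\<not> i < a" for \<tau> i
      using that permutes_in_image[OF that(1), of i] by (cases "i < a+b") (auto simp: permutes_def)
    show "\<forall>x\<in>?P \<times> ?T. (\<lambda>\<sigma>. (\<lambda>i. if i < a then \<sigma> i else i, \<lambda>i. if i < a then i else \<sigma> i)) (case x of (\<pi>, \<tau>) \<Rightarrow> \<pi> \<circ> \<tau>) = x"
    proof
      fix x assume "x \<in> ?P \<times> ?T"
      then obtain \<pi> \<tau> where x: "x = (\<pi>, \<tau>)" and pt: "\<pi> permutes {..<a}" "\<tau> permutes {a..<a+b}" by auto
      have "\<And>i. i < a \<Longrightarrow> \<pi> (\<tau> i) = \<pi> i" "\<And>i. \<not> i < a \<Longrightarrow> \<pi> (\<tau> i) = \<tau> i"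
        using fix1[OF pt(1)] fix2[OF pt(2)] ge[OF pt(2)] by (auto simp: not_less)
      then show "(\<lambda>\<sigma>. (\<lambda>i. if i < a then \<sigma> i else i, \<lambda>i. if i < a then i else \<sigma> i)) (case x of (\<pi>, \<tau>) \<Rightarrow> \<pi> \<circ> \<tau>) = x"
        unfolding x using fix1[OF pt(1)] fix2[OF pt(2)] by (auto simp: fun_eq_iff)
    qed
    \<comment> \<open>An injection of the finite first block into itself is onto, so no index of the
      second block can be sent there.\<close>
    have gg: "a \<le> \<sigma> i" if "\<sigma> \<in> ?G" "a \<le> i" for \<sigma> i
    proof (rule ccontr)
      assume c: "\<not> a \<le> \<sigma> i"
      have inj: "inj \<sigma>" using that permutes_inj by auto
      have "\<sigma> ` {..<a} \<subseteq> {..<a}" using that by auto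
      then have "\<sigma> ` {..<a} = {..<a}"
        using inj by (intro endo_inj_surj) (auto simp: inj_on_def)
      then obtain j where "j < a" "\<sigma> j = \<sigma> i" using c by (metis imageE lessThan_iff not_le)
      then show False using inj that by (auto dest: injD)
    qed
    show "\<forall>\<sigma>\<in>?G. (case (\<lambda>i. if i < a then \<sigma> i else i, \<lambda>i. if i < a then i else \<sigma> i) of (\<pi>, \<tau>) \<Rightarrow> \<pi> \<circ> \<tau>) = \<sigma>"
    proof
      fix \<sigma> assume "\<sigma> \<in> ?G"
      from gg[OF this] show "(case (\<lambda>i. if i < a then \<sigma> i else i, \<lambda>i. if i < a then i else \<sigma> i) of (\<pi>, \<tau>) \<Rightarrow> \<pi> \<circ> \<tau>) = \<sigma>"
        by (force simp: fun_eq_iff not_less)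
    qed
    show "(\<lambda>(\<pi>,\<tau>). \<pi> \<circ> \<tau>) ` (?P \<times> ?T) \<subseteq> ?G"
    proof clarsimp
      fix \<pi> \<tau> assume pt: "\<pi> permutes {..<a}" "\<tau> permutes {a..<a+b}"
      have "\<pi> permutes {..<a+b}" "\<tau> permutes {..<a+b}"
        using pt by (auto elim: permutes_subset)
      then show "\<pi> \<circ> \<tau> permutes {..<a + b} \<and> (\<forall>i<a. \<pi> (\<tau> i) < a)"
        using pt fix2[OF pt(2)] permutes_in_image[OF pt(1)] by (auto intro: permutes_compose)
    qed
    show "(\<lambda>\<sigma>. (\<lambda>i. if i < a then \<sigma> i else i, \<lambda>i. if i < a then i else \<sigma> i)) ` ?G \<subseteq> ?P \<times> ?T"
    proof (rule image_subsetI)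
      fix \<sigma> assume "\<sigma> \<in> ?G"
      then have s: "\<sigma> permutes {..<a+b}" "\<forall>i<a. \<sigma> i < a" by auto
      then have g: "\<And>i. a \<le> i \<Longrightarrow> a \<le> \<sigma> i" using gg by auto
      have inj: "inj \<sigma>" using s permutes_inj by auto
      show "(\<lambda>i. if i < a then \<sigma> i else i, \<lambda>i. if i < a then i else \<sigma> i) \<in> ?P \<times> ?T"
      proof (intro SigmaI CollectI)
        have im: "\<sigma> ` {..<a} = {..<a}"
          using inj s by (intro endo_inj_surj) (auto simp: inj_on_def)
        show "(\<lambda>i. if i < a then \<sigma> i else i) permutes {..<a}"
        proof (rule bij_imp_permutes)
          have "bij_betw \<sigma> {..<a} {..<a}" using im inj by (auto simp: bij_betw_def inj_on_def)
          then show "bij_betw (\<lambda>i. if i < a then \<sigma> i else i) {..<a} {..<a}"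
            by (rule bij_betw_cong[THEN iffD1, rotated]) auto
        qed auto
        have "\<sigma> ` {a..<a+b} \<subseteq> {a..<a+b}" using g permutes_in_image[OF s(1)] by auto
        then have im2: "\<sigma> ` {a..<a+b} = {a..<a+b}"
          using inj by (intro endo_inj_surj) (auto simp: inj_on_def)
        show "(\<lambda>i. if i < a then i else \<sigma> i) permutes {a..<a+b}"
        proof (rule bij_imp_permutes)
          have "bij_betw \<sigma> {a..<a+b} {a..<a+b}" using im2 inj by (auto simp: bij_betw_def inj_on_def)
          then show "bij_betw (\<lambda>i. if i < a then i else \<sigma> i) {a..<a+b} {a..<a+b}"
            by (rule bij_betw_cong[THEN iffD1, rotated]) auto
          show "(if i < a then i else \<sigma> i) = i" if "i \<notin> {a..<a+b}" for i
            using that s(1) by (auto simp: permutes_def)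
        qed
      qed
    qed
  qed
  have val: "?f (\<pi> \<circ> \<tau>) = \<beta> v * \<xi> (\<lambda>i. v (a + i))"
    if pt: "\<pi> permutes {..<a}" "\<tau> permutes {a..<a+b}" for \<pi> \<tau>
  proof -
    have perm: "permutation \<pi>" "permutation \<tau>" using pt by (auto simp: permutation_permutes)
    have "\<beta> (\<lambda>i. v ((\<pi> \<circ> \<tau>) i)) = \<beta> (\<lambda>i. v (\<pi> i))"
      using pt by (intro alternating_cong[OF altb]) (auto simp: permutes_def)
    also have "\<dots> = of_int (sign \<pi>) * \<beta> v" by (rule alternating_permutes0[OF altb pt(1)])
    finally have 1: "\<beta> (\<lambda>i. v ((\<pi> \<circ> \<tau>) i)) = of_int (sign \<pi>) * \<beta> v" .
    have "\<pi> (\<tau> (a + i)) = \<tau> (a + i)" if "i < b" for i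
      using pt permutes_in_image[OF pt(2), of "a+i"] that by (auto simp: permutes_def)
    then have "\<xi> (\<lambda>i. v ((\<pi> \<circ> \<tau>) (a + i))) = \<xi> (\<lambda>i. v (\<tau> (a + i)))"
      by (intro alternating_cong[OF altx]) auto
    also have "\<dots> = of_int (sign \<tau>) * \<xi> (\<lambda>i. v (a + i))" by (rule alternating_permutes[OF altx pt(2)])
    finally have 2: "\<xi> (\<lambda>i. v ((\<pi> \<circ> \<tau>) (a + i))) = of_int (sign \<tau>) * \<xi> (\<lambda>i. v (a + i))" .
    have "sign (\<pi> \<circ> \<tau>) = sign \<pi> * sign \<tau>" by (rule sign_compose[OF perm])
    moreover have "(of_int (sign \<pi>) * of_int (sign \<pi>) :: real) = 1" "(of_int (sign \<tau>) * of_int (sign \<tau>) :: real) = 1"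
      by (auto simp: sign_def)
    ultimately show ?thesis unfolding 1 2 by (simp add: algebra_simps)
  qed
  have finS: "finite ?S" by (simp add: finite_permutations)
  have "sum ?f ?S = sum ?f ?G"
    using finS vanish by (intro sum.mono_neutral_right) auto
  also have "\<dots> = (\<Sum>(\<pi>,\<tau>)\<in>?P \<times> ?T. ?f (\<pi> \<circ> \<tau>))"
    using sum.reindex_bij_betw[OF bij, of ?f] by (simp add: case_prod_unfold)
  also have "\<dots> = (\<Sum>(\<pi>,\<tau>)\<in>?P \<times> ?T. \<beta> v * \<xi> (\<lambda>i. v (a + i)))"
    using val by (intro sum.cong) auto
  also have "\<dots> = real (card (?P \<times> ?T)) * (\<beta> v * \<xi> (\<lambda>i. v (a + i)))"
    by (simp add: case_prod_unfold)
  also have "card (?P \<times> ?T) = fact a * fact b"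
    using card_permutations[of "{..<a}"] card_permutations[of "{a..<a+b}"] by (simp add: card_cartesian_product)
  finally show ?thesis unfolding wedge_def by simp
qed

section \<open>The determinant form, matrices acting on forms, and forms of top degree\<close>

definition vdet :: "(nat \<Rightarrow> (real,'m::{finite,wellorder}) vec) \<Rightarrow> real" where
  "vdet v = det (\<chi> i j. v (pos j) $ i)"

lemma vdet_rows:
  fixes v :: "nat \<Rightarrow> (real,'m::{finite,wellorder}) vec"
  shows "vdet v = det (\<chi> j. v (pos j))"
proof -
  have "(\<chi> i j. v (pos j) $ i) = transpose ((\<chi> j. v (pos j)) :: ((real,'m) vec,'m) vec)" by (simp add: transpose_def vec_eq_iff)
  then show ?thesis by (simp add: vdet_def)
qed

lemma alternating_vdet: "alternating CARD('m) (vdet :: (nat \<Rightarrow> (real,'m::{finite,wellorder}) vec) \<Rightarrow> real)"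
  unfolding alternating_def
proof (intro conjI allI impI)
  fix v :: "nat \<Rightarrow> (real,'m) vec" and l assume l: "l < CARD('m)"
  have eq: "vdet (v(l := u)) = det (\<chi> j. if j = coord l then u else v (pos j))" for u
    unfolding vdet_rows using l by (intro arg_cong[where f=det]) (auto simp: vec_eq_iff coord_eq_iff)
  show "linear (\<lambda>u. vdet (v(l := u)))"
    unfolding eq
  proof (rule linearI)
    fix x y :: "(real,'m) vec" and r :: real
    show "det (\<chi> j. if j = coord l then x + y else v (pos j)) =
       det (\<chi> j. if j = coord l then x else v (pos j)) + det (\<chi> j. if j = coord l then y else v (pos j))"
      by (rule det_row_add)
    show "det (\<chi> j. if j = coord l then r *\<^sub>R x else v (pos j)) =
       r *\<^sub>R det (\<chi> j. if j = coord l then x else v (pos j))"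
      using det_row_mul[of "coord l :: 'm" r "\<lambda>_. x" "\<lambda>j. v (pos j)"] unfolding scalar_mult_eq_scaleR by simp
  qed
next
  fix v :: "nat \<Rightarrow> (real,'m) vec" and i j
  assume "i < CARD('m)" "j < CARD('m)" "i \<noteq> j \<and> v i = v j"
  then show "vdet v = 0"
    unfolding vdet_rows
    by (intro det_identical_rows[of "coord i" "coord j"]) (auto simp: row_def coord_eq_iff)
next
  fix v w :: "nat \<Rightarrow> (real,'m) vec" assume "\<forall>i<CARD('m). v i = w i"
  then show "vdet v = vdet w" by (simp add: vdet_def)
qed

lemma vdet_linear:
  fixes A :: "(real,'m::{finite,wellorder}) vec \<Rightarrow> (real,'m::{finite,wellorder}) vec"
  assumes "linear A" shows "vdet (\<lambda>i. A (v i)) = det (matrix A) * vdet v"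
proof -
  have "((\<chi> i j. A (v (pos j)) $ i) :: ((real,'m) vec,'m) vec) = matrix A ** (\<chi> i j. v (pos j) $ i)"
    (is "?L = ?R")
  proof -
    have "?L $ i $ j = ?R $ i $ j" for i j
    proof -
      have "A (v (pos j)) = matrix A *v v (pos j)" using assms by (simp add: matrix_works)
      then show ?thesis by (simp add: matrix_matrix_mult_def matrix_vector_mult_def)
    qed
    then show ?thesis by (simp add: vec_eq_iff)
  qed
  then show ?thesis by (simp add: vdet_def det_mul)
qed

lemma vdet_axis [simp]: "vdet (\<lambda>i. axis (coord i) 1 :: (real,'m::{finite,wellorder}) vec) = 1"
proof -
  have "(\<chi> i j. axis (coord (pos j)) 1 $ i :: ((real,'m) vec,'m) vec) = mat 1"
    by (auto simp: vec_eq_iff mat_def axis_def)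
  then show ?thesis by (simp add: vdet_def del: coord_pos)
qed

lemma alternating_scale:
  assumes alt: "alternating k \<omega>" and "J \<subseteq> {..<k}"
  shows "\<omega> (\<lambda>i. if i \<in> J then c i *\<^sub>R w i else w i) = prod c J * \<omega> w"
proof -
  have "finite J" using assms finite_subset by blast
  then show ?thesis using assms(2)
  proof (induction J)
    case empty then show ?case by simp
  next
    case (insert j J)
    let ?v = "\<lambda>i. if i \<in> J then c i *\<^sub>R w i else w i"
    have "(\<lambda>i. if i \<in> insert j J then c i *\<^sub>R w i else w i) = ?v(j := c j *\<^sub>R w j)"
      by auto
    then have "\<omega> (\<lambda>i. if i \<in> insert j J then c i *\<^sub>R w i else w i) = \<omega> (?v(j := c j *\<^sub>R w j))"
      by (rule arg_cong)
    also have "\<dots> = c j * \<omega> (?v(j := w j))"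
      using linear_cmul[OF alternating_linear[OF alt], of j ?v] insert.prems by simp
    also have "?v(j := w j) = ?v" using insert.hyps by auto
    finally show ?case using insert by simp
  qed
qed

text \<open>Induction over elementary matrices. Quantifying over \<open>B\<close> is what makes the
  product case work: the rows of \<open>A ** A'\<close> are the rows of \<open>A\<close> transformed
  by \<open>transpose A'\<close>, and this factor is absorbed into \<open>B\<close>.\<close>

lemma alternating_matrix:
  fixes \<omega> :: "(nat \<Rightarrow> (real,'m::{finite,wellorder}) vec) \<Rightarrow> real" and A :: "((real,'m::{finite,wellorder}) vec,'m) vec"
  assumes alt: "alternating CARD('m) \<omega>"
  shows "\<omega> (\<lambda>i. B *v (A $ coord i)) = det A * \<omega> (\<lambda>i. B *v axis (coord i) 1)"
proof -
  have "\<forall>B. \<omega> (\<lambda>i. B *v (A $ coord i)) = det A * \<omega> (\<lambda>i. B *v axis (coord i) 1)"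
  proof (induct A rule: induct_matrix_elementary[case_names mult zero_row diagonal swap1 idplus])
    case (mult A A')
    show ?case
    proof
      fix B :: "((real,'m) vec,'m) vec"
      have "(A ** A') $ j = transpose A' *v (A $ j)" for j
        by (simp add: vec_eq_iff matrix_matrix_mult_def matrix_vector_mult_def transpose_def mult.commute)
      then have "\<omega> (\<lambda>i. B *v ((A ** A') $ coord i)) = \<omega> (\<lambda>i. (B ** transpose A') *v (A $ coord i))"
        by (simp only: matrix_vector_mul_assoc)
      also have "\<dots> = det A * \<omega> (\<lambda>i. (B ** transpose A') *v axis (coord i) 1)"
        using mult(1) by blast
      also have "(\<lambda>i. (B ** transpose A') *v axis (coord i) 1) = (\<lambda>i. B *v (A' $ coord i))"
      proof -
        have "transpose A' *v axis j 1 = A' $ j" for j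
          by (simp add: matrix_vector_mul_component vec_eq_iff matrix_vector_mult_basis column_def transpose_def)
        then show ?thesis by (simp flip: matrix_vector_mul_assoc)
      qed
      also have "\<omega> \<dots> = det A' * \<omega> (\<lambda>i. B *v axis (coord i) 1)" using mult(2) by blast
      finally show "\<omega> (\<lambda>i. B *v ((A ** A') $ coord i)) = det (A ** A') * \<omega> (\<lambda>i. B *v axis (coord i) 1)"
        by (simp add: det_mul)
    qed
  next
    case (zero_row A i)
    have "A $ i = 0" using zero_row by (simp add: row_def vec_eq_iff)
    then have "\<omega> (\<lambda>i. B *v (A $ coord i)) = 0" for B
      by (intro alternating_zero[OF alt, of "pos i"]) auto
    moreover have "det A = 0" using zero_row by (rule det_zero_row)
    ultimately show ?case by simp
  next
    case (diagonal A)
    have A: "A $ j = A $ j $ j *\<^sub>R axis j 1" for j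
      using diagonal by (auto simp: vec_eq_iff axis_def)
    show ?case
    proof
      fix B :: "((real,'m) vec,'m) vec"
      have "\<omega> (\<lambda>i. B *v (A $ coord i)) =
          \<omega> (\<lambda>i. if i \<in> {..<CARD('m)} then (A $ coord i $ coord i) *\<^sub>R (B *v axis (coord i) 1) else B *v axis (coord i) 1)"
        by (intro alternating_cong[OF alt]) (subst A, simp add: matrix_vector_mult_scaleR)
      also have "\<dots> = (\<Prod>i<CARD('m). A $ coord i $ coord i) * \<omega> (\<lambda>i. B *v axis (coord i) 1)"
        by (rule alternating_scale[OF alt]) simp
      also have "(\<Prod>i<CARD('m). A $ coord i $ coord i) = (\<Prod>j\<in>UNIV. A $ j $ j)"
        using prod.reindex_bij_betw[OF bij_betw_pos[where 'a='m], of "\<lambda>i. A $ coord i $ coord i"] by simp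
      also have "\<dots> = det A" using diagonal by (simp add: det_diagonal)
      finally show "\<omega> (\<lambda>i. B *v (A $ coord i)) = det A * \<omega> (\<lambda>i. B *v axis (coord i) 1)" .
    qed
  next
    case (swap1 a b)
    let ?t = "Transposition.transpose a b"
    let ?A = "\<chi> i j. mat 1 $ i $ ?t j :: ((real,'m) vec,'m) vec"
    have det: "det ?A = -1"
      using det_permute_columns[of ?t "mat 1 :: ((real,'m) vec,'m) vec"] swap1
      by (simp add: permutes_swap_id sign_swap_id)
    have A: "?A $ coord (pos i) = axis (coord (Transposition.transpose (pos a) (pos b) (pos i))) 1" for i :: 'm
      by (auto simp: vec_eq_iff mat_def axis_def Transposition.transpose_def)
    show ?case
    proof
      fix B :: "((real,'m) vec,'m) vec"
      have "\<omega> (\<lambda>i. B *v (?A $ coord i)) =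
          \<omega> ((\<lambda>i. B *v axis (coord i) 1) \<circ> Transposition.transpose (pos a) (pos b))"
      proof (intro alternating_cong[OF alt])
        fix i assume "i < CARD('m)"
        then show "B *v (?A $ coord i) = ((\<lambda>i. B *v axis (coord i) 1) \<circ> Transposition.transpose (pos a) (pos b)) i"
          using A[of "coord i"] by simp
      qed
      also have "\<dots> = - \<omega> (\<lambda>i. B *v axis (coord i) 1)"
        using swap1 by (intro alternating_transpose[OF alt]) auto
      finally show "\<omega> (\<lambda>i. B *v (?A $ coord i)) = det ?A * \<omega> (\<lambda>i. B *v axis (coord i) 1)"
        by (simp add: det)
    qed
  next
    case (idplus a b c)
    let ?A = "\<chi> i j. if i = a \<and> j = b then c else of_bool (i = j) :: ((real,'m) vec,'m) vec"
    have A: "?A $ i = (if i = a then axis a 1 + c *\<^sub>R axis b 1 else axis i 1)" for i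
      using idplus by (auto simp: vec_eq_iff axis_def)
    have "det ?A = det (\<chi> k. if k = a then row a (mat 1) + c *s row b (mat 1 :: ((real,'m) vec,'m) vec) else row k (mat 1))"
      using idplus by (intro arg_cong[where f=det]) (auto simp: vec_eq_iff row_def mat_def)
    also have "\<dots> = 1" using det_row_operation[OF idplus, of "mat 1"] by simp
    finally have det: "det ?A = 1" .
    show ?case
    proof
      fix B :: "((real,'m) vec,'m) vec"
      let ?w = "\<lambda>i. B *v axis (coord i) 1"
      have "\<omega> (\<lambda>i. B *v (?A $ coord i)) = \<omega> (?w(pos a := ?w (pos a) + c *\<^sub>R ?w (pos b)))"
      proof (intro alternating_cong[OF alt])
        fix i assume i: "i < CARD('m)"
        show "B *v (?A $ coord i) = (?w(pos a := ?w (pos a) + c *\<^sub>R ?w (pos b))) i"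
        proof (cases "i = pos a")
          case True
          then have "B *v (?A $ coord i) = B *v (axis a 1 + c *\<^sub>R axis b 1)"
            by (simp only: A coord_pos if_True refl)
          with True show ?thesis by (simp add: matrix_vector_right_distrib matrix_vector_mult_scaleR)
        next
          case False
          then have "coord i \<noteq> a" using i by (simp add: coord_eq_iff)
          then have "B *v (?A $ coord i) = B *v axis (coord i) 1"
            by (simp only: A if_False)
          with False show ?thesis by simp
        qed
      qed
      also have "\<dots> = \<omega> (?w(pos a := ?w (pos a))) + c * \<omega> (?w(pos a := ?w (pos b)))"
        using linear_add[OF alternating_linear[OF alt, of "pos a" ?w]]
          linear_cmul[OF alternating_linear[OF alt, of "pos a" ?w]] by simp
      also have "\<omega> (?w(pos a := ?w (pos b))) = 0"
        using idplus by (intro alternating_eq_0[OF alt, of "pos a" "pos b"]) auto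
      also have "?w(pos a := ?w (pos a)) = ?w" by (rule fun_upd_triv)
      finally show "\<omega> (\<lambda>i. B *v (?A $ coord i)) = det ?A * \<omega> ?w"
        unfolding det by simp
    qed
  qed
  then show ?thesis by blast
qed

text \<open>Forms of top degree are a line spanned by \<open>vdet\<close>, so two of them agree
  everywhere once they agree on one basis; \<open>exists_quotient\<close> uses the lemma in this
  way.\<close>

lemma alternating_top:
  fixes v :: "nat \<Rightarrow> (real,'m::{finite,wellorder}) vec"
  assumes alt: "alternating CARD('m) \<omega>"
  shows "\<omega> v = vdet v * \<omega> (\<lambda>i. axis (coord i) 1)"
proof -
  have "\<omega> v = \<omega> (\<lambda>i. mat 1 *v (((\<chi> j. v (pos j)) :: ((real,'m) vec,'m) vec) $ coord i))"
    by (intro alternating_cong[OF alt]) simp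
  also have "\<dots> = vdet v * \<omega> (\<lambda>i. axis (coord i) 1)"
    by (subst alternating_matrix[OF alt]) (simp add: vdet_rows)
  finally show ?thesis .
qed

lemma alternating_compose_linear:
  fixes A :: "'a::real_vector \<Rightarrow> 'b::real_vector"
  assumes alt: "alternating k \<omega>" and "linear A"
  shows "alternating k (\<lambda>v. \<omega> (\<lambda>i. A (v i)))"
  unfolding alternating_def
proof (intro conjI allI impI)
  fix v i assume "i < k"
  have "(\<lambda>u. \<omega> (\<lambda>j. A ((v(i := u)) j))) = (\<lambda>u. \<omega> ((\<lambda>j. A (v j))(i := u))) \<circ> A"
    by (auto simp: fun_eq_iff intro!: arg_cong[where f=\<omega>])
  then show "linear (\<lambda>u. \<omega> (\<lambda>j. A ((v(i := u)) j)))"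
    using linear_compose[OF assms(2) alternating_linear[OF alt \<open>i < k\<close>]] by simp
next
  fix v :: "nat \<Rightarrow> 'a" and i j assume "i < k" "j < k" "i \<noteq> j \<and> v i = v j"
  then show "\<omega> (\<lambda>i. A (v i)) = 0" by (intro alternating_eq_0[OF alt, of i j]) auto
next
  fix v w :: "nat \<Rightarrow> 'a" assume "\<forall>i<k. v i = w i"
  then show "\<omega> (\<lambda>i. A (v i)) = \<omega> (\<lambda>i. A (w i))" by (intro alternating_cong[OF alt]) auto
qed

lemma alternating_cmult:
  assumes "alternating k \<omega>" shows "alternating k (\<lambda>v. c * \<omega> v)"
  using assms unfolding alternating_def
  by (auto simp: linear_iff algebra_simps)

text \<open>Linearity in slot \<open>l\<close>: each permutation puts the index \<open>l\<close>
  into exactly one argument of exactly one factor. Vanishing: when \<open>v i = v j\<close>,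
  composing a permutation with the transposition of \<open>i\<close> and \<open>j\<close> preserves
  both factors and reverses the sign, so the sum equals its own negative.\<close>

lemma alternating_wedge:
  assumes altb: "alternating a \<beta>" and altx: "alternating b \<xi>"
  shows "alternating (a + b) (wedge a b \<beta> \<xi>)"
  unfolding alternating_def
proof (intro conjI allI impI)
  let ?f = "\<lambda>\<sigma> v. of_int (sign \<sigma>) * \<beta> (\<lambda>i. v (\<sigma> i)) * \<xi> (\<lambda>i. v (\<sigma> (a + i)))"
  fix v :: "nat \<Rightarrow> 'a" and l assume l: "l < a + b"
  have "linear (\<lambda>u. ?f \<sigma> (v(l := u)))" if \<sigma>: "\<sigma> permutes {..<a+b}" for \<sigma>
  proof -
    have inj: "inj \<sigma>" using \<sigma> permutes_inj by auto
    obtain j where j: "\<sigma> j = l" "j < a + b"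
      using \<sigma> l by (metis lessThan_iff permutes_in_image permutes_surj surjD)
    have iff: "\<sigma> i = l \<longleftrightarrow> i = j" for i using inj j by (auto dest: injD)
    show ?thesis
    proof (cases "j < a")
      case True
      have "?f \<sigma> (v(l := u)) = (of_int (sign \<sigma>) * \<xi> (\<lambda>i. v (\<sigma> (a + i)))) *\<^sub>R \<beta> ((\<lambda>i. v (\<sigma> i))(j := u))" for u
      proof -
        have "(\<lambda>i. (v(l := u)) (\<sigma> i)) = (\<lambda>i. v (\<sigma> i))(j := u)" using iff by auto
        moreover have "(\<lambda>i. (v(l := u)) (\<sigma> (a + i))) = (\<lambda>i. v (\<sigma> (a + i)))"
          using iff True by auto
        ultimately show ?thesis by simp
      qed
      then show ?thesis
        by (simp only: linear_compose_scale_right[OF alternating_linear[OF altb True]])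
    next
      case False
      then have jb: "j - a < b" using j by auto
      have "?f \<sigma> (v(l := u)) = (of_int (sign \<sigma>) * \<beta> (\<lambda>i. v (\<sigma> i))) *\<^sub>R \<xi> ((\<lambda>i. v (\<sigma> (a + i)))(j - a := u))" for u
      proof -
        have "(\<lambda>i. (v(l := u)) (\<sigma> (a + i))) = (\<lambda>i. v (\<sigma> (a + i)))(j - a := u)" using iff False by (auto simp: fun_eq_iff)
        moreover have "\<beta> (\<lambda>i. (v(l := u)) (\<sigma> i)) = \<beta> (\<lambda>i. v (\<sigma> i))"
          using iff False by (intro alternating_cong[OF altb]) auto
        ultimately show ?thesis by simp
      qed
      then show ?thesis
        by (simp only: linear_compose_scale_right[OF alternating_linear[OF altx jb]])
    qed
  qed
  then have "linear (\<lambda>u. \<Sum>\<sigma> | \<sigma> permutes {..<a+b}. ?f \<sigma> (v(l := u)))"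
    by (intro linear_compose_sum ballI) auto
  from linear_compose_scale_right[OF this, of "1 / (fact a * fact b)"]
  show "linear (\<lambda>u. wedge a b \<beta> \<xi> (v(l := u)))"
    unfolding wedge_def by simp
next
  let ?f = "\<lambda>\<sigma> v. of_int (sign \<sigma>) * \<beta> (\<lambda>i. v (\<sigma> i)) * \<xi> (\<lambda>i. v (\<sigma> (a + i)))"
  fix v :: "nat \<Rightarrow> 'a" and i j assume ij: "i < a + b" "j < a + b" "i \<noteq> j \<and> v i = v j"
  let ?t = "Transposition.transpose i j" and ?S = "{\<sigma>. \<sigma> permutes {..<a+b}}"
  have t: "?t permutes {..<a+b}" using ij by (intro permutes_swap_id) auto
  have vt: "v (?t x) = v x" for x using ij by (auto simp: Transposition.transpose_def)
  have neg: "?f (?t \<circ> \<sigma>) v = - ?f \<sigma> v" if "\<sigma> \<in> ?S" for \<sigma>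
  proof -
    have "permutation \<sigma>" using that by (auto simp: permutation_permutes)
    then have sg: "sign (?t \<circ> \<sigma>) = - sign \<sigma>"
      using ij by (simp add: sign_compose permutation_swap_id sign_swap_id)
    show ?thesis unfolding sg by (simp add: vt)
  qed
  have "(\<Sum>\<sigma>\<in>?S. ?f \<sigma> v) = (\<Sum>\<sigma>\<in>?S. ?f (?t \<circ> \<sigma>) v)"
    by (rule setum_permutations_compose_left[OF t])
  also have "\<dots> = (\<Sum>\<sigma>\<in>?S. - ?f \<sigma> v)" using neg by (intro sum.cong refl) blast
  also have "\<dots> = - (\<Sum>\<sigma>\<in>?S. ?f \<sigma> v)" by (rule sum_negf)
  finally show "wedge a b \<beta> \<xi> v = 0" unfolding wedge_def by simp
next
  fix v w :: "nat \<Rightarrow> 'a" assume vw: "\<forall>i<a + b. v i = w i"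
  have "\<beta> (\<lambda>i. v (\<sigma> i)) = \<beta> (\<lambda>i. w (\<sigma> i)) \<and> \<xi> (\<lambda>i. v (\<sigma> (a + i))) = \<xi> (\<lambda>i. w (\<sigma> (a + i)))"
    if "\<sigma> permutes {..<a+b}" for \<sigma>
    using that vw permutes_in_image[OF that]
    by (intro conjI alternating_cong[OF altb] alternating_cong[OF altx]) auto
  then show "wedge a b \<beta> \<xi> v = wedge a b \<beta> \<xi> w" unfolding wedge_def by simp
qed

section \<open>Splitting coordinates\<close>

text \<open>
  \<open>\<real>\<^sup>m\<close> is the product of \<open>\<real>\<^sup>n\<close> and \<open>\<real>\<^sup>m\<^sup>-\<^sup>n\<close>, where the elements of the latter are the sequences that vanish from
  index \<open>m - n\<close> on; \<open>base\<close> and \<open>fib\<close> are the projections, \<open>join\<close> is the inverse of their pairing.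
\<close>

definition base :: "(real,'m::{finite,wellorder}) vec \<Rightarrow> (real,'n::{finite,wellorder}) vec" where
  "base z = (\<chi> i. z $ coord (pos i))"

definition fib :: "nat \<Rightarrow> (real,'m::{finite,wellorder}) vec \<Rightarrow> nat \<Rightarrow> real" where
  "fib n z i = (if i < CARD('m) - n then z $ coord (n + i) else 0)"

definition join :: "(real,'n::{finite,wellorder}) vec \<Rightarrow> (nat \<Rightarrow> real) \<Rightarrow> (real,'m::{finite,wellorder}) vec" where
  "join u w = (\<chi> j. if pos j < CARD('n) then u $ coord (pos j) else w (pos j - CARD('n)))"

lemma base_join [simp]:
  assumes "CARD('n) \<le> CARD('m)"
  shows "base (join (u :: (real,'n::{finite,wellorder}) vec) w :: (real,'m::{finite,wellorder}) vec) = u"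
proof -
  have "pos (coord (pos i) :: 'm) = pos i" for i :: 'n
    using assms pos_less[of i] by (intro pos_coord) linarith
  then show ?thesis by (simp add: base_def join_def vec_eq_iff)
qed

lemma fib_join:
  assumes "CARD('n) \<le> CARD('m)" "\<And>i. i \<ge> CARD('m) - CARD('n) \<Longrightarrow> w i = 0"
  shows "fib CARD('n) (join (u :: (real,'n::{finite,wellorder}) vec) w :: (real,'m::{finite,wellorder}) vec) = w"
  using assms by (auto simp: fib_def join_def fun_eq_iff)

lemma join_base_fib [simp]:
  "join (base z :: (real,'n::{finite,wellorder}) vec) (fib CARD('n) z) = (z :: (real,'m::{finite,wellorder}) vec)"
proof -
  have "pos j - CARD('n) < CARD('m) - CARD('n)" if "\<not> pos j < CARD('n)" for j :: 'm
    using that pos_less[of j] by linarith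
  then show ?thesis by (auto simp: base_def join_def fib_def vec_eq_iff)
qed

lemma fib_ge [simp]: "i \<ge> CARD('m) - n \<Longrightarrow> fib n (z :: (real,'m::{finite,wellorder}) vec) i = 0"
  by (simp add: fib_def)

lemma linear_base: "linear (base :: (real,'m::{finite,wellorder}) vec \<Rightarrow> (real,'n::{finite,wellorder}) vec)"
  by (rule linearI) (auto simp: base_def vec_eq_iff)

lemma surj_base:
  assumes "CARD('n) \<le> CARD('m)"
  shows "surj (base :: (real,'m::{finite,wellorder}) vec \<Rightarrow> (real,'n::{finite,wellorder}) vec)"
  by (rule surjI[of _ "\<lambda>u. join u (\<lambda>_. 0)"]) (simp add: assms)

lemma linear_join_0: "linear (\<lambda>u :: (real,'n::{finite,wellorder}) vec. join u (\<lambda>_. 0) :: (real,'m::{finite,wellorder}) vec)"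
  by (rule linearI) (auto simp: join_def vec_eq_iff)

lemma linear_join_0_fib:
  "linear (\<lambda>b :: (real,'m::{finite,wellorder}) vec. join (0 :: (real,'n::{finite,wellorder}) vec) (fib CARD('n) b) :: (real,'m) vec)"
  by (rule linearI) (auto simp: join_def fib_def vec_eq_iff)

lemma join_add:
  "join (u :: (real,'n::{finite,wellorder}) vec) w = (join u (\<lambda>_. 0) + join (0 :: (real,'n::{finite,wellorder}) vec) w :: (real,'m::{finite,wellorder}) vec)"
  by (simp add: join_def vec_eq_iff)

lemma base_axis:
  assumes "CARD('n) \<le> CARD('m)" "i < CARD('n)"
  shows "base (axis (coord i) 1 :: (real,'m::{finite,wellorder}) vec) = (axis (coord i) 1 :: (real,'n::{finite,wellorder}) vec)"
proof -
  have "(coord (pos j) :: 'm) = coord i \<longleftrightarrow> j = coord i" for j :: 'n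
  proof -
    have "pos j < CARD('m)" "i < CARD('m)" using assms pos_less[of j] by linarith+
    then have "(coord (pos j) :: 'm) = coord i \<longleftrightarrow> pos j = i" by (metis pos_coord)
    also have "\<dots> \<longleftrightarrow> j = coord i" using assms(2) by auto
    finally show ?thesis .
  qed
  then show ?thesis by (auto simp: base_def axis_def vec_eq_iff)
qed

lemma base_axis_0:
  assumes "CARD('n) \<le> i" "i < CARD('m)"
  shows "base (axis (coord i) 1 :: (real,'m::{finite,wellorder}) vec) = (0 :: (real,'n::{finite,wellorder}) vec)"
proof -
  have "(coord (pos j) :: 'm) \<noteq> coord i" for j :: 'n
  proof -
    have "pos j < CARD('m)" "pos j \<noteq> i" using assms pos_less[of j] by linarith+
    then show ?thesis using assms(2) by (metis pos_coord)
  qed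
  then show ?thesis by (auto simp: base_def axis_def vec_eq_iff)
qed

text \<open>The kernel of \<open>D\<close> and the range of a right inverse \<open>R\<close> are
  complementary, and \<open>R\<close> is injective.\<close>

lemma dim_kernel_surj:
  fixes D :: "'a::euclidean_space \<Rightarrow> 'b::euclidean_space"
  assumes D: "linear D" "surj D"
  shows "dim {z. D z = 0} + DIM('b) = DIM('a)"
proof -
  obtain R where R: "linear R" "D \<circ> R = id"
    using linear_surjective_right_inverse[OF D] by blast
  have DR: "D (R x) = x" for x using fun_cong[OF R(2), of x] by simp
  have "dim {x + y |x y. x \<in> {z. D z = 0} \<and> y \<in> range R} + dim ({z. D z = 0} \<inter> range R)
      = dim {z. D z = 0} + dim (range R)"
    by (intro dim_sums_Int linear_subspace_kernel[OF D(1)] linear_subspace_image[OF R(1)] subspace_UNIV)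
  moreover have "{x + y |x y. x \<in> {z. D z = 0} \<and> y \<in> range R} = UNIV"
  proof (rule UNIV_eq_I[symmetric])
    fix z
    have "z = (z - R (D z)) + R (D z)" "D (z - R (D z)) = 0"
      by (simp_all add: linear_diff[OF D(1)] DR)
    then show "z \<in> {x + y |x y. x \<in> {z. D z = 0} \<and> y \<in> range R}"
      by (intro CollectI exI[of _ "z - R (D z)"] exI[of _ "R (D z)"]) simp
  qed
  moreover have "{z. D z = 0} \<inter> range R = {0}"
  proof (intro equalityI subsetI)
    fix x assume "x \<in> {z. D z = 0} \<inter> range R"
    then obtain y where "x = R y" "D x = 0" by blast
    then show "x \<in> {0}" using DR[of y] linear_0[OF R(1)] by simp
  next
    fix x :: 'a assume "x \<in> {0}"
    then have "x = R 0" "D x = 0" using linear_0[OF R(1)] linear_0[OF D(1)] by simp_all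
    then show "x \<in> {z. D z = 0} \<inter> range R" by blast
  qed
  moreover have "dim (range R) = DIM('b)"
  proof -
    have "inj R" by (rule inj_on_inverseI[of _ D]) (rule DR)
    then show ?thesis using dim_image_eq[OF R(1), of UNIV] by simp
  qed
  ultimately show ?thesis by simp
qed

text \<open>The kernels of \<open>D\<close> and of \<open>base\<close> have the same dimension, so
  there is an isomorphism \<open>f\<close> between them. \<open>B\<close> sends
  \<open>base z\<close> through a right inverse of \<open>D\<close>, and the remainder
  \<open>z - S (base z)\<close>, which lies in the kernel of \<open>base\<close>, through
  \<open>f\<close>. It serves twice: for a basis adapted to a quotient of forms, and for completing
  p to a coordinate system.\<close>

lemma straighten_linear:
  fixes D :: "(real,'m::{finite,wellorder}) vec \<Rightarrow> (real,'n::{finite,wellorder}) vec"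
  assumes D: "linear D" "surj D" and nm: "CARD('n) \<le> CARD('m)"
  obtains B where "linear B" "bij B" "\<And>z :: (real,'m) vec. D (B z) = base z"
proof -
  let ?b = "base :: (real,'m) vec \<Rightarrow> (real,'n) vec"
  obtain R where R: "linear R" "D \<circ> R = id"
    using linear_surjective_right_inverse[OF D] by blast
  have DR: "D (R x) = x" for x using fun_cong[OF R(2), of x] by simp
  have "dim {z. ?b z = 0} = dim {z. D z = 0}"
    using dim_kernel_surj[OF D] dim_kernel_surj[OF linear_base surj_base[OF nm]] by linarith
  then obtain f where f: "linear f" "f ` {z. ?b z = 0} = {z. D z = 0}" "inj_on f {z. ?b z = 0}"
    using subspace_isomorphism[OF linear_subspace_kernel[OF linear_base] linear_subspace_kernel[OF D(1)]] by blast
  obtain S where S: "linear S" "?b \<circ> S = id"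
    using linear_surjective_right_inverse[OF linear_base surj_base[OF nm]] by blast
  have bS: "?b (S x) = x" for x using fun_cong[OF S(2), of x] by simp
  define B where "B z = R (?b z) + f (z - S (?b z))" for z
  have lin: "linear B"
    unfolding B_def
    using linear_compose[OF linear_base R(1)] linear_compose[OF linear_base S(1)] 
    by (intro linear_compose_add linear_compose[OF _ f(1), unfolded o_def] linear_compose_sub)
      (simp_all add: o_def linear_id[unfolded id_def])
  have k: "?b (z - S (?b z)) = 0" for z
    using bS linear_diff[OF linear_base[where 'm='m and 'n='n]] by simp
  have D0: "D (f (z - S (?b z))) = 0" for z
    using k f(2) by blast
  have DB: "D (B z) = base z" for z
    unfolding B_def using linear_add[OF D(1)] DR D0 by simp
  have "z = 0" if "B z = 0" for z
  proof -
    have b0: "?b z = 0" using DB[of z] that linear_0[OF D(1)] by simp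
    then have "f z = 0" using that unfolding B_def
      by (simp add: linear_0[OF R(1)] linear_0[OF S(1)])
    then show "z = 0"
      using inj_onD[OF f(3), of z 0] b0 linear_0[OF f(1)] linear_0[OF linear_base[where 'm='m and 'n='n]] by simp
  qed
  then have inj: "inj B" using lin by (simp add: linear_injective_0)
  then have "bij B" using lin linear_injective_imp_surjective by (blast intro: bijI)
  from that[OF lin this DB] show ?thesis .
qed

section \<open>Quotients of top forms\<close>

text \<open>In a basis \<open>e\<close> whose first n vectors are mapped by \<open>D\<close> to the
  standard basis and whose others lie in the kernel, the quotient is obtained by filling the first n
  slots of \<alpha> with the first n vectors of \<open>e\<close> and dividing by \<open>b\<close>.
  Both sides of the claim have top degree, so it is enough to compare them on \<open>e\<close>,
  where \<open>wedge_eval\<close> applies.\<close>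

lemma exists_quotient:
  fixes D :: "(real,'m::{finite,wellorder}) vec \<Rightarrow> (real,'n::{finite,wellorder}) vec"
  assumes D: "linear D" "surj D" and nm: "CARD('m) = CARD('n) + k" and b: "b \<noteq> 0"
  shows "\<exists>\<xi>. alternating k \<xi> \<and> (\<forall>v. c * vdet v = wedge CARD('n) k (\<lambda>v. b * vdet (\<lambda>i. D (v i))) \<xi> v)"
proof -
  let ?n = "CARD('n)"
  have le: "?n \<le> CARD('m)" using nm by simp
  obtain B where B: "linear B" "bij B" "\<And>z :: (real,'m) vec. D (B z) = base z"
    by (rule straighten_linear[OF D le]) (rule that)
  define e where "e i = B (axis (coord i) 1)" for i
  define ext where "ext w i = (if i < ?n then e i else w (i - ?n))" for w :: "nat \<Rightarrow> (real,'m) vec" and i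
  define \<alpha> where "\<alpha> v = c * vdet v" for v :: "nat \<Rightarrow> (real,'m) vec"
  define \<beta> where "\<beta> v = b * vdet (\<lambda>i. D (v i))" for v
  define \<xi> where "\<xi> w = \<alpha> (ext w) / b" for w
  have alta: "alternating CARD('m) \<alpha>"
    unfolding \<alpha>_def by (intro alternating_cmult alternating_vdet)
  have altb: "alternating ?n \<beta>"
    unfolding \<beta>_def by (intro alternating_cmult alternating_compose_linear[OF alternating_vdet D(1)])
  have alt0: "alternating k (\<lambda>w. \<alpha> (ext w))"
    unfolding alternating_def
  proof (intro conjI allI impI)
    fix v i assume i: "i < k"
    have "ext (v(i := u)) = (ext v)(?n + i := u)" for u by (auto simp: ext_def fun_eq_iff)
    then show "linear (\<lambda>u. \<alpha> (ext (v(i := u))))"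
      using alternating_linear[OF alta, of "?n + i" "ext v"] i nm by simp
  next
    fix v :: "nat \<Rightarrow> (real,'m) vec" and i j assume "i < k" "j < k" "i \<noteq> j \<and> v i = v j"
    then show "\<alpha> (ext v) = 0"
      using nm by (intro alternating_eq_0[OF alta, of "?n + i" "?n + j"]) (auto simp: ext_def)
  next
    fix v w :: "nat \<Rightarrow> (real,'m) vec" assume "\<forall>i<k. v i = w i"
    then show "\<alpha> (ext v) = \<alpha> (ext w)"
      using nm by (intro alternating_cong[OF alta]) (auto simp: ext_def)
  qed
  have altx: "alternating k \<xi>"
    using alternating_cmult[OF alt0, of "1 / b"] by (simp add: \<xi>_def[abs_def])
  have altw: "alternating CARD('m) (wedge ?n k \<beta> \<xi>)"
    using alternating_wedge[OF altb altx] nm by simp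
  have "wedge ?n k \<beta> \<xi> e = \<beta> e * \<xi> (\<lambda>i. e (?n + i))"
  proof (rule wedge_eval[OF altb altx, where K = "{z. D z = 0}"])
    fix w :: "nat \<Rightarrow> (real,'m) vec" and i assume "i < ?n" "w i \<in> {z. D z = 0}"
    then have "vdet (\<lambda>i. D (w i)) = 0"
      by (intro alternating_zero[OF alternating_vdet, of i]) auto
    then show "\<beta> w = 0" by (simp add: \<beta>_def)
  next
    fix i assume "?n \<le> i" "i < ?n + k"
    then show "e i \<in> {z. D z = 0}" using base_axis_0[of i, where 'm='m and 'n='n] nm by (simp add: e_def B)
  qed
  also have "\<beta> e = b"
  proof -
    have "vdet (\<lambda>i. D (e i)) = vdet (\<lambda>i. axis (coord i) 1 :: (real,'n) vec)"
      by (intro alternating_cong[OF alternating_vdet]) (simp add: e_def B base_axis[OF le])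
    then show ?thesis by (simp add: \<beta>_def)
  qed
  also have "\<xi> (\<lambda>i. e (?n + i)) = \<alpha> e / b"
  proof -
    have "ext (\<lambda>i. e (?n + i)) = e" by (auto simp: ext_def)
    then show ?thesis by (simp add: \<xi>_def)
  qed
  finally have we: "wedge ?n k \<beta> \<xi> e = \<alpha> e" using b by simp
  have "vdet e = det (matrix B)"
    unfolding e_def using vdet_linear[OF B(1), of "\<lambda>i. axis (coord i) 1"] by simp
  also have "\<dots> \<noteq> 0" using B bij_is_inj det_nz_iff_inj by blast
  finally have nz: "vdet e \<noteq> 0" .
  have "\<alpha> v = wedge ?n k \<beta> \<xi> v" for v
    using alternating_top[OF altw, of v] alternating_top[OF alta, of v]
      alternating_top[OF altw, of e] alternating_top[OF alta, of e] we nz by simp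
  then show ?thesis using altx unfolding \<alpha>_def \<beta>_def by blast
qed

section \<open>Calculus of smooth maps\<close>

lemma Ck_on_continuous: "Ck_on r f S \<Longrightarrow> continuous_on S f"
  by (cases r) (auto simp: continuous_on_eq_continuous_within
      intro: differentiable_imp_continuous_within continuous_at_imp_continuous_within)

lemma Ck_on_subset: "Ck_on r f S \<Longrightarrow> T \<subseteq> S \<Longrightarrow> Ck_on r f T"
  by (induction r arbitrary: f) (auto intro: continuous_on_subset)

lemma Ck_on_cong:
  assumes "open S"
  shows "(\<And>x. x \<in> S \<Longrightarrow> f x = g x) \<Longrightarrow> Ck_on r f S \<Longrightarrow> Ck_on r g S"
proof (induction r arbitrary: f g)
  case 0
  then show ?case by (metis Ck_on.simps(1) continuous_on_cong)
next
  case (Suc r)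
  have d: "f differentiable at x" if "x \<in> S" for x using Suc.prems that by simp
  have "g differentiable at x" if x: "x \<in> S" for x
  proof -
    obtain D where "(f has_derivative D) (at x)" using d[OF x] unfolding differentiable_def by blast
    then have "(g has_derivative D) (at x)"
      by (rule has_derivative_transform_within_open[OF _ assms x Suc.prems(1)])
    then show ?thesis unfolding differentiable_def by blast
  qed
  moreover have "frechet_derivative f (at x) v = frechet_derivative g (at x) v" if "x \<in> S" for x v
    using frechet_derivative_transform_within_open[OF d[OF that] assms that Suc.prems(1)] by simp
  then have "Ck_on r (\<lambda>x. frechet_derivative g (at x) v) S" for v
    using Suc.IH[of "\<lambda>x. frechet_derivative f (at x) v" "\<lambda>x. frechet_derivative g (at x) v"] Suc.prems(2) by simp
  ultimately show ?case by simp
qed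

lemma Ck_on_Suc_lower: "Ck_on (Suc r) f S \<Longrightarrow> Ck_on r f S"
proof (induction r arbitrary: f)
  case 0
  then show ?case using Ck_on_continuous by (metis Ck_on.simps(1))
next
  case (Suc r)
  then show ?case by (metis Ck_on.simps(2))
qed

text \<open>The derivative may be given by any formula; the inductions below then only have to show
  that this formula is of class \<open>r\<close>.\<close>

lemma Ck_on_Suc_intro:
  assumes "open S" and d: "\<And>x. x \<in> S \<Longrightarrow> (f has_derivative f' x) (at x)"
    and C: "\<And>v. Ck_on r (\<lambda>x. f' x v) S"
  shows "Ck_on (Suc r) f S"
proof -
  have "f differentiable at x" if "x \<in> S" for x using d[OF that] by (auto simp: differentiable_def)
  moreover have "f' x v = frechet_derivative f (at x) v" if "x \<in> S" for x v
    using frechet_derivative_at[OF d[OF that]] by simp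
  then have "Ck_on r (\<lambda>x. frechet_derivative f (at x) v) S" for v
    using Ck_on_cong[OF assms(1) _ C] by simp
  ultimately show ?thesis by simp
qed

lemma Ck_on_Suc_has_derivative:
  "Ck_on (Suc r) f S \<Longrightarrow> x \<in> S \<Longrightarrow> (f has_derivative frechet_derivative f (at x)) (at x)"
  using frechet_derivative_works by auto

lemma Ck_on_const: "open S \<Longrightarrow> Ck_on r (\<lambda>_. c) S"
proof (induction r arbitrary: c)
  case (Suc r)
  then show ?case by (intro Ck_on_Suc_intro[where f' = "\<lambda>_ _. 0"]) (auto intro: derivative_eq_intros)
qed simp

lemma Ck_on_linear_comp:
  assumes L: "bounded_linear L" and S: "open S"
  shows "Ck_on r f S \<Longrightarrow> Ck_on r (\<lambda>x. L (f x)) S"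
proof (induction r arbitrary: f)
  case 0
  then show ?case by (simp add: bounded_linear.continuous_on[OF L])
next
  case (Suc r)
  show ?case
  proof (rule Ck_on_Suc_intro[OF S])
    show "((\<lambda>x. L (f x)) has_derivative (\<lambda>v. L (frechet_derivative f (at x) v))) (at x)" if "x \<in> S" for x
      by (rule bounded_linear.has_derivative[OF L Ck_on_Suc_has_derivative[OF Suc.prems that]])
    show "Ck_on r (\<lambda>x. L (frechet_derivative f (at x) v)) S" for v
      using Suc by simp
  qed
qed

lemma Ck_on_linear:
  assumes L: "bounded_linear L" and S: "open S"
  shows "Ck_on r L S"
proof (cases r)
  case 0
  then show ?thesis using linear_continuous_on[OF L] by simp
next
  case (Suc r')
  show ?thesis unfolding Suc
    by (intro Ck_on_Suc_intro[OF S, where f' = "\<lambda>_. L"] Ck_on_const[OF S] bounded_linear_imp_has_derivative[OF L])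
qed

lemma Ck_on_add:
  assumes S: "open S"
  shows "Ck_on r f S \<Longrightarrow> Ck_on r g S \<Longrightarrow> Ck_on r (\<lambda>x. f x + g x) S"
proof (induction r arbitrary: f g)
  case 0
  then show ?case by (simp add: continuous_on_add)
next
  case (Suc r)
  show ?case
  proof (rule Ck_on_Suc_intro[OF S])
    show "((\<lambda>x. f x + g x) has_derivative (\<lambda>v. frechet_derivative f (at x) v + frechet_derivative g (at x) v)) (at x)" if "x \<in> S" for x
      by (intro has_derivative_add Ck_on_Suc_has_derivative[OF Suc.prems(1) that] Ck_on_Suc_has_derivative[OF Suc.prems(2) that])
    show "Ck_on r (\<lambda>x. frechet_derivative f (at x) v + frechet_derivative g (at x) v) S" for v
      using Suc by simp
  qed
qed

lemma Ck_on_scaleR: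
  assumes S: "open S"
  shows "Ck_on r f S \<Longrightarrow> Ck_on r g S \<Longrightarrow> Ck_on r (\<lambda>x. f x *\<^sub>R g x) S"
proof (induction r arbitrary: f g)
  case 0
  then show ?case by (simp add: continuous_on_scaleR)
next
  case (Suc r)
  show ?case
  proof (rule Ck_on_Suc_intro[OF S])
    show "((\<lambda>x. f x *\<^sub>R g x) has_derivative (\<lambda>v. f x *\<^sub>R frechet_derivative g (at x) v + frechet_derivative f (at x) v *\<^sub>R g x)) (at x)" if "x \<in> S" for x
      by (intro has_derivative_scaleR Ck_on_Suc_has_derivative[OF Suc.prems(1) that] Ck_on_Suc_has_derivative[OF Suc.prems(2) that])
    show "Ck_on r (\<lambda>x. f x *\<^sub>R frechet_derivative g (at x) v + frechet_derivative f (at x) v *\<^sub>R g x) S" for v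
      using Suc.prems by (intro Ck_on_add[OF S] Suc.IH Ck_on_Suc_lower[OF Suc.prems(1)] Ck_on_Suc_lower[OF Suc.prems(2)]) auto
  qed
qed

lemma Ck_on_mult:
  fixes f g :: "'a::euclidean_space \<Rightarrow> real"
  shows "open S \<Longrightarrow> Ck_on r f S \<Longrightarrow> Ck_on r g S \<Longrightarrow> Ck_on r (\<lambda>x. f x * g x) S"
  using Ck_on_scaleR[of S r f g] by simp

lemma Ck_on_sum:
  assumes S: "open S"
  shows "(\<And>i. i \<in> I \<Longrightarrow> Ck_on r (f i) S) \<Longrightarrow> Ck_on r (\<lambda>x. \<Sum>i\<in>I. f i x) S"
  by (induction I rule: infinite_finite_induct) (simp_all add: Ck_on_const[OF S] Ck_on_add[OF S])

lemma Ck_on_prod: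
  fixes f :: "'i \<Rightarrow> 'a::euclidean_space \<Rightarrow> real"
  assumes S: "open S"
  shows "(\<And>i. i \<in> I \<Longrightarrow> Ck_on r (f i) S) \<Longrightarrow> Ck_on r (\<lambda>x. \<Prod>i\<in>I. f i x) S"
  by (induction I rule: infinite_finite_induct) (simp_all add: Ck_on_const[OF S] Ck_on_mult[OF S])

lemma Ck_on_inverse:
  fixes f :: "'a::euclidean_space \<Rightarrow> real"
  assumes S: "open S" and nz: "\<And>x. x \<in> S \<Longrightarrow> f x \<noteq> 0"
  shows "Ck_on r f S \<Longrightarrow> Ck_on r (\<lambda>x. inverse (f x)) S"
proof (induction r)
  case 0
  then show ?case using nz by (auto intro: continuous_on_inverse)
next
  case (Suc r)
  have inv: "Ck_on r (\<lambda>x. inverse (f x)) S" using Suc Ck_on_Suc_lower by blast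
  show ?case
  proof (rule Ck_on_Suc_intro[OF S])
    show "((\<lambda>x. inverse (f x)) has_derivative (\<lambda>v. - (inverse (f x) * frechet_derivative f (at x) v * inverse (f x)))) (at x)" if "x \<in> S" for x
      by (intro Deriv.has_derivative_inverse nz[OF that] Ck_on_Suc_has_derivative[OF Suc.prems that])
    have "Ck_on r (\<lambda>x. (-1) * (inverse (f x) * frechet_derivative f (at x) v * inverse (f x))) S" for v
      using Suc.prems by (intro Ck_on_mult[OF S] inv Ck_on_const[OF S]) auto
    then show "Ck_on r (\<lambda>x. - (inverse (f x) * frechet_derivative f (at x) v * inverse (f x))) S" for v
      by simp
  qed
qed

text \<open>In the chain rule both the point and the direction of the outer derivative move, while
  \<open>Ck_on\<close> speaks of fixed directions. Expanding the direction in \<open>Basis\<close>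
  gives a sum of products to which the induction hypothesis applies.\<close>

lemma Ck_on_compose:
  fixes g :: "'a::euclidean_space \<Rightarrow> 'b::euclidean_space"
  assumes S: "open S" and T: "open T" and sub: "g ` S \<subseteq> T"
  shows "Ck_on r f T \<Longrightarrow> Ck_on r g S \<Longrightarrow> Ck_on r (\<lambda>x. f (g x)) S"
proof (induction r arbitrary: f)
  case 0
  then show ?case using sub by (auto intro: continuous_on_compose2)
next
  case (Suc r)
  have gr: "Ck_on r g S" using Suc.prems Ck_on_Suc_lower by blast
  let ?f = "\<lambda>x. frechet_derivative f (at x)" and ?g = "\<lambda>x. frechet_derivative g (at x)"
  show ?case
  proof (rule Ck_on_Suc_intro[OF S])
    fix x assume x: "x \<in> S"
    then have gx: "g x \<in> T" using sub by blast
    have df: "(f has_derivative ?f (g x)) (at (g x))" by (rule Ck_on_Suc_has_derivative[OF Suc.prems(1) gx])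
    have "((\<lambda>x. f (g x)) has_derivative (\<lambda>v. ?f (g x) (?g x v))) (at x)"
      using diff_chain_at[OF Ck_on_Suc_has_derivative[OF Suc.prems(2) x] df] by (simp add: o_def)
    moreover have "?f (g x) (?g x v) = (\<Sum>b\<in>Basis. (?g x v \<bullet> b) *\<^sub>R ?f (g x) b)" for v
    proof -
      have lin: "linear (?f (g x))" using df has_derivative_linear by blast
      have "?f (g x) (?g x v) = ?f (g x) (\<Sum>b\<in>Basis. (?g x v \<bullet> b) *\<^sub>R b)" by (simp add: euclidean_representation)
      also have "\<dots> = (\<Sum>b\<in>Basis. (?g x v \<bullet> b) *\<^sub>R ?f (g x) b)"
        by (simp add: linear_sum[OF lin] linear_cmul[OF lin])
      finally show ?thesis .
    qed
    ultimately show "((\<lambda>x. f (g x)) has_derivative (\<lambda>v. \<Sum>b\<in>Basis. (?g x v \<bullet> b) *\<^sub>R ?f (g x) b)) (at x)" by simp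
  next
    fix v
    have "Ck_on r (\<lambda>x. ?g x v \<bullet> b) S" for b
      using Suc.prems by (intro Ck_on_linear_comp[OF bounded_linear_inner_left S]) simp
    moreover have "Ck_on r (\<lambda>x. ?f (g x) b) S" for b
      using Suc.IH[of "\<lambda>y. ?f y b"] Suc.prems(1) gr by simp
    ultimately show "Ck_on r (\<lambda>x. \<Sum>b\<in>Basis. (?g x v \<bullet> b) *\<^sub>R ?f (g x) b) S"
      by (intro Ck_on_sum[OF S] Ck_on_scaleR[OF S])
  qed
qed

lemma Ck_on_vec_lambda:
  fixes f :: "'n::finite \<Rightarrow> 'a::euclidean_space \<Rightarrow> real"
  assumes S: "open S" and "\<And>i. Ck_on r (f i) S"
  shows "Ck_on r (\<lambda>x. \<chi> i. f i x) S"
proof -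
  have "Ck_on r (\<lambda>x. \<Sum>i\<in>UNIV. f i x *\<^sub>R axis i (1::real)) S"
    by (intro Ck_on_sum[OF S] Ck_on_scaleR[OF S] assms Ck_on_const[OF S])
  moreover have "(\<Sum>i\<in>UNIV. f i x *\<^sub>R axis i (1::real)) = (\<chi> i. f i x)" for x
    by (simp add: vec_eq_iff axis_def if_distrib[of "\<lambda>y. f _ x * y"] cong: if_cong)
  ultimately show ?thesis by simp
qed

lemma Ck_on_det:
  fixes A :: "'a::euclidean_space \<Rightarrow> ((real,'n::finite) vec,'n) vec"
  assumes S: "open S" and "\<And>i j. Ck_on r (\<lambda>x. A x $ i $ j) S"
  shows "Ck_on r (\<lambda>x. det (A x)) S"
  unfolding det_def
  by (intro Ck_on_sum[OF S] Ck_on_mult[OF S] Ck_on_prod[OF S] Ck_on_const[OF S] assms)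

lemma smooth_onD: "smooth_on S f \<Longrightarrow> Ck_on r f S"
  by (simp add: smooth_on_def)

lemma smooth_on_has_derivative:
  "smooth_on S f \<Longrightarrow> x \<in> S \<Longrightarrow> (f has_derivative frechet_derivative f (at x)) (at x)"
  using Ck_on_Suc_has_derivative smooth_onD by blast

lemma smooth_on_compose:
  fixes g :: "'a::euclidean_space \<Rightarrow> 'b::euclidean_space"
  shows "open S \<Longrightarrow> open T \<Longrightarrow> g ` S \<subseteq> T \<Longrightarrow> smooth_on T f \<Longrightarrow> smooth_on S g \<Longrightarrow> smooth_on S (\<lambda>x. f (g x))"
  unfolding smooth_on_def using Ck_on_compose by blast

section \<open>Smooth inverse functions\<close>

text \<open>Cramer's rule writes the inverse as a rational expression in the entries of the matrix,
  so it depends on a parameter as smoothly as they do.\<close>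

lemma inv_cramer:
  fixes A :: "(real,'m::finite) vec \<Rightarrow> (real,'m) vec"
  assumes "linear A" "bij A"
  shows "inv A v = (\<chi> k. det (\<chi> i j. if j = k then v $ i else A (axis j 1) $ i) / det (matrix A))"
proof -
  have nz: "det (matrix A) \<noteq> 0" using assms bij_is_inj det_nz_iff_inj by blast
  have "matrix A *v inv A v = v"
    using assms by (simp add: matrix_works bij_is_surj surj_f_inv_f)
  then have "inv A v = (\<chi> k. det (\<chi> i j. if j = k then v $ i else matrix A $ i $ j) / det (matrix A))"
    using cramer[OF nz] by blast
  then show ?thesis by (simp add: matrix_def cong: if_cong)
qed

text \<open>The inverse function theorem gives a differentiable inverse g, and bootstrapping makes
  it smooth: if g is of class \<open>r\<close>, so are the entries of the derivative of f along g,
  and by \<open>inv_cramer\<close> so is the derivative of g.\<close>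

lemma smooth_inverse_function:
  fixes f :: "(real,'m::finite) vec \<Rightarrow> (real,'m) vec"
  assumes U: "open U" and sm: "smooth_on U f" and x0: "x0 \<in> U"
    and bij: "bij (frechet_derivative f (at x0))"
  obtains U' V g where "open U'" "U' \<subseteq> U" "x0 \<in> U'" "open V" "homeomorphism U' V f g" "smooth_on V g"
    "\<And>y. y \<in> V \<Longrightarrow> bij (frechet_derivative f (at (g y)))"
    "\<And>y. y \<in> V \<Longrightarrow> (g has_derivative inv (frechet_derivative f (at (g y)))) (at y)"
proof -
  let ?D = "\<lambda>x. frechet_derivative f (at x)"
  have der: "(f has_derivative ?D x) (at x)" if "x \<in> U" for x
    by (rule smooth_on_has_derivative[OF sm that])
  have bl: "bounded_linear (?D x)" if "x \<in> U" for x
    using der[OF that] by (rule has_derivative_bounded_linear)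
  \<comment> \<open>The theorem asks for the derivative as a continuous map into the bounded linear
    functions. Continuity in every fixed direction suffices for this, and \<open>Ck_on\<close>
    provides it.\<close>
  define f' where "f' x = Blinfun (?D x)" for x
  have f': "blinfun_apply (f' x) = ?D x" if "x \<in> U" for x
    unfolding f'_def using bl[OF that] by (rule bounded_linear_Blinfun_apply)
  have Cv: "Ck_on r (\<lambda>x. ?D x v) U" for r v
    using smooth_onD[OF sm, of "Suc r"] by simp
  have cont: "continuous_on U f'"
  proof (rule continuous_on_blinfun_componentwise)
    fix i :: "(real,'m) vec"
    have "continuous_on U (\<lambda>x. ?D x i)" using Cv Ck_on_continuous by blast
    then show "continuous_on U (\<lambda>x. blinfun_apply (f' x) i)"
      by (rule continuous_on_cong[THEN iffD1, rotated -1]) (simp_all add: f')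
  qed
  have lin: "linear (?D x)" if "x \<in> U" for x using bl[OF that] bounded_linear.linear by blast
  have linv: "linear (inv (?D x0))"
    using inj_linear_imp_inv_linear[OF lin[OF x0] bij_is_inj[OF bij]] .
  then have blinv: "bounded_linear (inv (?D x0))" using linear_linear by blast
  have derb: "(f has_derivative blinfun_apply (f' x)) (at x)" if "x \<in> U" for x
    using der[OF that] f'[OF that] by simp
  have invb: "Blinfun (inv (?D x0)) o\<^sub>L f' x0 = id_blinfun"
    by (rule blinfun_eqI) (simp add: bounded_linear_Blinfun_apply[OF blinv] f'[OF x0] inv_f_f[OF bij_is_inj[OF bij]])
  obtain U' V g g' where U': "open U'" "U' \<subseteq> U" "x0 \<in> U'" and V: "open V" "f x0 \<in> V"
    and hom: "homeomorphism U' V f g"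
    and dg: "\<And>y. y \<in> V \<Longrightarrow> (g has_derivative (g' y)) (at y)"
    and g': "\<And>y. y \<in> V \<Longrightarrow> g' y = inv (blinfun_apply (f' (g y)))"
    and bijg: "\<And>y. y \<in> V \<Longrightarrow> bij (blinfun_apply (f' (g y)))"
    by (rule inverse_function_theorem[OF U derb cont x0 invb], assumption) (rule that)
  have gU: "g y \<in> U" if "y \<in> V" for y
    using hom that U'(2) unfolding homeomorphism_def by blast
  have bijg': "bij (?D (g y))" if "y \<in> V" for y using bijg[OF that] f'[OF gU[OF that]] by simp
  have dg': "(g has_derivative inv (?D (g y))) (at y)" if "y \<in> V" for y
    using dg[OF that] g'[OF that] f'[OF gU[OF that]] by simp
  have "Ck_on r g V" for r
  proof (induction r)
    case 0
    then show ?case using hom by (simp add: homeomorphism_def)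
  next
    case (Suc r)
    show ?case
    proof (rule Ck_on_Suc_intro[OF V(1) dg'])
      fix v :: "(real,'m) vec"
      have ent: "Ck_on r (\<lambda>y. ?D (g y) w $ i) V" for w i
      proof -
        have "Ck_on r (\<lambda>y. ?D (g y) w) V"
          using gU by (intro Ck_on_compose[OF V(1) U _ Cv Suc]) auto
        then show ?thesis by (rule Ck_on_linear_comp[OF bounded_linear_vec_nth V(1)])
      qed
      let ?M = "\<lambda>y k. \<chi> i j. if j = k then v $ i else ?D (g y) (axis j 1) $ i"
      have "Ck_on r (\<lambda>y. ?M y k $ i $ j) V" for k i j
        by (cases "j = k") (simp_all add: ent Ck_on_const[OF V(1)])
      then have num: "Ck_on r (\<lambda>y. det (?M y k)) V" for k
        by (rule Ck_on_det[OF V(1)])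
      have den: "Ck_on r (\<lambda>y. det (matrix (?D (g y)))) V"
        by (rule Ck_on_det[OF V(1)]) (simp add: matrix_def ent)
      have nz: "det (matrix (?D (g y))) \<noteq> 0" if "y \<in> V" for y
        using lin[OF gU[OF that]] bij_is_inj[OF bijg'[OF that]] det_nz_iff_inj by blast
      have "Ck_on r (\<lambda>y. \<chi> k. det (?M y k) * inverse (det (matrix (?D (g y))))) V"
        by (intro Ck_on_vec_lambda[OF V(1)] Ck_on_mult[OF V(1)] num Ck_on_inverse[OF V(1) nz den])
      moreover have "(\<chi> k. det (?M y k) * inverse (det (matrix (?D (g y))))) = inv (?D (g y)) v" if "y \<in> V" for y
        unfolding inv_cramer[OF lin[OF gU[OF that]] bijg'[OF that]] divide_inverse by (rule refl)
      ultimately show "Ck_on r (\<lambda>y. inv (?D (g y)) v) V"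
        by (rule Ck_on_cong[OF V(1), rotated])
    qed
  qed
  then have "smooth_on V g" by (simp add: smooth_on_def)
  then show ?thesis using that U' V(1) hom bijg' dg' by simp
qed

section \<open>Partial derivatives\<close>

text \<open>The passage from \<open>x\<close> to \<open>x + v\<close> is made one coordinate at a
  time, and each increment is estimated by the mean value inequality along a segment. Local
  parametrisations of a fiber are described by partial derivatives only, whereas the change of
  variables needs a total derivative.\<close>

lemma has_derivative_partials:
  fixes f :: "(real,'m::finite) vec \<Rightarrow> 'b::real_normed_vector"
  assumes S: "open S" and x: "x \<in> S"
    and part: "\<And>z i. z \<in> S \<Longrightarrow> ((\<lambda>t. f (z + t *\<^sub>R axis i 1)) has_vector_derivative g i z) (at 0)"
    and cont: "\<And>i. continuous_on S (g i)"
  shows "(f has_derivative (\<lambda>v. \<Sum>i\<in>UNIV. v $ i *\<^sub>R g i x)) (at x)"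
  unfolding has_derivative_at_alt
proof (intro conjI allI impI)
  show "bounded_linear (\<lambda>v. \<Sum>i\<in>UNIV. v $ i *\<^sub>R g i x)"
    by (intro bounded_linear_sum bounded_linear_scaleR_const bounded_linear_vec_nth)
  fix e :: real assume e: "e > 0"
  \<comment> \<open>One equal share of the error \<open>e\<close> for each coordinate.\<close>
  define e' where "e' = e / CARD('m)"
  have e': "e' > 0" using e by (simp add: e'_def)
  have "\<forall>\<^sub>F z in at x. \<forall>i\<in>UNIV. dist (g i z) (g i x) < e'"
    using cont e' S x by (intro eventually_ball_finite ballI tendstoD)
      (auto simp: continuous_on_eq_continuous_at continuous_at)
  then obtain d1 where d1: "d1 > 0" "\<And>z i. z \<noteq> x \<Longrightarrow> dist z x < d1 \<Longrightarrow> dist (g i z) (g i x) < e'"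
    by (auto simp: eventually_at)
  obtain d2 where d2: "d2 > 0" "ball x d2 \<subseteq> S" using S x openE by blast
  define d where "d = min d1 d2"
  have near: "z \<in> S" "norm (g i z - g i x) \<le> e'" if "norm (z - x) < d" for z i
  proof -
    show "z \<in> S" using that d2 by (auto simp: d_def dist_norm norm_minus_commute)
    show "norm (g i z - g i x) \<le> e'"
      using d1(2)[of z i] that e' by (cases "z = x") (auto simp: d_def dist_norm)
  qed
  \<comment> \<open>\<open>x + r J v\<close> is the intermediate point at which the coordinates in
    \<open>J\<close> have been moved.\<close>
  define r where "r J v = (\<chi> i. if i \<in> J then v $ i else 0)" for J and v :: "(real,'m) vec"
  have rn: "norm (r J v) \<le> norm v" for J v
    by (rule norm_le_componentwise_cart) (simp add: r_def)
  have step: "norm (f (x + r J v) - f x - (\<Sum>i\<in>J. v $ i *\<^sub>R g i x)) \<le> card J * e' * norm v"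
    if v: "norm v < d" for v J
    using finite[of J]
  proof (induction J)
    case empty
    have "r {} v = 0" by (simp add: r_def vec_eq_iff)
    then show ?case by simp
  next
    case (insert j J)
    \<comment> \<open>Without its linear part, the function along the segment has as derivative the
      difference of a partial derivative at two nearby points, which has norm at most
      \<open>e'\<close>.\<close>
    define h where "h t = f (x + r J v + t *\<^sub>R axis j 1) - t *\<^sub>R g j x" for t
    have rj: "r (insert j J) v = r J v + (v $ j) *\<^sub>R axis j 1"
      using insert.hyps by (auto simp: r_def vec_eq_iff axis_def)
    have dh: "(h has_derivative (\<lambda>s. s *\<^sub>R (g j (x + r J v + t *\<^sub>R axis j 1) - g j x))) (at t within closed_segment 0 (v $ j))"
      and bh: "norm (g j (x + r J v + t *\<^sub>R axis j 1) - g j x) \<le> e'"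
      if t: "t \<in> closed_segment 0 (v $ j)" for t
    proof -
      let ?z = "x + r J v + t *\<^sub>R axis j 1"
      have "\<bar>t\<bar> \<le> \<bar>v $ j\<bar>" using t by (auto simp: closed_segment_eq_real_ivl split: if_splits)
      then have "norm (r J v + t *\<^sub>R axis j 1) \<le> norm v"
        using insert.hyps by (intro norm_le_componentwise_cart) (auto simp: r_def axis_def)
      then have n: "norm (?z - x) < d" using v by (simp add: algebra_simps)
      show "norm (g j ?z - g j x) \<le> e'" using near(2)[OF n] .
      have "((\<lambda>s. f (?z + s *\<^sub>R axis j 1)) has_vector_derivative g j ?z) (at 0)"
        using part[OF near(1)[OF n]] .
      then have "((\<lambda>s. f (?z + s *\<^sub>R axis j 1)) has_vector_derivative g j ?z) (at (t - t))" by simp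
      then have "((\<lambda>s. f (?z + s *\<^sub>R axis j 1)) \<circ> (\<lambda>s. s - t) has_vector_derivative 1 *\<^sub>R g j ?z) (at t)"
        by (intro vector_diff_chain_at) (auto intro!: derivative_eq_intros)
      also have "(\<lambda>s. f (?z + s *\<^sub>R axis j 1)) \<circ> (\<lambda>s. s - t) = (\<lambda>s. f (x + r J v + s *\<^sub>R axis j 1))"
        by (auto simp: fun_eq_iff algebra_simps)
      finally have "((\<lambda>s. f (x + r J v + s *\<^sub>R axis j 1)) has_vector_derivative g j ?z) (at t)" by simp
      then have "(h has_vector_derivative (g j ?z - g j x)) (at t)"
        unfolding h_def by (auto intro!: derivative_eq_intros)
      then show "(h has_derivative (\<lambda>s. s *\<^sub>R (g j ?z - g j x))) (at t within closed_segment 0 (v $ j))"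
        unfolding has_vector_derivative_def by (rule has_derivative_at_withinI)
    qed
    have "norm (h (v $ j) - h 0) \<le> e' * norm (v $ j - 0)"
    proof (rule differentiable_bound[OF convex_closed_segment dh])
      fix t assume t: "t \<in> closed_segment 0 (v $ j)"
      show "onorm (\<lambda>s. s *\<^sub>R (g j (x + r J v + t *\<^sub>R axis j 1) - g j x)) \<le> e'"
      proof (rule onorm_le)
        fix s :: real
        show "norm (s *\<^sub>R (g j (x + r J v + t *\<^sub>R axis j 1) - g j x)) \<le> e' * norm s"
          using mult_right_mono[OF bh[OF t], of "\<bar>s\<bar>"] by (simp add: mult.commute)
      qed
    qed auto
    also have "\<dots> \<le> e' * norm v"
      using e' component_le_norm_cart[of v j] by simp
    finally have hd: "norm (h (v $ j) - h 0) \<le> e' * norm v" .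
    have "f (x + r (insert j J) v) - f x - (\<Sum>i\<in>insert j J. v $ i *\<^sub>R g i x)
        = (h (v $ j) - h 0) + (f (x + r J v) - f x - (\<Sum>i\<in>J. v $ i *\<^sub>R g i x))"
      using insert.hyps by (simp add: h_def rj algebra_simps)
    also have "norm \<dots> \<le> e' * norm v + card J * e' * norm v"
      by (rule norm_triangle_le) (use hd insert.IH in linarith)
    also have "\<dots> = card (insert j J) * e' * norm v"
      using insert.hyps by (simp add: algebra_simps)
    finally show ?case .
  qed
  show "\<exists>d>0. \<forall>y. norm (y - x) < d \<longrightarrow> norm (f y - f x - (\<Sum>i\<in>UNIV. (y - x) $ i *\<^sub>R g i x)) \<le> e * norm (y - x)"
  proof (intro exI[of _ d] conjI allI impI)
    show "d > 0" using d1 d2 by (simp add: d_def)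
    fix y assume y: "norm (y - x) < d"
    have "r UNIV (y - x) = y - x" by (simp add: r_def vec_eq_iff)
    then show "norm (f y - f x - (\<Sum>i\<in>UNIV. (y - x) $ i *\<^sub>R g i x)) \<le> e * norm (y - x)"
      using step[OF y, of UNIV] by (simp add: e'_def)
  qed
qed

section \<open>Functions of the fiber coordinates\<close>

lemma continuous_on_join:
  assumes "continuous_on S f" "continuous_on S g"
  shows "continuous_on S (\<lambda>x. join (f x :: (real,'n::{finite,wellorder}) vec) (g x) :: (real,'m::{finite,wellorder}) vec)"
  unfolding join_def
proof (rule continuous_on_vec_lambda)
  fix j :: 'm
  show "continuous_on S (\<lambda>x. if pos j < CARD('n) then f x $ coord (pos j) else g x (pos j - CARD('n)))"
    using assms continuous_on_product_then_coordinatewise[OF assms(2)]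
    by (cases "pos j < CARD('n)") (auto intro: continuous_on_component)
qed

lemma continuous_on_fib: "continuous_on S (fib n :: (real,'m::{finite,wellorder}) vec \<Rightarrow> _)"
  unfolding fib_def[abs_def]
proof (rule continuous_on_coordinatewise_then_product)
  fix i
  show "continuous_on S (\<lambda>z :: (real,'m::{finite,wellorder}) vec. if i < CARD('m) - n then z $ coord (n + i) else 0)"
    by (cases "i < CARD('m) - n") (auto intro: continuous_on_component continuous_on_id)
qed

lemma continuous_on_base: "continuous_on S base"
  unfolding base_def[abs_def] by (intro continuous_on_vec_lambda continuous_on_component continuous_on_id)

lemma coord_inj_iff:
  assumes "i < CARD('m::{finite,wellorder})" "i' < CARD('m)"
  shows "(coord i :: 'm) = coord i' \<longleftrightarrow> i = i'"
proof
  assume "(coord i :: 'm) = coord i'"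
  then have "pos (coord i :: 'm) = pos (coord i' :: 'm)" by (rule arg_cong)
  then show "i = i'" by (simp only: pos_coord[OF assms(1)] pos_coord[OF assms(2)])
qed simp

lemma join_upd:
  fixes u :: "(real,'n::{finite,wellorder}) vec"
  assumes "CARD('n) \<le> CARD('m)" "i < CARD('m) - CARD('n)"
  shows "(join u (w(i := t)) :: (real,'m::{finite,wellorder}) vec) = join u w + (t - w i) *\<^sub>R axis (coord (CARD('n) + i)) 1"
proof -
  have "CARD('n) + i < CARD('m)" using assms by linarith
  then have pj: "j = coord (CARD('n) + i) \<longleftrightarrow> pos j = CARD('n) + i" for j :: 'm
    using coord_inj_iff[of "pos j" "CARD('n) + i", where 'm='m] by simp
  have "(join u (w(i := t)) :: (real,'m) vec) $ j = (join u w + (t - w i) *\<^sub>R axis (coord (CARD('n) + i)) 1) $ j" for j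
  proof (cases "pos j = CARD('n) + i")
    case True
    then have "(axis (coord (CARD('n) + i)) 1 :: (real,'m) vec) $ j = 1" using pj[of j] by (simp add: axis_def)
    then show ?thesis using True by (simp add: join_def)
  next
    case False
    then have "(axis (coord (CARD('n) + i)) 1 :: (real,'m) vec) $ j = 0" using pj[of j] by (simp add: axis_def)
    moreover have "pos j - CARD('n) \<noteq> i" if "\<not> pos j < CARD('n)" using that False by linarith
    ultimately show ?thesis by (simp add: join_def)
  qed
  then show ?thesis by (simp add: vec_eq_iff)
qed

lemma fib_axis:
  fixes z :: "(real,'m::{finite,wellorder}) vec"
  assumes "n \<le> CARD('m)" "i < CARD('m) - n"
  shows "fib n (z + t *\<^sub>R axis (coord (n + i)) 1) = (fib n z)(i := fib n z i + t)"
proof -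
  have "(coord (n + i') :: 'm) = coord (n + i) \<longleftrightarrow> i' = i" if "i' < CARD('m) - n" for i'
  proof -
    have "n + i < CARD('m)" "n + i' < CARD('m)" using that assms by linarith+
    then show ?thesis by (simp add: coord_inj_iff)
  qed
  then show ?thesis using assms by (auto simp: fib_def fun_eq_iff axis_def)
qed

lemma fib_axis_base:
  fixes z :: "(real,'m::{finite,wellorder}) vec"
  assumes "n \<le> CARD('m)" "i < n"
  shows "fib n (z + t *\<^sub>R axis (coord i) 1) = fib n z"
proof -
  have "(coord (n + i') :: 'm) \<noteq> coord i" if "i' < CARD('m) - n" for i'
  proof -
    have "i < CARD('m)" "n + i' < CARD('m)" "i \<noteq> n + i'" using that assms by linarith+
    then show ?thesis by (simp add: coord_inj_iff)
  qed
  then show ?thesis using assms by (auto simp: fib_def fun_eq_iff axis_def)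
qed

lemma openin_Euclidean_space_iff:
  "openin (Euclidean_space k) W \<longleftrightarrow> (\<exists>T. open T \<and> W = T \<inter> {w. \<forall>i\<ge>k. w i = 0})"
  by (simp add: Euclidean_space_def openin_subtopology euclidean_product_topology)

text \<open>Changing a coordinate below \<open>k\<close> stays in the subspace in which
  \<open>W\<close> is relatively open, so partial derivatives are taken at interior points of a
  line.\<close>

lemma openin_Euclidean_space_upd:
  assumes "openin (Euclidean_space k) W" "y \<in> W" "i < k"
  shows "\<exists>T. open T \<and> y i \<in> T \<and> (\<forall>t\<in>T. y(i := t) \<in> W)"
proof -
  obtain T where T: "open T" "W = T \<inter> {w. \<forall>i\<ge>k. w i = 0}"
    using assms(1) unfolding openin_Euclidean_space_iff by blast
  have "continuous_on UNIV (\<lambda>t. y(i := t))"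
  proof (rule continuous_on_coordinatewise_then_product)
    fix j show "continuous_on UNIV (\<lambda>t. (y(i := t)) j)"
      by (cases "j = i") (auto intro: continuous_on_id)
  qed
  then have "open ((\<lambda>t. y(i := t)) -` T)" using T(1) by (simp add: continuous_on_open_vimage)
  then show ?thesis
    using assms T by (intro exI[of _ "(\<lambda>t. y(i := t)) -` T"]) auto
qed

lemma openin_Euclidean_vimage:
  assumes W: "openin (Euclidean_space k) W" and f: "continuous_on W f" and V: "open V"
  shows "openin (Euclidean_space k) (W \<inter> f -` V)"
proof -
  have "openin (top_of_set W) (W \<inter> f -` V)" by (rule continuous_openin_preimage_gen[OF f V])
  then obtain O' where O': "open O'" "W \<inter> f -` V = W \<inter> O'" by (auto simp: openin_open)
  obtain T0 where "open T0" "W = T0 \<inter> {w. \<forall>i\<ge>k. w i = 0}" using W unfolding openin_Euclidean_space_iff by blast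
  then show ?thesis
    unfolding openin_Euclidean_space_iff O'(2) using O'(1) by (intro exI[of _ "T0 \<inter> O'"]) auto
qed

lemma open_fib_vimage:
  assumes W: "openin (Euclidean_space (CARD('m) - n)) W"
  shows "open {z :: (real,'m::{finite,wellorder}) vec. fib n z \<in> W}"
proof -
  obtain T where T: "open T" "W = T \<inter> {w. \<forall>i\<ge>CARD('m) - n. w i = 0}"
    using W unfolding openin_Euclidean_space_iff by blast
  have "open (fib n -` T :: (real,'m) vec set)" by (intro open_vimage T(1) continuous_on_fib)
  also have "fib n -` T = {z :: (real,'m) vec. fib n z \<in> W}" unfolding T(2) by auto
  finally show ?thesis .
qed

lemma Ck_nat_on_cong:
  assumes W: "openin (Euclidean_space k) W"
  shows "(\<And>y. y \<in> W \<Longrightarrow> f y = g y) \<Longrightarrow> Ck_nat_on k r f W \<Longrightarrow> Ck_nat_on k r g W"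
proof (induction r arbitrary: f g)
  case 0
  then show ?case by (metis Ck_nat_on.simps(1) continuous_on_cong)
next
  case (Suc r)
  have c: "continuous_on W g" using Suc.prems by (metis Ck_nat_on.simps(2) continuous_on_cong)
  have tr: "((\<lambda>t. g (y(i := t))) has_vector_derivative D) (at (y i))"
    if y: "y \<in> W" "i < k" and D: "((\<lambda>t. f (y(i := t))) has_vector_derivative D) (at (y i))" for y i D
  proof -
    obtain T where T: "open T" "y i \<in> T" "\<forall>t\<in>T. y(i := t) \<in> W"
      using openin_Euclidean_space_upd[OF W y] by blast
    show ?thesis
      by (rule has_vector_derivative_transform_within_open[OF D T(1,2)]) (use T(3) Suc.prems(1) in blast)
  qed
  have df: "((\<lambda>t. f (y(i := t))) has_vector_derivative partial_deriv i f y) (at (y i))" if "y \<in> W" "i < k" for y i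
    unfolding partial_deriv_def using Suc.prems(2) that by (simp add: vector_derivative_works[symmetric])
  have pd: "partial_deriv i f y = partial_deriv i g y" if "y \<in> W" "i < k" for y i
    using vector_derivative_at[OF tr[OF that df[OF that]]] by (simp add: partial_deriv_def)
  have "(\<lambda>t. g (y(i := t))) differentiable at (y i)" if "y \<in> W" "i < k" for y i
    using tr[OF that df[OF that]] by (rule differentiableI_vector)
  moreover have "Ck_nat_on k r (partial_deriv i g) W" if "i < k" for i
    using Suc.IH[of "partial_deriv i f" "partial_deriv i g"] Suc.prems(2) pd that by simp
  ultimately show ?case using c by simp
qed

lemma openin_join_vimage:
  fixes u :: "(real,'n::{finite,wellorder}) vec" and Z :: "(real,'m::{finite,wellorder}) vec set"
  assumes "open Z"
  shows "openin (Euclidean_space k) {w. (\<forall>i\<ge>k. w i = 0) \<and> join u w \<in> Z}"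
proof -
  have "continuous_on UNIV (join u :: _ \<Rightarrow> (real,'m) vec)"
    using continuous_on_join[of UNIV "\<lambda>_. u" "\<lambda>w. w"] by simp
  then have "open ((join u :: _ \<Rightarrow> (real,'m) vec) -` Z)" using assms by (simp add: continuous_on_open_vimage)
  then show ?thesis unfolding openin_Euclidean_space_iff by (intro exI[of _ "join u -` Z"]) auto
qed

lemma has_vector_derivative_join:
  fixes u :: "(real,'n::{finite,wellorder}) vec" and f :: "(real,'m::{finite,wellorder}) vec \<Rightarrow> 'b::real_normed_vector"
  assumes nm: "CARD('n) \<le> CARD('m)" "i < CARD('m) - CARD('n)"
    and f: "(f has_derivative f') (at (join u w))"
  shows "((\<lambda>t. f (join u (w(i := t)))) has_vector_derivative f' (axis (coord (CARD('n) + i)) 1)) (at (w i))"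
proof -
  have "((\<lambda>t. join u w + (t - w i) *\<^sub>R axis (coord (CARD('n) + i)) 1 :: (real,'m) vec) has_vector_derivative
      axis (coord (CARD('n) + i)) 1) (at (w i))"
    by (auto intro!: derivative_eq_intros)
  then have "((\<lambda>t. join u (w(i := t)) :: (real,'m) vec) has_vector_derivative axis (coord (CARD('n) + i)) 1) (at (w i))"
    by (simp add: join_upd[OF nm])
  moreover have "(f has_derivative f') (at (join u (w(i := w i))))" using f by simp
  ultimately have "(f \<circ> (\<lambda>t. join u (w(i := t))) has_derivative f' \<circ> (\<lambda>s. s *\<^sub>R axis (coord (CARD('n) + i)) 1)) (at (w i))"
    unfolding has_vector_derivative_def by (rule diff_chain_at)
  moreover have "linear f'" using f has_derivative_linear by blast
  ultimately show ?thesis unfolding has_vector_derivative_def by (simp add: o_def linear_cmul)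
qed

text \<open>On a slice with fixed \<open>u\<close>, the partial derivative with index i is the
  derivative in the direction of coordinate n + i. Smoothness on an open subset of \<real>^m thus
  yields the smoothness that \<open>local_param\<close> demands.\<close>

lemma Ck_nat_on_join:
  fixes u :: "(real,'n::{finite,wellorder}) vec" and f :: "(real,'m::{finite,wellorder}) vec \<Rightarrow> 'b::real_normed_vector"
  assumes nm: "CARD('n) \<le> CARD('m)" and k: "k = CARD('m) - CARD('n)" and Z: "open Z"
  defines "W \<equiv> {w. (\<forall>i\<ge>k. w i = 0) \<and> join u w \<in> Z}"
  shows "Ck_on r f Z \<Longrightarrow> Ck_nat_on k r (\<lambda>w. f (join u w)) W"
proof (induction r arbitrary: f)
  have cont: "continuous_on W (\<lambda>w. f (join u w))" if "continuous_on Z f" for f :: "_ \<Rightarrow> 'b"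
    by (rule continuous_on_compose2[OF that continuous_on_join]) (auto simp: W_def intro: continuous_on_id)
  {
    case 0
    then show ?case using cont by simp
  next
    case (Suc r)
    have W: "openin (Euclidean_space k) W" unfolding W_def by (rule openin_join_vimage[OF Z])
    have hv: "((\<lambda>t. f (join u (w(i := t)))) has_vector_derivative frechet_derivative f (at (join u w)) (axis (coord (CARD('n) + i)) 1)) (at (w i))"
      if "w \<in> W" "i < k" for w i
      using that unfolding W_def k by (intro has_vector_derivative_join[OF nm] Ck_on_Suc_has_derivative[OF Suc.prems]) auto
    have "Ck_nat_on k r (partial_deriv i (\<lambda>w. f (join u w))) W" if "i < k" for i
    proof (rule Ck_nat_on_cong[OF W])
      show "Ck_nat_on k r (\<lambda>w. frechet_derivative f (at (join u w)) (axis (coord (CARD('n) + i)) 1)) W"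
        using Suc.IH[of "\<lambda>z. frechet_derivative f (at z) (axis (coord (CARD('n) + i)) 1)"] Suc.prems by simp
      show "frechet_derivative f (at (join u w)) (axis (coord (CARD('n) + i)) 1) = partial_deriv i (\<lambda>w. f (join u w)) w" if "w \<in> W" for w
        using vector_derivative_at[OF hv[OF that \<open>i < k\<close>]] by (simp add: partial_deriv_def)
    qed
    moreover have "(\<lambda>t. f (join u (w(i := t)))) differentiable at (w i)" if "w \<in> W" "i < k" for w i
      using hv[OF that] by (rule differentiableI_vector)
    ultimately show ?case using cont[OF Ck_on_continuous[OF Suc.prems]] by simp
  }
qed

text \<open>The opposite passage: composed with \<open>fib\<close>, a function of k variables
  becomes a function of m variables whose partial derivatives in the base directions are 0, and
  \<open>has_derivative_partials\<close> applies.\<close>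

lemma has_derivative_fib:
  fixes h :: "(nat \<Rightarrow> real) \<Rightarrow> 'b::real_normed_vector" and z :: "(real,'m::{finite,wellorder}) vec"
  assumes nm: "n \<le> CARD('m)" and k: "k = CARD('m) - n" and W: "openin (Euclidean_space k) W"
    and h: "Ck_nat_on k (Suc 0) h W" and z: "fib n z \<in> W"
  shows "((\<lambda>z. h (fib n z)) has_derivative
     (\<lambda>v. \<Sum>j\<in>UNIV. v $ j *\<^sub>R (if pos j < n then 0 else partial_deriv (pos j - n) h (fib n z)))) (at z)"
proof -
  let ?S = "{z :: (real,'m) vec. fib n z \<in> W}"
  have S: "open ?S" by (rule open_fib_vimage) (use W k in simp)
  show ?thesis
  proof (rule has_derivative_partials[OF S, where g = "\<lambda>j z. if pos j < n then 0 else partial_deriv (pos j - n) h (fib n z)"])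
    show "z \<in> ?S" using z by simp
    fix j :: 'm
    show "continuous_on ?S (\<lambda>z. if pos j < n then 0 else partial_deriv (pos j - n) h (fib n z))"
    proof (cases "pos j < n")
      case False
      then have "pos j - n < k" using k pos_less[of j] by linarith
      then have "continuous_on W (partial_deriv (pos j - n) h)" using h by simp
      then have "continuous_on ?S (\<lambda>z. partial_deriv (pos j - n) h (fib n z))"
        by (rule continuous_on_compose2[OF _ continuous_on_fib]) auto
      then show ?thesis using False by simp
    qed simp
    fix z :: "(real,'m) vec" assume z: "z \<in> ?S"
    show "((\<lambda>t. h (fib n (z + t *\<^sub>R axis j 1))) has_vector_derivative
        (if pos j < n then 0 else partial_deriv (pos j - n) h (fib n z))) (at 0)"
    proof (cases "pos j < n")
      case True
      then show ?thesis using fib_axis_base[OF nm True, of z] by simp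
    next
      case False
      define i where "i = pos j - n"
      have pj: "pos j = n + i" using False by (simp add: i_def)
      have i: "i < CARD('m) - n" using pos_less[of j] unfolding pj by linarith
      have ji: "j = coord (n + i)" unfolding pj[symmetric] by simp
      have "((\<lambda>t. h ((fib n z)(i := t))) has_vector_derivative partial_deriv i h (fib n z)) (at (fib n z i))"
        unfolding partial_deriv_def using h z i k by (simp add: vector_derivative_works[symmetric])
      then have "((\<lambda>t. h ((fib n z)(i := t))) has_vector_derivative partial_deriv i h (fib n z)) (at (fib n z i + 0))"
        by simp
      then have "((\<lambda>t. h ((fib n z)(i := t))) \<circ> (\<lambda>t. fib n z i + t) has_vector_derivative 1 *\<^sub>R partial_deriv i h (fib n z)) (at 0)"
        by (intro vector_diff_chain_at) (auto intro!: derivative_eq_intros)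
      then show ?thesis using False fib_axis[OF nm i, of z] by (simp add: o_def ji[symmetric] i_def[symmetric])
    qed
  qed
qed

section \<open>Change of variables\<close>

text \<open>\<open>has_measure_differentiable_image\<close> settles the case in which one side is
  finite. If the integral is infinite, the image cannot have finite measure, since the same
  equivalence would then make the integral finite.\<close>

lemma emeasure_differentiable_image:
  fixes g :: "(real,'m::{finite,wellorder}) vec \<Rightarrow> (real,'m) vec"
  assumes S: "S \<in> sets borel" and gS: "g ` S \<in> sets borel"
    and der: "\<And>x. x \<in> S \<Longrightarrow> (g has_derivative g' x) (at x within S)" and inj: "inj_on g S"
    and meas: "(\<lambda>x. det (matrix (g' x)) * indicator S x) \<in> borel_measurable borel"
  shows "emeasure lborel (g ` S) = (\<integral>\<^sup>+x\<in>S. ennreal \<bar>det (matrix (g' x))\<bar> \<partial>lborel)"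
proof -
  have SL: "S \<in> sets lebesgue" using S by auto
  note eq = has_measure_differentiable_image[OF SL der inj]
  have em: "emeasure lebesgue (g ` S) = emeasure lborel (g ` S)" using gS by simp
  have fin1: "emeasure lborel (g ` S) = (\<integral>\<^sup>+x\<in>S. ennreal \<bar>det (matrix (g' x))\<bar> \<partial>lborel)"
    if "g ` S \<in> lmeasurable"
  proof -
    have "((\<lambda>x. \<bar>det (matrix (g' x))\<bar>) has_integral measure lebesgue (g ` S)) S" using eq that by blast
    then have "(\<integral>\<^sup>+x\<in>S. ennreal \<bar>det (matrix (g' x))\<bar> \<partial>lborel) = ennreal (measure lebesgue (g ` S))"
      by (intro nn_integral_has_integral_lebesgue') auto
    then show ?thesis using that em by (simp add: emeasure_eq_measure2)
  qed
  show ?thesis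
  proof (cases "(\<integral>\<^sup>+x\<in>S. ennreal \<bar>det (matrix (g' x))\<bar> \<partial>lborel) = \<infinity>")
    case True
    have nl: "\<not> g ` S \<in> lmeasurable"
    proof
      assume l: "g ` S \<in> lmeasurable"
      then have "emeasure lebesgue (g ` S) \<noteq> top" by (rule fmeasurableD2)
      then show False unfolding em fin1[OF l] True by simp
    qed
    have "emeasure lborel (g ` S) = \<infinity>"
    proof (rule ccontr)
      assume "emeasure lborel (g ` S) \<noteq> \<infinity>"
      then have "emeasure lebesgue (g ` S) < \<infinity>"
        unfolding em infinity_ennreal_def by (rule top.not_eq_extremum[THEN iffD1])
      moreover have "g ` S \<in> sets lebesgue" using gS by auto
      ultimately have "g ` S \<in> lmeasurable" by (intro fmeasurableI)
      then show False using nl by contradiction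
    qed
    then show ?thesis using True by simp
  next
    case False
    then obtain r where r: "0 \<le> r" "(\<integral>\<^sup>+x\<in>S. ennreal \<bar>det (matrix (g' x))\<bar> \<partial>lborel) = ennreal r"
      by (cases "\<integral>\<^sup>+x\<in>S. ennreal \<bar>det (matrix (g' x))\<bar> \<partial>lborel" rule: ennreal_cases) simp_all
    have "(\<integral>\<^sup>+x. ennreal \<bar>det (matrix (g' x)) * indicator S x\<bar> \<partial>lborel) = ennreal r"
      unfolding r(2)[symmetric] by (intro nn_integral_cong) (auto simp: indicator_def)
    then have "((\<lambda>x. \<bar>det (matrix (g' x)) * indicator S x\<bar>) has_integral r) UNIV"
      using meas r(1) by (intro nn_integral_has_integral) auto
    also have "(\<lambda>x. \<bar>det (matrix (g' x)) * indicator S x\<bar>) = (\<lambda>x. if x \<in> S then \<bar>det (matrix (g' x))\<bar> else 0)"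
      by (auto simp: indicator_def)
    finally have "((\<lambda>x. \<bar>det (matrix (g' x))\<bar>) has_integral r) S"
      by (simp add: has_integral_restrict_UNIV)
    then have "g ` S \<in> lmeasurable" using eq by blast
    then show ?thesis by (rule fin1)
  qed
qed

text \<open>Two measures are compared: the push-forward under \<open>g\<close> of the Jacobian
  density on \<open>S\<close>, and Lebesgue measure restricted to the image of \<open>S\<close>. The
  previous lemma shows that they agree on Borel sets, and the claim is the integral of
  \<open>f\<close> against them.\<close>

lemma nn_integral_change_of_variables:
  fixes g :: "(real,'m::{finite,wellorder}) vec \<Rightarrow> (real,'m) vec"
  assumes S[measurable]: "S \<in> sets borel" and gS: "\<And>A. A \<in> sets borel \<Longrightarrow> A \<subseteq> S \<Longrightarrow> g ` A \<in> sets borel"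
    and der: "\<And>x. x \<in> S \<Longrightarrow> (g has_derivative g' x) (at x within S)" and inj: "inj_on g S"
    and meas: "(\<lambda>x. det (matrix (g' x)) * indicator S x) \<in> borel_measurable borel"
    and f[measurable]: "f \<in> borel_measurable borel"
  shows "(\<integral>\<^sup>+y\<in>g ` S. f y \<partial>lborel) = (\<integral>\<^sup>+x\<in>S. f (g x) * ennreal \<bar>det (matrix (g' x))\<bar> \<partial>lborel)"
proof -
  \<comment> \<open>Nothing is known about \<open>g\<close> outside \<open>S\<close>. The default 0
    makes \<open>h\<close> Borel measurable and stays invisible, since the density \<open>J\<close>
    vanishes there.\<close>
  define h where "h x = (if x \<in> S then g x else 0)" for x
  define J where "J x = ennreal \<bar>det (matrix (g' x)) * indicator S x\<bar>" for x
  have J[measurable]: "J \<in> borel_measurable borel" unfolding J_def using meas by measurable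
  have cont: "continuous_on S g"
    unfolding continuous_on_eq_continuous_within using has_derivative_continuous[OF der] by blast
  have h[measurable]: "h \<in> borel_measurable borel"
    unfolding h_def by (rule borel_measurable_continuous_on_if[OF S cont continuous_on_const, simplified])
  have gS': "g ` S \<in> sets borel" using gS[OF S] by simp
  have "distr (density lborel J) borel h = density lborel (indicator (g ` S))"
  proof (rule measure_eqI)
    fix B assume "B \<in> sets (distr (density lborel J) borel h)"
    then have B[measurable]: "B \<in> sets borel" by simp
    define A where "A = S \<inter> h -` B"
    have A[measurable]: "A \<in> sets borel"
      unfolding A_def using measurable_sets[OF h B] by (intro sets.Int S) simp
    have AS: "A \<subseteq> S" by (auto simp: A_def)
    have im: "g ` A = g ` S \<inter> B" by (auto simp: A_def h_def)
    have "emeasure (distr (density lborel J) borel h) B = (\<integral>\<^sup>+x. J x * indicator (h -` B) x \<partial>lborel)"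
      using measurable_sets[OF h B] by (simp add: emeasure_distr emeasure_density)
    also have "\<dots> = (\<integral>\<^sup>+x\<in>A. ennreal \<bar>det (matrix (g' x))\<bar> \<partial>lborel)"
      by (intro nn_integral_cong) (auto simp: J_def A_def indicator_def)
    also have "\<dots> = emeasure lborel (g ` A)"
    proof (rule emeasure_differentiable_image[symmetric])
      show "g ` A \<in> sets borel" using gS[OF A AS] .
      show "(g has_derivative g' x) (at x within A)" if "x \<in> A" for x
        using der AS that has_derivative_subset by blast
      show "inj_on g A" using inj AS inj_on_subset by blast
      have "(\<lambda>x. (det (matrix (g' x)) * indicator S x) * indicator A x) \<in> borel_measurable borel"
        using meas by measurable
      also have "(\<lambda>x. (det (matrix (g' x)) * indicator S x) * indicator A x) = (\<lambda>x. det (matrix (g' x)) * indicator A x)"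
        using AS by (auto simp: indicator_def fun_eq_iff)
      finally show "(\<lambda>x. det (matrix (g' x)) * indicator A x) \<in> borel_measurable borel" .
    qed (rule A)
    also have "\<dots> = emeasure (density lborel (indicator (g ` S))) B"
    proof -
      have "emeasure (density lborel (indicator (g ` S))) B = (\<integral>\<^sup>+x. indicator (g ` S \<inter> B) x \<partial>lborel)"
        using gS' by (simp add: emeasure_density indicator_inter_arith)
      also have "\<dots> = emeasure lborel (g ` S \<inter> B)" using gS' by (intro nn_integral_indicator) simp
      finally show ?thesis by (simp add: im)
    qed
    finally show "emeasure (distr (density lborel J) borel h) B = emeasure (density lborel (indicator (g ` S))) B" .
  qed simp
  then have "(\<integral>\<^sup>+y. f y \<partial>distr (density lborel J) borel h) = (\<integral>\<^sup>+y. f y \<partial>density lborel (indicator (g ` S)))" by simp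
  moreover have "(\<integral>\<^sup>+y. f y \<partial>distr (density lborel J) borel h) = (\<integral>\<^sup>+x. J x * f (h x) \<partial>lborel)"
    by (simp add: nn_integral_distr nn_integral_density)
  moreover have "(\<integral>\<^sup>+y. f y \<partial>density lborel (indicator (g ` S))) = (\<integral>\<^sup>+y\<in>g ` S. f y \<partial>lborel)"
    using gS' by (simp add: nn_integral_density mult.commute)
  moreover have "(\<integral>\<^sup>+x. J x * f (h x) \<partial>lborel) = (\<integral>\<^sup>+x\<in>S. f (g x) * ennreal \<bar>det (matrix (g' x))\<bar> \<partial>lborel)"
    by (intro nn_integral_cong) (auto simp: J_def h_def indicator_def mult.commute)
  ultimately show ?thesis by simp
qed

section \<open>Fubini in split coordinates\<close>

lemma sets_lborel_nat [measurable_cong]: "sets (lborel_nat k) = sets borel"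
  by (simp add: lborel_nat_def)

lemma space_lborel_nat [simp]: "space (lborel_nat k) = UNIV"
  by (simp add: lborel_nat_def)

lemma measurable_extend_0:
  fixes k :: nat
  shows "(\<lambda>y i. if i < k then y i else 0) \<in> (\<Pi>\<^sub>M i\<in>{..<k}. lborel :: real measure) \<rightarrow>\<^sub>M borel"
proof (rule measurable_coordinatewise_then_product)
  fix i
  show "(\<lambda>y. if i < k then y i else (0::real)) \<in> borel_measurable (\<Pi>\<^sub>M i\<in>{..<k}. lborel)"
    by (cases "i < k") auto
qed

lemma nn_integral_lborel_nat:
  assumes "f \<in> borel_measurable borel"
  shows "(\<integral>\<^sup>+w. f w \<partial>lborel_nat k) = (\<integral>\<^sup>+y. f (\<lambda>i. if i < k then y i else 0) \<partial>(\<Pi>\<^sub>M i\<in>{..<k}. lborel))"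
  unfolding lborel_nat_def by (rule nn_integral_distr[OF measurable_extend_0]) (use assms in simp)

lemma closed_topspace_Euclidean: "closed {w :: nat \<Rightarrow> real. \<forall>i\<ge>k. w i = 0}"
proof -
  have "closed ((\<lambda>w :: nat \<Rightarrow> real. w i) -` {0})" for i
    by (intro closed_vimage continuous_on_product_coordinates) simp
  then have "closed (\<Inter>i\<in>{k..}. (\<lambda>w :: nat \<Rightarrow> real. w i) -` {0})" by (intro closed_INT) simp
  also have "(\<Inter>i\<in>{k..}. (\<lambda>w :: nat \<Rightarrow> real. w i) -` {0}) = {w. \<forall>i\<ge>k. w i = 0}" by auto
  finally show ?thesis .
qed

text \<open>\<open>join u\<close> is inverted by \<open>fib\<close> only on sequences that vanish
  from \<open>k\<close> on; by this lemma, identities between integrands in fiber coordinates need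
  to be checked only there.\<close>

lemma AE_lborel_nat: "AE w in lborel_nat k. \<forall>i\<ge>k. w i = 0"
  unfolding lborel_nat_def
  by (subst AE_distr_iff[OF measurable_extend_0]) (simp_all add: closed_topspace_Euclidean)

lemma openin_Euclidean_space_borel: "openin (Euclidean_space k) W \<Longrightarrow> W \<in> sets borel"
  using closed_topspace_Euclidean unfolding openin_Euclidean_space_iff by auto

lemma measurable_join:
  "(\<lambda>(u, w). join (u :: (real,'n::{finite,wellorder}) vec) w :: (real,'m::{finite,wellorder}) vec) \<in> borel_measurable (borel \<Otimes>\<^sub>M borel)"
proof -
  have "continuous_on UNIV (\<lambda>p. join (fst p :: (real,'n) vec) (snd p) :: (real,'m) vec)"
    by (intro continuous_on_join continuous_intros)
  then show ?thesis
    using borel_measurable_continuous_onI by (simp add: borel_prod case_prod_unfold)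
qed

lemma prod_split_coord:
  fixes f :: "nat \<Rightarrow> 'b::comm_monoid_mult"
  assumes nm: "CARD('n) \<le> CARD('m)"
  shows "(\<Prod>j\<in>(UNIV :: 'm::{finite,wellorder} set). f (pos j))
     = (\<Prod>i\<in>(UNIV :: 'n::{finite,wellorder} set). f (pos i)) * (\<Prod>i<CARD('m) - CARD('n). f (CARD('n) + i))"
proof -
  have "(\<Prod>j\<in>(UNIV :: 'm set). f (pos j)) = prod f {..<CARD('m)}"
    by (rule prod.reindex_bij_betw[OF bij_betw_pos])
  also have "{..<CARD('m)} = {..<CARD('n)} \<union> {CARD('n)..<CARD('m)}" using nm by auto
  also have "prod f \<dots> = prod f {..<CARD('n)} * prod f {CARD('n)..<CARD('m)}"
    by (rule prod.union_disjoint) auto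
  also have "prod f {..<CARD('n)} = (\<Prod>i\<in>(UNIV :: 'n set). f (pos i))"
    by (rule prod.reindex_bij_betw[OF bij_betw_pos, symmetric])
  also have "prod f {CARD('n)..<CARD('m)} = (\<Prod>i<CARD('m) - CARD('n). f (CARD('n) + i))"
  proof (rule prod.reindex_bij_witness[of _ "\<lambda>i. CARD('n) + i" "\<lambda>i. i - CARD('n)"])
  qed (use nm in auto)
  finally show ?thesis .
qed

text \<open>A Borel measure that gives each box the product of its side lengths is Lebesgue measure.
  The preimage of a box is the product of a box of base coordinates and a box of sequences.\<close>

lemma lborel_eq_distr_join:
  assumes nm: "CARD('n) \<le> CARD('m)" and k: "k = CARD('m) - CARD('n)"
  shows "(lborel :: (real,'m::{finite,wellorder}) vec measure) =
    distr (lborel \<Otimes>\<^sub>M (\<Pi>\<^sub>M i\<in>{..<k}. lborel)) borel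
      (\<lambda>(u :: (real,'n::{finite,wellorder}) vec, y). join u (\<lambda>i. if i < k then y i else 0))"
    (is "_ = distr ?P borel ?J")
proof (rule lborel_eqI)
  interpret pf: product_sigma_finite "\<lambda>_::nat. lborel :: real measure" by standard
  interpret fpf: finite_product_sigma_finite "\<lambda>_::nat. lborel :: real measure" "{..<k}" by standard simp
  have "(\<lambda>p. (fst p, (\<lambda>y i. if i < k then y i else 0) (snd p))) \<in> ?P \<rightarrow>\<^sub>M borel \<Otimes>\<^sub>M borel"
    by (intro measurable_Pair measurable_compose[OF measurable_snd measurable_extend_0]) simp
  from measurable_compose[OF this measurable_join[where 'm='m]]
  have J: "?J \<in> ?P \<rightarrow>\<^sub>M borel" by (simp add: case_prod_unfold)
  fix l u :: "(real,'m) vec" assume lu: "\<And>b. b \<in> Basis \<Longrightarrow> l \<bullet> b \<le> u \<bullet> b"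
  have le: "l $ j \<le> u $ j" for j using lu[of "axis j 1"] by (simp add: cart_eq_inner_axis)
  let ?l = "\<lambda>i. l $ coord i" and ?u = "\<lambda>i. u $ coord i"
  let ?B = "box (base l) (base u) :: (real,'n) vec set"
  let ?C = "Pi\<^sub>E {..<k} (\<lambda>i. {?l (CARD('n) + i)<..<?u (CARD('n) + i)})"
  have mem: "?J (v, y) \<in> box l u \<longleftrightarrow> v \<in> ?B \<and> (\<forall>i<k. y i \<in> {?l (CARD('n) + i)<..<?u (CARD('n) + i)})" for v y
  proof
    assume a: "?J (v, y) \<in> box l u"
    have "(base l :: (real,'n) vec) $ i < v $ i \<and> v $ i < (base u :: (real,'n) vec) $ i" for i
    proof -
      have "pos i < CARD('m)" using nm pos_less[of i] by linarith
      then show ?thesis using a[unfolded mem_box_cart, rule_format, of "coord (pos i)"]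
        by (simp add: base_def join_def)
    qed
    moreover have "y i \<in> {?l (CARD('n) + i)<..<?u (CARD('n) + i)}" if "i < k" for i
    proof -
      have "CARD('n) + i < CARD('m)" using nm that k by linarith
      then show ?thesis using a[unfolded mem_box_cart, rule_format, of "coord (CARD('n) + i)"] that
        by (simp add: join_def)
    qed
    ultimately show "v \<in> ?B \<and> (\<forall>i<k. y i \<in> {?l (CARD('n) + i)<..<?u (CARD('n) + i)})"
      by (simp add: mem_box_cart)
  next
    assume a: "v \<in> ?B \<and> (\<forall>i<k. y i \<in> {?l (CARD('n) + i)<..<?u (CARD('n) + i)})"
    have "l $ j < ?J (v, y) $ j \<and> ?J (v, y) $ j < u $ j" for j
    proof (cases "pos j < CARD('n)")
      case True
      have "(base l :: (real,'n) vec) $ coord (pos j) < v $ coord (pos j) \<and> v $ coord (pos j) < (base u :: (real,'n) vec) $ coord (pos j)"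
        using a unfolding mem_box_cart by blast
      then show ?thesis using True by (simp add: base_def join_def)
    next
      case False
      then have "pos j - CARD('n) < k" using pos_less[of j] k by linarith
      then show ?thesis using a False by (auto simp: join_def dest!: spec[of _ "pos j - CARD('n)"])
    qed
    then show "?J (v, y) \<in> box l u" by (simp add: mem_box_cart)
  qed
  have vim: "?J -` box l u \<inter> space ?P = ?B \<times> ?C"
  proof (rule set_eqI)
    fix p :: "(real,'n) vec \<times> (nat \<Rightarrow> real)"
    obtain v y where p: "p = (v, y)" by (cases p)
    show "p \<in> ?J -` box l u \<inter> space ?P \<longleftrightarrow> p \<in> ?B \<times> ?C"
      using mem[of v y] unfolding p
      by (auto simp: space_pair_measure space_PiM PiE_def Pi_def extensional_def)
  qed
  have "emeasure (distr ?P borel ?J) (box l u) = emeasure ?P (?B \<times> ?C)"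
    using vim J by (simp add: emeasure_distr)
  also have "\<dots> = emeasure lborel ?B * emeasure (\<Pi>\<^sub>M i\<in>{..<k}. lborel) ?C"
    by (rule fpf.emeasure_pair_measure_Times) (auto intro!: sets_PiM_I_finite)
  also have "emeasure (\<Pi>\<^sub>M i\<in>{..<k}. lborel) ?C = (\<Prod>i<k. emeasure lborel {?l (CARD('n) + i)<..<?u (CARD('n) + i)})"
    by (rule fpf.measure_times) simp
  also have "\<dots> = (\<Prod>i<k. ennreal (?u (CARD('n) + i) - ?l (CARD('n) + i)))"
    using le by simp
  also have "\<dots> = ennreal (\<Prod>i<k. ?u (CARD('n) + i) - ?l (CARD('n) + i))"
    using le by (simp add: prod_ennreal)
  also have "emeasure lborel ?B = ennreal (\<Prod>i\<in>(UNIV :: 'n set). ?u (pos i) - ?l (pos i))"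
  proof -
    have "emeasure lborel ?B = ennreal (\<Prod>b\<in>Basis. (base u - base l :: (real,'n) vec) \<bullet> b)"
      using le by (intro emeasure_lborel_box) (auto simp: Basis_vec_def base_def inner_axis)
    also have "(\<Prod>b\<in>Basis. (base u - base l :: (real,'n) vec) \<bullet> b) = (\<Prod>i\<in>UNIV. (base u - base l :: (real,'n) vec) $ i)"
      unfolding Basis_vec_def by (subst prod.UNION_disjoint) (auto simp: axis_eq_axis inner_axis)
    finally show ?thesis by (simp add: base_def)
  qed
  also have "ennreal (\<Prod>i\<in>(UNIV :: 'n set). ?u (pos i) - ?l (pos i)) * ennreal (\<Prod>i<k. ?u (CARD('n) + i) - ?l (CARD('n) + i))
      = ennreal (\<Prod>j\<in>(UNIV :: 'm set). ?u (pos j) - ?l (pos j))"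
    using prod_split_coord[OF nm, of "\<lambda>i. ?u i - ?l i"] le k
    by (simp add: ennreal_mult[symmetric] prod_nonneg)
  also have "(\<Prod>j\<in>(UNIV :: 'm set). ?u (pos j) - ?l (pos j)) = (\<Prod>b\<in>Basis. (u - l) \<bullet> b)"
    unfolding Basis_vec_def by (subst prod.UNION_disjoint) (auto simp: axis_eq_axis inner_axis)
  finally show "emeasure (distr ?P borel ?J) (box l u) = (\<Prod>b\<in>Basis. (u - l) \<bullet> b)" .
qed simp

lemma measurable_nn_integral_lborel_nat:
  assumes f: "(\<lambda>(x, w). f x w) \<in> borel_measurable (M \<Otimes>\<^sub>M borel)"
  shows "(\<lambda>x. \<integral>\<^sup>+w. f x w \<partial>lborel_nat k) \<in> borel_measurable M"
proof -
  interpret fpf: finite_product_sigma_finite "\<lambda>_::nat. lborel :: real measure" "{..<k}" by standard simp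
  have fx: "f x \<in> borel_measurable borel" if "x \<in> space M" for x
    using measurable_compose[OF measurable_Pair1'[OF that] f] by simp
  have "(\<lambda>p. (fst p, (\<lambda>y i. if i < k then y i else 0) (snd p))) \<in> M \<Otimes>\<^sub>M (\<Pi>\<^sub>M i\<in>{..<k}. lborel :: real measure) \<rightarrow>\<^sub>M M \<Otimes>\<^sub>M borel"
    by (intro measurable_Pair measurable_compose[OF measurable_snd measurable_extend_0]) simp
  from measurable_compose[OF this f]
  have "(\<lambda>(x, y). f x (\<lambda>i. if i < k then y i else 0)) \<in> borel_measurable (M \<Otimes>\<^sub>M (\<Pi>\<^sub>M i\<in>{..<k}. lborel :: real measure))"
    by (simp add: case_prod_unfold)
  then have "(\<lambda>x. \<integral>\<^sup>+y. f x (\<lambda>i. if i < k then y i else 0) \<partial>(\<Pi>\<^sub>M i\<in>{..<k}. lborel)) \<in> borel_measurable M"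
    by (rule fpf.borel_measurable_nn_integral)
  then show ?thesis
    by (rule measurable_cong[THEN iffD1, rotated]) (simp add: nn_integral_lborel_nat[OF fx])
qed

lemma nn_integral_join:
  fixes f :: "(real,'m::{finite,wellorder}) vec \<Rightarrow> ennreal"
  assumes nm: "CARD('n) \<le> CARD('m)" and k: "k = CARD('m) - CARD('n)"
    and f: "f \<in> borel_measurable borel"
  shows "(\<integral>\<^sup>+z. f z \<partial>lborel) = (\<integral>\<^sup>+(u :: (real,'n::{finite,wellorder}) vec). \<integral>\<^sup>+w. f (join u w) \<partial>lborel_nat k \<partial>lborel)"
proof -
  let ?P = "lborel \<Otimes>\<^sub>M (\<Pi>\<^sub>M i\<in>{..<k}. lborel :: real measure) :: ((real,'n) vec \<times> (nat \<Rightarrow> real)) measure"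
  interpret fpf: finite_product_sigma_finite "\<lambda>_::nat. lborel :: real measure" "{..<k}" by standard simp
  have "(\<lambda>p. (fst p, (\<lambda>y i. if i < k then y i else 0) (snd p))) \<in> ?P \<rightarrow>\<^sub>M borel \<Otimes>\<^sub>M borel"
    by (intro measurable_Pair measurable_compose[OF measurable_snd measurable_extend_0]) simp
  from measurable_compose[OF this measurable_join[where 'm='m and 'n='n]]
  have J: "(\<lambda>(u, y). join u (\<lambda>i. if i < k then y i else 0) :: (real,'m) vec) \<in> ?P \<rightarrow>\<^sub>M borel"
    by (simp add: case_prod_unfold)
  have fu: "(\<lambda>w. f (join u w)) \<in> borel_measurable borel" for u :: "(real,'n) vec"
  proof -
    have "continuous_on UNIV (join u :: _ \<Rightarrow> (real,'m) vec)"
      using continuous_on_join[of UNIV "\<lambda>_. u" "\<lambda>w. w"] by simp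
    from measurable_compose[OF borel_measurable_continuous_onI[OF this] f] show ?thesis .
  qed
  have "(\<integral>\<^sup>+z. f z \<partial>lborel) = (\<integral>\<^sup>+p. f ((\<lambda>(u :: (real,'n) vec, y). join u (\<lambda>i. if i < k then y i else 0)) p) \<partial>?P)"
    by (subst lborel_eq_distr_join[OF nm k]) (rule nn_integral_distr[OF J], simp add: f)
  also have "\<dots> = (\<integral>\<^sup>+(u :: (real,'n) vec). \<integral>\<^sup>+y. f (join u (\<lambda>i. if i < k then y i else 0)) \<partial>(\<Pi>\<^sub>M i\<in>{..<k}. lborel) \<partial>lborel)"
    using fpf.nn_integral_fst[OF measurable_compose[OF J f]] by simp
  also have "\<dots> = (\<integral>\<^sup>+(u :: (real,'n) vec). \<integral>\<^sup>+w. f (join u w) \<partial>lborel_nat k \<partial>lborel)"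
    by (simp add: nn_integral_lborel_nat[OF fu])
  finally show ?thesis .
qed

section \<open>Charts and differentials\<close>

lemma is_chart_open: "is_chart c \<Longrightarrow> open (fst c)" "is_chart c \<Longrightarrow> open (snd c ` fst c)"
  by (auto simp: is_chart_def)

lemma is_chart_homeomorphism: "is_chart c \<Longrightarrow> homeomorphism (fst c) (snd c ` fst c) (snd c) (chart_inv c)"
  by (simp add: is_chart_def)

lemma chart_inv_chart [simp]: "is_chart c \<Longrightarrow> x \<in> fst c \<Longrightarrow> chart_inv c (snd c x) = x"
  by (rule homeomorphism_apply1[OF is_chart_homeomorphism])

lemma chart_chart_inv [simp]: "is_chart c \<Longrightarrow> y \<in> snd c ` fst c \<Longrightarrow> snd c (chart_inv c y) = y"
  by (rule homeomorphism_apply2[OF is_chart_homeomorphism])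

lemma chart_inv_in: "is_chart c \<Longrightarrow> y \<in> snd c ` fst c \<Longrightarrow> chart_inv c y \<in> fst c"
  using homeomorphism_image2[OF is_chart_homeomorphism] by blast

lemma continuous_on_chart: "is_chart c \<Longrightarrow> continuous_on (fst c) (snd c)"
  by (rule homeomorphism_cont1[OF is_chart_homeomorphism])

lemma continuous_on_chart_inv: "is_chart c \<Longrightarrow> continuous_on (snd c ` fst c) (chart_inv c)"
  by (rule homeomorphism_cont2[OF is_chart_homeomorphism])

lemma chart_image_eq:
  assumes c: "is_chart c" and A: "A \<subseteq> fst c"
  shows "snd c ` A = snd c ` fst c \<inter> chart_inv c -` A"
  using chart_inv_chart[OF c] A by force

lemma chart_inv_image_eq:
  assumes c: "is_chart c" and A: "A \<subseteq> snd c ` fst c"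
  shows "chart_inv c ` A = fst c \<inter> snd c -` A"
proof (intro set_eqI iffI)
  fix x assume "x \<in> chart_inv c ` A"
  then show "x \<in> fst c \<inter> snd c -` A" using A chart_inv_in[OF c] chart_chart_inv[OF c] by auto
next
  fix x assume "x \<in> fst c \<inter> snd c -` A"
  then show "x \<in> chart_inv c ` A" using chart_inv_chart[OF c, of x] by (metis IntD1 IntD2 imageI vimageE)
qed

lemma open_chart_image:
  assumes c: "is_chart c" and A: "open A" "A \<subseteq> fst c"
  shows "open (snd c ` A)"
  using continuous_open_preimage[OF continuous_on_chart_inv[OF c] is_chart_open(2)[OF c] A(1)]
  by (simp add: chart_image_eq[OF c A(2)])

lemma open_chart_inv_image:
  assumes c: "is_chart c" and A: "open A" "A \<subseteq> snd c ` fst c"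
  shows "open (chart_inv c ` A)"
  using continuous_open_preimage[OF continuous_on_chart[OF c] is_chart_open(1)[OF c] A(1)]
  by (simp add: chart_inv_image_eq[OF c A(2)])

lemma borel_preimage_open:
  fixes f :: "'a::topological_space \<Rightarrow> 'b::topological_space"
  assumes "open S" "continuous_on S f" "A \<in> sets borel"
  shows "S \<inter> f -` A \<in> sets borel"
proof -
  have "f \<in> borel_measurable (restrict_space borel S)"
    by (rule borel_measurable_continuous_on_restrict[OF assms(2)])
  from measurable_sets[OF this assms(3)] have "f -` A \<inter> S \<in> sets (restrict_space borel S)"
    by (simp add: space_restrict_space)
  then show ?thesis using assms(1) by (auto simp: sets_restrict_space_iff Int_commute)
qed

lemma borel_chart_image:
  assumes c: "is_chart c" and A: "A \<in> sets borel" "A \<subseteq> fst c"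
  shows "snd c ` A \<in> sets borel"
  using borel_preimage_open[OF is_chart_open(2)[OF c] continuous_on_chart_inv[OF c] A(1)]
  by (simp add: chart_image_eq[OF c A(2)])

lemma borel_chart_inv_image:
  assumes c: "is_chart c" and A: "A \<in> sets borel" "A \<subseteq> snd c ` fst c"
  shows "chart_inv c ` A \<in> sets borel"
  using borel_preimage_open[OF is_chart_open(1)[OF c] continuous_on_chart[OF c] A(1)]
  by (simp add: chart_inv_image_eq[OF c A(2)])

lemma open_transition_domain:
  assumes c: "is_chart c" and d: "is_chart d" and f: "continuous_on UNIV f"
  shows "open (snd c ` (fst c \<inter> f -` fst d))"
  by (intro open_chart_image[OF c] open_Int open_vimage is_chart_open c d f) auto

lemma local_rep_apply: "is_chart c \<Longrightarrow> x \<in> fst c \<Longrightarrow> local_rep c d f (snd c x) = snd d (f x)"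
  by (simp add: local_rep_def)

lemma has_derivative_differential:
  assumes f: "smooth_wrt A B f" and c: "c \<in> A" and d: "d \<in> B" and x: "x \<in> fst c" "f x \<in> fst d"
  shows "(local_rep c d f has_derivative differential c d f x) (at (snd c x))"
proof -
  have "smooth_on (snd c ` (fst c \<inter> f -` fst d)) (local_rep c d f)"
    using f c d by (simp add: smooth_wrt_def)
  from smooth_on_has_derivative[OF this] show ?thesis unfolding differential_def using x by auto
qed

lemma linear_differential:
  assumes "smooth_wrt A B f" "c \<in> A" "d \<in> B" "x \<in> fst c" "f x \<in> fst d"
  shows "linear (differential c d f x)"
  using has_derivative_differential[OF assms] has_derivative_linear by blast

lemma differential_comp:
  fixes A :: "('p::topological_space, 'm::finite) chart set" and B :: "('q::topological_space, 'n::finite) chart set"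
    and C :: "('r::topological_space, 'k::finite) chart set"
  assumes f: "smooth_wrt A B f" and g: "smooth_wrt B C g"
    and A: "\<And>c. c \<in> A \<Longrightarrow> is_chart c" and B: "\<And>c. c \<in> B \<Longrightarrow> is_chart c"
    and c: "c \<in> A" and d: "d \<in> B" and e: "e \<in> C" and x: "x \<in> fst c" "f x \<in> fst d" "g (f x) \<in> fst e"
  shows "differential c e (g \<circ> f) x = differential d e g (f x) \<circ> differential c d f x"
proof -
  let ?Z = "snd c ` (fst c \<inter> f -` fst d)"
  have cf: "continuous_on UNIV f" using f by (simp add: smooth_wrt_def)
  have Z: "open ?Z" by (rule open_transition_domain[OF A[OF c] B[OF d] cf])
  have xZ: "snd c x \<in> ?Z" using x by auto
  have "(local_rep d e g has_derivative differential d e g (f x)) (at (snd d (f x)))"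
    by (rule has_derivative_differential[OF g d e x(2,3)])
  then have "(local_rep d e g has_derivative differential d e g (f x)) (at (local_rep c d f (snd c x)))"
    by (simp add: local_rep_apply[OF A[OF c] x(1)])
  with has_derivative_differential[OF f c d x(1,2)]
  have "(local_rep d e g \<circ> local_rep c d f has_derivative differential d e g (f x) \<circ> differential c d f x) (at (snd c x))"
    by (rule diff_chain_at)
  then have "(local_rep c e (g \<circ> f) has_derivative differential d e g (f x) \<circ> differential c d f x) (at (snd c x))"
  proof (rule has_derivative_transform_within_open[OF _ Z xZ])
    fix y assume "y \<in> ?Z"
    then obtain z where "z \<in> fst c" "f z \<in> fst d" "y = snd c z" by auto
    then show "(local_rep d e g \<circ> local_rep c d f) y = local_rep c e (g \<circ> f) y"
      using A[OF c] B[OF d] by (simp add: local_rep_def)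
  qed
  then show ?thesis unfolding differential_def using frechet_derivative_at by metis
qed

lemma differential_same:
  assumes c: "is_chart c" and x: "x \<in> fst c"
  shows "differential c c id x = id"
proof -
  have "(id has_derivative id) (at (snd c x))" by (simp add: id_def)
  then have "(local_rep c c id has_derivative id) (at (snd c x))"
    by (rule has_derivative_transform_within_open[OF _ is_chart_open(2)[OF c]])
      (use c x in \<open>auto simp: local_rep_def\<close>)
  then show ?thesis unfolding differential_def using frechet_derivative_at by metis
qed

text \<open>On the segment from the identity to \<open>G\<close> every matrix is positive definite
  and hence nonsingular, so the determinant keeps the sign it has at the identity.\<close>

lemma posdef_det_pos:
  fixes G :: "((real,'n::finite) vec,'n) vec"
  assumes G: "\<And>v. v \<noteq> 0 \<Longrightarrow> v \<bullet> (G *v v) > 0"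
  shows "det G > 0"
proof (rule ccontr)
  assume neg: "\<not> det G > 0"
  define H where "H t = (1 - t) *\<^sub>R mat 1 + t *\<^sub>R G" for t :: real
  have "continuous_on {0..1} (\<lambda>t. det (H t))"
    unfolding H_def det_def by (intro continuous_intros)
  then have "\<exists>t. 0 \<le> t \<and> t \<le> 1 \<and> det (H t) = 0"
    using neg by (intro IVT2'[of "\<lambda>t. det (H t)" 1 0 0]) (auto simp: H_def)
  then obtain t where t: "0 \<le> t" "t \<le> 1" "det (H t) = 0" by blast
  then obtain v where v: "v \<noteq> 0" "H t *v v = 0"
    using det_nz_iff_inj[of "(*v) (H t)"] linear_injective_0[of "(*v) (H t)"] by auto
  have "0 = v \<bullet> (H t *v v)" by (simp add: v)
  also have "\<dots> = (1 - t) * (v \<bullet> v) + t * (v \<bullet> (G *v v))"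
    by (simp add: H_def matrix_vector_mult_add_rdistrib scaleR_matrix_vector_assoc[symmetric] inner_add_right)
  also have "\<dots> > 0"
  proof (cases "t = 0")
    case True then show ?thesis using v(1) by simp
  next
    case False
    then have "t * (v \<bullet> (G *v v)) > 0" using t G[OF v(1)] by simp
    then show ?thesis using t by (intro add_nonneg_pos mult_nonneg_nonneg) auto
  qed
  finally show False by simp
qed

section \<open>The volume form and the Riemannian measure\<close>

locale riem =
  fixes M :: "('p::{second_countable_topology,t2_space}, 'm::{finite,wellorder}) manifold"
  assumes M: "oriented_riemannian_manifold M"
begin

lemma chart: "c \<in> atlas M \<Longrightarrow> is_chart c"
  using M by (simp add: oriented_riemannian_manifold_def oriented_atlas_def smooth_atlas_def)

lemma smooth_id: "smooth_wrt (atlas M) (atlas M) id"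
  using M by (simp add: oriented_riemannian_manifold_def oriented_atlas_def smooth_atlas_def)

lemma ex_chart: "\<exists>c\<in>atlas M. x \<in> fst c"
proof -
  have "(\<Union>c\<in>atlas M. fst c) = UNIV"
    using M by (simp add: oriented_riemannian_manifold_def oriented_atlas_def smooth_atlas_def)
  then show ?thesis by blast
qed

lemma chart_at: "chart_at M x \<in> atlas M" "x \<in> fst (chart_at M x)"
proof -
  have "\<exists>c. c \<in> atlas M \<and> x \<in> fst c" using ex_chart by blast
  from someI_ex[OF this] show "chart_at M x \<in> atlas M" "x \<in> fst (chart_at M x)"
    unfolding chart_at_def by blast+
qed

lemma riemannian: "riemannian_metric M"
  using M unfolding oriented_riemannian_manifold_def by (rule conjunct2)

lemma metric_posdef: "c \<in> atlas M \<Longrightarrow> x \<in> fst c \<Longrightarrow> v \<noteq> 0 \<Longrightarrow> v \<bullet> (metric M c x *v v) > 0"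
  using riemannian[unfolded riemannian_metric_def, THEN bspec, THEN conjunct2, THEN bspec, THEN conjunct2, THEN conjunct1]
  by blast

lemma metric_change:
  "c \<in> atlas M \<Longrightarrow> x \<in> fst c \<Longrightarrow> d \<in> atlas M \<Longrightarrow> x \<in> fst d \<Longrightarrow>
    v \<bullet> (metric M c x *v w) = differential c d id x v \<bullet> (metric M d x *v differential c d id x w)"
  using riemannian[unfolded riemannian_metric_def, THEN bspec, THEN conjunct2, THEN bspec, THEN conjunct2, THEN conjunct2, THEN bspec]
  by blast

lemma smooth_metric: "c \<in> atlas M \<Longrightarrow> smooth_on (snd c ` fst c) (\<lambda>y. metric M c (chart_inv c y))"
  using riemannian[unfolded riemannian_metric_def, THEN bspec, THEN conjunct1] .

lemma metric_pos: "c \<in> atlas M \<Longrightarrow> x \<in> fst c \<Longrightarrow> det (metric M c x) > 0"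
  by (rule posdef_det_pos) (rule metric_posdef)

lemma linear_diff_id: "c \<in> atlas M \<Longrightarrow> d \<in> atlas M \<Longrightarrow> x \<in> fst c \<Longrightarrow> x \<in> fst d \<Longrightarrow> linear (differential c d id x)"
  using linear_differential[OF smooth_id] by simp

lemma differential_id_comp:
  "c \<in> atlas M \<Longrightarrow> d \<in> atlas M \<Longrightarrow> e \<in> atlas M \<Longrightarrow> x \<in> fst c \<Longrightarrow> x \<in> fst d \<Longrightarrow> x \<in> fst e \<Longrightarrow>
   differential c e id x v = differential d e id x (differential c d id x v)"
  using differential_comp[OF smooth_id smooth_id chart chart, of c d e x] by simp

lemma det_metric_change:
  assumes c: "c \<in> atlas M" and d: "d \<in> atlas M" and x: "x \<in> fst c" "x \<in> fst d"
  shows "det (metric M c x) = (det (matrix (differential c d id x)))\<^sup>2 * det (metric M d x)"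
proof -
  let ?D = "matrix (differential c d id x)"
  have D: "differential c d id x v = ?D *v v" for v
    using linear_diff_id[OF c d x] by (simp add: matrix_works)
  have eq: "v \<bullet> (metric M c x *v w) = differential c d id x v \<bullet> (metric M d x *v differential c d id x w)" for v w
    by (rule metric_change[OF c x(1) d x(2)])
  have "metric M c x *v w = (transpose ?D ** metric M d x ** ?D) *v w" for w
  proof (rule vector_eq_ldot[THEN iffD1], intro allI)
    fix v
    have "v \<bullet> (metric M c x *v w) = (?D *v v) \<bullet> (metric M d x *v (?D *v w))" by (simp add: eq D)
    also have "\<dots> = v \<bullet> (transpose ?D *v (metric M d x *v (?D *v w)))"
      by (metis dot_lmul_matrix vector_transpose_matrix)
    finally show "v \<bullet> (metric M c x *v w) = v \<bullet> ((transpose ?D ** metric M d x ** ?D) *v w)"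
      by (simp add: matrix_vector_mul_assoc matrix_mul_assoc)
  qed
  then have "metric M c x = transpose ?D ** metric M d x ** ?D" by (simp add: matrix_eq)
  then show ?thesis by (simp add: det_mul power2_eq_square)
qed

lemma sqrt_metric_change:
  assumes "c \<in> atlas M" "d \<in> atlas M" "x \<in> fst c" "x \<in> fst d"
  shows "sqrt (det (metric M c x)) = \<bar>det (matrix (differential c d id x))\<bar> * sqrt (det (metric M d x))"
  by (simp add: det_metric_change[OF assms] real_sqrt_mult)

lemma vol_form_vdet: "vol_form M c x v = sqrt (det (metric M c x)) * vdet v"
  by (simp add: vol_form_def vdet_def pos_def)

text \<open>A change of chart brings the absolute value of the transition determinant into the
  metric factor, and the determinant itself into \<open>vdet\<close>; in an oriented atlas the two
  coincide.\<close>

lemma differential_form_vol: "differential_form M CARD('m) (vol_form M)"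
  unfolding differential_form_def
proof (intro ballI conjI impI allI)
  fix c x assume c: "c \<in> atlas M" and x: "x \<in> fst c"
  show "alternating CARD('m) (vol_form M c x)"
    using alternating_cmult[OF alternating_vdet] by (simp add: vol_form_vdet[abs_def])
  fix d v assume d: "d \<in> atlas M" and xd: "x \<in> fst d"
  have "det (matrix (differential c d id x)) > 0"
    using M c d x xd by (simp add: oriented_riemannian_manifold_def oriented_atlas_def)
  then show "vol_form M c x v = vol_form M d x (\<lambda>i. differential c d id x (v i))"
    by (simp add: vol_form_vdet vdet_linear[OF linear_diff_id[OF c d x xd]] sqrt_metric_change[OF c d x xd])
qed

lemma continuous_on_sqrt_metric:
  assumes c: "c \<in> atlas M"
  shows "continuous_on (snd c ` fst c) (\<lambda>y. sqrt (det (metric M c (chart_inv c y))))"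
proof -
  have "continuous_on (snd c ` fst c) (\<lambda>y. metric M c (chart_inv c y))"
    using smooth_onD[OF smooth_metric[OF c]] Ck_on_continuous by blast
  then show ?thesis unfolding det_def
    by (intro continuous_intros continuous_on_component)
qed

text \<open>The value 0 beyond the image of the chart makes it Borel measurable on the whole
  coordinate space.\<close>

definition density_in :: "('p, 'm) chart \<Rightarrow> (real, 'm) vec \<Rightarrow> ennreal" where
  "density_in c y = (if y \<in> snd c ` fst c then ennreal (sqrt (det (metric M c (chart_inv c y)))) else 0)"

lemma measurable_density_in:
  assumes c: "c \<in> atlas M" shows "density_in c \<in> borel_measurable borel"
proof -
  have "(\<lambda>y. if y \<in> snd c ` fst c then sqrt (det (metric M c (chart_inv c y))) else 0) \<in> borel_measurable borel"
    using is_chart_open(2)[OF chart[OF c]]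
    by (intro borel_measurable_continuous_on_if continuous_on_sqrt_metric[OF c] continuous_on_const) auto
  then have "(\<lambda>y. ennreal (if y \<in> snd c ` fst c then sqrt (det (metric M c (chart_inv c y))) else 0)) \<in> borel_measurable borel"
    by measurable
  also have "(\<lambda>y. ennreal (if y \<in> snd c ` fst c then sqrt (det (metric M c (chart_inv c y))) else 0)) = density_in c"
    by (auto simp: density_in_def)
  finally show ?thesis .
qed

lemma density_in_integral:
  assumes c: "c \<in> atlas M" and A: "A \<subseteq> fst c"
  shows "(\<integral>\<^sup>+ y \<in> snd c ` A. ennreal (sqrt (det (metric M c (chart_inv c y)))) \<partial>lborel) = (\<integral>\<^sup>+ y \<in> snd c ` A. density_in c y \<partial>lborel)"
  using A by (intro nn_integral_cong) (auto simp: density_in_def indicator_def)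

text \<open>The Jacobian of the transition map is exactly the factor by which the two densities
  differ. This consistency is what allows the local measures to be glued.\<close>

lemma chart_integral_change:
  assumes c: "c \<in> atlas M" and d: "d \<in> atlas M" and A: "A \<in> sets borel" "A \<subseteq> fst c" "A \<subseteq> fst d"
  shows "(\<integral>\<^sup>+ y \<in> snd c ` A. density_in c y \<partial>lborel) = (\<integral>\<^sup>+ y \<in> snd d ` A. density_in d y \<partial>lborel)"
proof -
  let ?g = "local_rep c d id" and ?Z = "snd c ` (fst c \<inter> id -` fst d)"
  let ?g' = "\<lambda>y. frechet_derivative ?g (at y)"
  note cc = chart[OF c] note dd = chart[OF d]
  have Z: "open ?Z" by (rule open_transition_domain[OF cc dd]) (simp add: continuous_on_id id_def)
  have sm: "smooth_on ?Z ?g" using smooth_id c d by (simp add: smooth_wrt_def)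
  have SZ: "snd c ` A \<subseteq> ?Z" using A by auto
  have S: "snd c ` A \<in> sets borel" by (rule borel_chart_image[OF cc A(1,2)])
  have im: "?g ` B = snd d ` (chart_inv c ` B)" for B by (auto simp: local_rep_def)
  have imA: "?g ` snd c ` A = snd d ` A" using A cc by (force simp: local_rep_def)
  have "(\<integral>\<^sup>+ y \<in> snd d ` A. density_in d y \<partial>lborel) = (\<integral>\<^sup>+ y \<in> ?g ` snd c ` A. density_in d y \<partial>lborel)"
    by (simp add: imA)
  also have "\<dots> = (\<integral>\<^sup>+ y \<in> snd c ` A. density_in d (?g y) * ennreal \<bar>det (matrix (?g' y))\<bar> \<partial>lborel)"
  proof (rule nn_integral_change_of_variables[OF S])
    fix B assume B: "B \<in> sets borel" "B \<subseteq> snd c ` A"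
    then have "chart_inv c ` B \<in> sets borel" using A by (intro borel_chart_inv_image[OF cc]) auto
    moreover have "chart_inv c ` B \<subseteq> fst d" using B A cc by fastforce
    ultimately show "?g ` B \<in> sets borel" unfolding im by (rule borel_chart_image[OF dd])
  next
    fix y assume "y \<in> snd c ` A"
    then show "(?g has_derivative ?g' y) (at y within snd c ` A)"
      using SZ smooth_on_has_derivative[OF sm] has_derivative_at_withinI by blast
  next
    show "inj_on ?g (snd c ` A)"
    proof (rule inj_onI)
      fix y z assume "y \<in> snd c ` A" "z \<in> snd c ` A" and eq: "?g y = ?g z"
      then obtain a b where ab: "a \<in> A" "b \<in> A" "y = snd c a" "z = snd c b" by auto
      then have "a \<in> fst c" "b \<in> fst c" using A by auto
      then have "snd d a = snd d b" using eq cc unfolding ab by (simp add: local_rep_apply)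
      then have "a = b" using ab A chart_inv_chart[OF dd] by (metis subsetD)
      then show "y = z" using ab by simp
    qed
  next
    have "continuous_on ?Z (\<lambda>y. det (matrix (?g' y)))"
    proof (rule Ck_on_continuous[of 0], rule Ck_on_det[OF Z])
      fix i j
      have "Ck_on 0 (\<lambda>y. ?g' y (axis j 1)) ?Z" using smooth_onD[OF sm, of "Suc 0"] by simp
      then have "Ck_on 0 (\<lambda>y. ?g' y (axis j 1) $ i) ?Z"
        by (rule Ck_on_linear_comp[OF bounded_linear_vec_nth Z])
      then show "Ck_on 0 (\<lambda>y. matrix (?g' y) $ i $ j) ?Z" by (simp add: matrix_def)
    qed
    then have "continuous_on (snd c ` A) (\<lambda>y. det (matrix (?g' y)))" using SZ continuous_on_subset by blast
    then have "(\<lambda>y. indicator (snd c ` A) y *\<^sub>R det (matrix (?g' y))) \<in> borel_measurable borel"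
      by (rule borel_measurable_continuous_on_indicator[OF S])
    then show "(\<lambda>y. det (matrix (?g' y)) * indicator (snd c ` A) y) \<in> borel_measurable borel"
      by (simp add: mult.commute)
  qed (rule measurable_density_in[OF d])
  also have "\<dots> = (\<integral>\<^sup>+ y \<in> snd c ` A. density_in c y \<partial>lborel)"
  proof (intro nn_integral_cong)
    fix y
    have "density_in d (?g y) * ennreal \<bar>det (matrix (?g' y))\<bar> = density_in c y" if yA: "y \<in> snd c ` A"
    proof -
      obtain a where a: "a \<in> A" "y = snd c a" using yA by auto
      then have ac: "a \<in> fst c" "a \<in> fst d" using A by auto
      have "density_in d (?g y) = ennreal (sqrt (det (metric M d a)))"
        using a ac cc dd by (simp add: density_in_def local_rep_def)
      moreover have "density_in c y = ennreal (sqrt (det (metric M c a)))"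
        using a ac cc by (simp add: density_in_def)
      moreover have "?g' y = differential c d id a" by (simp add: differential_def a)
      moreover have "det (metric M d a) \<ge> 0" using metric_pos[OF d ac(2)] by simp
      ultimately show ?thesis
        by (simp add: sqrt_metric_change[OF c d ac] ennreal_mult[symmetric] mult.commute)
    qed
    then show "density_in d (?g y) * ennreal \<bar>det (matrix (?g' y))\<bar> * indicator (snd c ` A) y = density_in c y * indicator (snd c ` A) y"
      by (auto simp: indicator_def)
  qed
  finally show ?thesis by simp
qed


lemma ex_countable_charts:
  obtains cc :: "nat \<Rightarrow> ('p, 'm) chart" where "\<And>i. cc i \<in> atlas M" "(\<Union>i. fst (cc i)) = UNIV"
proof -
  have "\<And>S. S \<in> fst ` atlas M \<Longrightarrow> openin (top_of_set UNIV) S" using is_chart_open(1)[OF chart] by auto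
  then obtain F where F: "F \<subseteq> fst ` atlas M" "countable F" "\<Union>F = \<Union>(fst ` atlas M)"
    by (rule Lindelof_openin)
  have U: "\<Union>(fst ` atlas M) = UNIV" using ex_chart by blast
  then have ne: "F \<noteq> {}" using F(3) by auto
  define cc where "cc i = (SOME c. c \<in> atlas M \<and> fst c = from_nat_into F i)" for i
  have "cc i \<in> atlas M \<and> fst (cc i) = from_nat_into F i" for i
  proof -
    have "from_nat_into F i \<in> fst ` atlas M" using from_nat_into[OF ne] F(1) by blast
    then have "\<exists>c. c \<in> atlas M \<and> fst c = from_nat_into F i" by auto
    from someI_ex[OF this] show ?thesis unfolding cc_def .
  qed
  then have cc: "cc i \<in> atlas M" "fst (cc i) = from_nat_into F i" for i by simp_all
  have "(\<Union>i. from_nat_into F i) = UNIV"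
    using F(3) U range_from_nat_into[OF ne F(2)] by simp
  then have "(\<Union>i. fst (cc i)) = UNIV" by (simp add: cc(2))
  with cc(1) show ?thesis by (rule that[of cc])
qed

text \<open>The predicate under the \<open>THE\<close> of \<open>riemannian_measure\<close>,
  rewritten with \<open>density_in\<close>; existence and uniqueness are shown below so that the
  description denotes.\<close>

definition chart_measure :: "'p measure \<Rightarrow> bool" where
  "chart_measure \<mu> \<longleftrightarrow> sets \<mu> = sets borel \<and>
     (\<forall>c\<in>atlas M. \<forall>A\<in>sets borel. A \<subseteq> fst c \<longrightarrow> emeasure \<mu> A = (\<integral>\<^sup>+ y \<in> snd c ` A. density_in c y \<partial>lborel))"

lemma riemannian_measure_THE: "riemannian_measure M = (THE \<mu>. chart_measure \<mu>)"
  unfolding riemannian_measure_def chart_measure_def by (simp add: density_in_integral cong: conj_cong)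

lemma ex_disjoint_charts:
  "\<exists>(cc :: nat \<Rightarrow> ('p, 'm) chart) P. (\<forall>i. cc i \<in> atlas M \<and> P i \<in> sets borel \<and> P i \<subseteq> fst (cc i)) \<and>
    disjoint_family P \<and> (\<Union>i. P i) = UNIV"
proof -
  obtain cc :: "nat \<Rightarrow> ('p, 'm) chart" where cc: "\<And>i. cc i \<in> atlas M" "(\<Union>i. fst (cc i)) = UNIV"
    by (rule ex_countable_charts) (rule that)
  let ?P = "disjointed (\<lambda>i. fst (cc i))"
  have "range (\<lambda>i. fst (cc i)) \<subseteq> sets borel"
    using is_chart_open(1)[OF chart[OF cc(1)]] by auto
  from sets.range_disjointed_sets[OF this] have "?P i \<in> sets borel" for i by blast
  moreover have "?P i \<subseteq> fst (cc i)" for i by (rule disjointed_subset)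
  ultimately show ?thesis
    using cc disjoint_family_disjointed[of "\<lambda>i. fst (cc i)"] UN_disjointed_eq[of "\<lambda>i. fst (cc i)"]
    by (intro exI[of _ cc] exI[of _ ?P]) simp
qed

text \<open>The manifold is a countable disjoint union of Borel sets inside charts, on whose subsets
  both measures are prescribed.\<close>

lemma chart_measure_unique:
  assumes "chart_measure \<mu>" "chart_measure \<nu>" shows "\<mu> = \<nu>"
proof -
  obtain cc :: "nat \<Rightarrow> ('p, 'm) chart" and P :: "nat \<Rightarrow> 'p set" where P': "\<forall>i. cc i \<in> atlas M \<and> P i \<in> sets borel \<and> P i \<subseteq> fst (cc i)"
    "disjoint_family P" "(\<Union>i. P i) = UNIV"
    using ex_disjoint_charts by (elim exE conjE) (rule that)
  then have P: "\<And>i. cc i \<in> atlas M" "\<And>i. P i \<in> sets borel" "\<And>i. P i \<subseteq> fst (cc i)"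
    "disjoint_family P" "(\<Union>i. P i) = UNIV" by simp_all
  show ?thesis
  proof (rule measure_eqI)
    show "sets \<mu> = sets \<nu>" using assms by (simp add: chart_measure_def)
    fix A assume "A \<in> sets \<mu>"
    then have A: "A \<in> sets borel" using assms by (simp add: chart_measure_def)
    have split: "emeasure \<kappa> A = (\<Sum>i. emeasure \<kappa> (A \<inter> P i))" if "chart_measure \<kappa>" for \<kappa>
    proof -
      have "(\<Sum>i. emeasure \<kappa> (A \<inter> P i)) = emeasure \<kappa> (\<Union>i. A \<inter> P i)"
        using that A P(2,4) by (intro suminf_emeasure) (auto simp: chart_measure_def disjoint_family_on_def)
      also have "(\<Union>i. A \<inter> P i) = A" using P(5) by blast
      finally show ?thesis by simp
    qed
    have "emeasure \<mu> (A \<inter> P i) = emeasure \<nu> (A \<inter> P i)" for i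
    proof -
      have "A \<inter> P i \<in> sets borel" "A \<inter> P i \<subseteq> fst (cc i)" using A P(2,3)[of i] by auto
      then show ?thesis using assms P(1)[of i] unfolding chart_measure_def by simp
    qed
    then show "emeasure \<mu> A = emeasure \<nu> A" using split assms by simp
  qed
qed

lemma chart_piece_measure:
  assumes c: "c \<in> atlas M" and P: "P \<in> sets borel" "P \<subseteq> fst c"
  obtains \<nu> where "sets \<nu> = sets borel" "\<And>A. A \<in> sets borel \<Longrightarrow> emeasure \<nu> A = (\<integral>\<^sup>+ y \<in> snd c ` (A \<inter> P). density_in c y \<partial>lborel)"
proof -
  note cc = chart[OF c]
  define S where "S = snd c ` P"
  have S: "S \<in> sets borel" unfolding S_def by (rule borel_chart_image[OF cc P])
  have SI: "S \<subseteq> snd c ` fst c" using P by (auto simp: S_def)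
  define h where "h y = (if y \<in> S then chart_inv c y else undefined)" for y
  have h: "h \<in> borel \<rightarrow>\<^sub>M borel"
    unfolding h_def
    using continuous_on_subset[OF continuous_on_chart_inv[OF cc] SI]
    by (intro borel_measurable_continuous_on_if S continuous_on_const)
  note m = measurable_density_in[OF c]
  define \<nu> where "\<nu> = distr (density lborel (\<lambda>y. density_in c y * indicator S y)) borel h"
  have "emeasure \<nu> A = (\<integral>\<^sup>+ y \<in> snd c ` (A \<inter> P). density_in c y \<partial>lborel)" if A: "A \<in> sets borel" for A
  proof -
    have "emeasure \<nu> A = (\<integral>\<^sup>+y. density_in c y * indicator S y * indicator (h -` A) y \<partial>lborel)"
      unfolding \<nu>_def using h m S A measurable_sets[OF h A] by (simp add: emeasure_distr emeasure_density)
    also have "\<dots> = (\<integral>\<^sup>+ y \<in> snd c ` (A \<inter> P). density_in c y \<partial>lborel)"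
    proof (intro nn_integral_cong)
      fix y
      have "y \<in> snd c ` (A \<inter> P) \<longleftrightarrow> y \<in> S \<and> h y \<in> A"
        using P cc by (force simp: S_def h_def)
      then show "density_in c y * indicator S y * indicator (h -` A) y = density_in c y * indicator (snd c ` (A \<inter> P)) y"
        by (auto simp: indicator_def)
    qed
    finally show ?thesis .
  qed
  moreover have "sets \<nu> = sets borel" by (simp add: \<nu>_def)
  ultimately show ?thesis by (rule that[rotated])
qed

text \<open>The measure is the sum of the measures \<nu> of the pieces. For any chart
  \<open>c\<close> and \<open>A\<close> inside it, let \<kappa> be the measure that \<open>c\<close>
  defines on \<open>A\<close>. By \<open>chart_integral_change\<close>,
  \<open>emeasure (\<nu> i) A = emeasure \<kappa> (P i)\<close>, and countable additivity of
  \<kappa> over the partition gives the value required on \<open>A\<close>.\<close>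

lemma ex_chart_measure: "\<exists>\<mu>. chart_measure \<mu>"
proof -
  obtain cc :: "nat \<Rightarrow> ('p, 'm) chart" and P :: "nat \<Rightarrow> 'p set" where P': "\<forall>i. cc i \<in> atlas M \<and> P i \<in> sets borel \<and> P i \<subseteq> fst (cc i)"
    "disjoint_family P" "(\<Union>i. P i) = UNIV"
    using ex_disjoint_charts by (elim exE conjE) (rule that)
  then have P: "\<And>i. cc i \<in> atlas M" "\<And>i. P i \<in> sets borel" "\<And>i. P i \<subseteq> fst (cc i)"
    "disjoint_family P" "(\<Union>i. P i) = UNIV" by simp_all
  have "\<exists>\<nu>. sets \<nu> = sets borel \<and> (\<forall>A\<in>sets borel. emeasure \<nu> A = (\<integral>\<^sup>+ y \<in> snd (cc i) ` (A \<inter> P i). density_in (cc i) y \<partial>lborel))" for i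
    by (rule chart_piece_measure[OF P(1-3)[of i]]) blast
  then obtain \<nu> where \<nu>: "\<And>i. sets (\<nu> i) = sets borel"
    "\<And>i A. A \<in> sets borel \<Longrightarrow> emeasure (\<nu> i) A = (\<integral>\<^sup>+ y \<in> snd (cc i) ` (A \<inter> P i). density_in (cc i) y \<partial>lborel)"
    by metis
  define \<mu> where "\<mu> = measure_of UNIV (sets borel) (\<lambda>A. \<Sum>i. emeasure (\<nu> i) A)"
  have sets: "sets \<mu> = sets borel"
    unfolding \<mu>_def using sets.sigma_sets_eq[of "borel :: 'p measure"] by (simp add: sets_measure_of)
  have em: "emeasure \<mu> A = (\<Sum>i. emeasure (\<nu> i) A)" if "A \<in> sets borel" for A
  proof (rule emeasure_measure_of[OF \<mu>_def])
    show "countably_additive (sets \<mu>) (\<lambda>A. \<Sum>i. emeasure (\<nu> i) A)"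
      unfolding countably_additive_def
    proof (intro allI impI)
      fix B :: "nat \<Rightarrow> 'p set" assume B: "range B \<subseteq> sets \<mu>" "disjoint_family B"
      have "(\<Sum>i. emeasure (\<nu> i) (\<Union>j. B j)) = (\<Sum>i. \<Sum>j. emeasure (\<nu> i) (B j))"
        using B sets \<nu>(1) by (simp add: suminf_emeasure)
      \<comment> \<open>The two summations are exchanged by reading the outer one as an integral
        over a counting measure.\<close>
      also have "\<dots> = (\<integral>\<^sup>+i. (\<Sum>j. emeasure (\<nu> i) (B j)) \<partial>count_space UNIV)"
        by (rule nn_integral_count_space_nat[symmetric])
      also have "\<dots> = (\<Sum>j. \<integral>\<^sup>+i. emeasure (\<nu> i) (B j) \<partial>count_space UNIV)"
        by (rule nn_integral_suminf) simp
      also have "\<dots> = (\<Sum>j. \<Sum>i. emeasure (\<nu> i) (B j))"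
        by (simp add: nn_integral_count_space_nat)
      finally show "(\<Sum>j. \<Sum>i. emeasure (\<nu> i) (B j)) = (\<Sum>i. emeasure (\<nu> i) (\<Union>j. B j))" by simp
    qed
    show "positive (sets \<mu>) (\<lambda>A. \<Sum>i. emeasure (\<nu> i) A)" by (simp add: positive_def)
    show "A \<in> sets \<mu>" using that sets by simp
  qed simp
  have "emeasure \<mu> A = (\<integral>\<^sup>+ y \<in> snd c ` A. density_in c y \<partial>lborel)"
    if c: "c \<in> atlas M" and A: "A \<in> sets borel" "A \<subseteq> fst c" for c A
  proof -
    obtain \<kappa> where \<kappa>: "sets \<kappa> = sets borel" "\<And>B. B \<in> sets borel \<Longrightarrow> emeasure \<kappa> B = (\<integral>\<^sup>+ y \<in> snd c ` (B \<inter> A). density_in c y \<partial>lborel)"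
      by (rule chart_piece_measure[OF c A]) (rule that)
    have "emeasure (\<nu> i) A = emeasure \<kappa> (P i)" for i
    proof -
      have "A \<inter> P i \<in> sets borel" using A P(2) by simp
      then have "(\<integral>\<^sup>+ y \<in> snd (cc i) ` (A \<inter> P i). density_in (cc i) y \<partial>lborel) = (\<integral>\<^sup>+ y \<in> snd c ` (A \<inter> P i). density_in c y \<partial>lborel)"
        using A P(3)[of i] by (intro chart_integral_change P(1) c) auto
      then show ?thesis using A P(2)[of i] by (simp add: \<nu> \<kappa> Int_commute)
    qed
    then have "emeasure \<mu> A = (\<Sum>i. emeasure \<kappa> (P i))" using em[OF A(1)] by simp
    also have "\<dots> = emeasure \<kappa> (\<Union>i. P i)"
      using P(2,4) \<kappa>(1) by (intro suminf_emeasure) auto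
    also have "\<dots> = (\<integral>\<^sup>+ y \<in> snd c ` A. density_in c y \<partial>lborel)"
      using \<kappa>(2)[of UNIV] P(5) by simp
    finally show ?thesis .
  qed
  then show ?thesis using sets unfolding chart_measure_def by blast
qed

abbreviation "vol \<equiv> riemannian_measure M"

lemma chart_measure_vol: "chart_measure vol"
proof -
  obtain \<mu> where "chart_measure \<mu>" using ex_chart_measure by blast
  then have "(THE \<mu>. chart_measure \<mu>) = \<mu>"
    by (intro the_equality chart_measure_unique)
  then show ?thesis using \<open>chart_measure \<mu>\<close> by (simp add: riemannian_measure_THE)
qed

lemma sets_vol [measurable_cong, simp]: "sets vol = sets borel"
  using chart_measure_vol by (simp add: chart_measure_def)

lemma space_vol [simp]: "space vol = UNIV"
  using sets_eq_imp_space_eq[OF sets_vol] by simp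

lemma emeasure_vol:
  "c \<in> atlas M \<Longrightarrow> A \<in> sets borel \<Longrightarrow> A \<subseteq> fst c \<Longrightarrow> emeasure vol A = (\<integral>\<^sup>+ y \<in> snd c ` A. density_in c y \<partial>lborel)"
  using chart_measure_vol by (simp add: chart_measure_def)

lemma nn_integral_vol:
  assumes c: "c \<in> atlas M" and A: "A \<in> sets borel" "A \<subseteq> fst c" and f: "f \<in> borel_measurable borel"
  shows "(\<integral>\<^sup>+x\<in>A. f x \<partial>vol) = (\<integral>\<^sup>+y\<in>snd c ` A. f (chart_inv c y) * density_in c y \<partial>lborel)"
proof -
  note cc = chart[OF c]
  define S where "S = snd c ` A"
  have S: "S \<in> sets borel" unfolding S_def by (rule borel_chart_image[OF cc A])
  have SI: "S \<subseteq> snd c ` fst c" using A by (auto simp: S_def)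
  define h where "h y = (if y \<in> S then chart_inv c y else undefined)" for y
  have h: "h \<in> borel \<rightarrow>\<^sub>M borel"
    unfolding h_def
    using continuous_on_subset[OF continuous_on_chart_inv[OF cc] SI]
    by (intro borel_measurable_continuous_on_if S continuous_on_const)
  note m = measurable_density_in[OF c]
  have eq: "density vol (indicator A) = distr (density lborel (\<lambda>y. density_in c y * indicator S y)) borel h"
  proof (rule measure_eqI)
    fix B assume "B \<in> sets (density vol (indicator A))"
    then have B: "B \<in> sets borel" by simp
    have "emeasure (density vol (indicator A)) B = (\<integral>\<^sup>+x. indicator (A \<inter> B) x \<partial>vol)"
      using A B by (simp add: emeasure_density indicator_inter_arith)
    also have "\<dots> = emeasure vol (A \<inter> B)" using A B by (intro nn_integral_indicator) simp
    also have "\<dots> = (\<integral>\<^sup>+ y \<in> snd c ` (A \<inter> B). density_in c y \<partial>lborel)"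
      using A B by (intro emeasure_vol c) auto
    also have "\<dots> = (\<integral>\<^sup>+y. density_in c y * indicator S y * indicator (h -` B) y \<partial>lborel)"
    proof (intro nn_integral_cong)
      fix y
      have "y \<in> snd c ` (A \<inter> B) \<longleftrightarrow> y \<in> S \<and> h y \<in> B"
        using A cc by (force simp: S_def h_def)
      then show "density_in c y * indicator (snd c ` (A \<inter> B)) y = density_in c y * indicator S y * indicator (h -` B) y"
        by (auto simp: indicator_def)
    qed
    also have "\<dots> = emeasure (distr (density lborel (\<lambda>y. density_in c y * indicator S y)) borel h) B"
      using h m S B measurable_sets[OF h B] by (simp add: emeasure_distr emeasure_density)
    finally show "emeasure (density vol (indicator A)) B = emeasure (distr (density lborel (\<lambda>y. density_in c y * indicator S y)) borel h) B" .
  qed simp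
  have "(\<integral>\<^sup>+x\<in>A. f x \<partial>vol) = (\<integral>\<^sup>+x. f x \<partial>density vol (indicator A))"
    using A f by (simp add: nn_integral_density mult.commute)
  also have "\<dots> = (\<integral>\<^sup>+y. density_in c y * indicator S y * f (h y) \<partial>lborel)"
    unfolding eq using h m S f by (simp add: nn_integral_distr nn_integral_density)
  also have "\<dots> = (\<integral>\<^sup>+y\<in>snd c ` A. f (chart_inv c y) * density_in c y \<partial>lborel)"
    by (intro nn_integral_cong) (auto simp: S_def[symmetric] h_def indicator_def mult.commute)
  finally show ?thesis .
qed

text \<open>These neighbourhoods make \<open>vol\<close> sigma-finite. They also let straightened
  charts have finite volume, on which the finiteness of the fiber volume rests.\<close>

lemma finite_nhd:
  assumes "c \<in> atlas M" "x \<in> fst c"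
  obtains U where "open U" "x \<in> U" "U \<subseteq> fst c" "emeasure vol U < \<infinity>"
proof -
  note cc = chart[OF assms(1)]
  let ?s = "\<lambda>y. sqrt (det (metric M c (chart_inv c y)))" and ?I = "snd c ` fst c"
  \<comment> \<open>Any number above the density at \<open>x\<close> would serve: by continuity the
    density stays below it near \<open>x\<close>, and the unit ball bounds the Lebesgue
    measure.\<close>
  define B where "B = ?s (snd c x) + 1"
  define V where "V = (?I \<inter> ?s -` {..<B}) \<inter> ball (snd c x) 1"
  have V: "open V" unfolding V_def
    by (intro open_Int continuous_open_preimage continuous_on_sqrt_metric assms is_chart_open(2)[OF cc]) auto
  have VI: "V \<subseteq> ?I" by (auto simp: V_def)
  have xV: "snd c x \<in> V" using assms by (auto simp: V_def B_def)
  have im: "snd c ` (chart_inv c ` V) = V" using VI chart_chart_inv[OF cc] by force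
  have U: "open (chart_inv c ` V)" by (rule open_chart_inv_image[OF cc V VI])
  have UI: "chart_inv c ` V \<subseteq> fst c" using VI chart_inv_in[OF cc] by blast
  have "emeasure vol (chart_inv c ` V) = (\<integral>\<^sup>+ y \<in> V. density_in c y \<partial>lborel)"
    using emeasure_vol[OF assms(1) _ UI] U by (simp add: im)
  also have "\<dots> \<le> (\<integral>\<^sup>+ y. ennreal B * indicator (ball (snd c x) 1) y \<partial>lborel)"
    by (intro nn_integral_mono) (auto simp: V_def density_in_def indicator_def intro!: ennreal_leI)
  also have "\<dots> = ennreal B * emeasure lborel (ball (snd c x) 1)"
    by (simp add: nn_integral_cmult_indicator)
  also have "\<dots> < \<infinity>"
    using emeasure_lborel_ball_finite[of "snd c x" 1] by (simp add: ennreal_mult_less_top)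
  finally have "emeasure vol (chart_inv c ` V) < \<infinity>" .
  moreover have "x \<in> chart_inv c ` V" using xV assms cc by (metis chart_inv_chart imageI)
  ultimately show ?thesis using that U UI by blast
qed

lemma sigma_finite_vol: "sigma_finite_measure vol"
proof -
  let ?F = "{U. open U \<and> emeasure vol U < \<infinity>}"
  have "\<And>S. S \<in> ?F \<Longrightarrow> openin (top_of_set UNIV) S" by auto
  then obtain F where F: "F \<subseteq> ?F" "countable F" "\<Union>F = \<Union>?F" by (rule Lindelof_openin)
  have "\<Union>?F = UNIV"
  proof (rule UNIV_eq_I[symmetric])
    fix x
    obtain c where "c \<in> atlas M" "x \<in> fst c" using ex_chart by blast
    then obtain U where "open U" "x \<in> U" "emeasure vol U < \<infinity>" by (rule finite_nhd)
    then show "x \<in> \<Union>?F" by blast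
  qed
  then show ?thesis
    using F by unfold_locales (rule exI[of _ F], auto simp: less_top)
qed

end

section \<open>Quotients of volume forms\<close>

locale subm =
  fixes M :: "('p::{second_countable_topology,t2_space}, 'm::{finite,wellorder}) manifold"
    and N :: "('q::{second_countable_topology,t2_space}, 'n::{finite,wellorder}) manifold"
    and p :: "'p \<Rightarrow> 'q" and k :: nat
  assumes M: "oriented_riemannian_manifold M" and N: "oriented_riemannian_manifold N"
    and p: "submersion M N p" and k: "k = CARD('m) - CARD('n)"
begin

sublocale M: riem M by (rule riem.intro[OF M])
sublocale N: riem N by (rule riem.intro[OF N])

definition quotient :: "('p, 'm) form \<Rightarrow> bool" where
  "quotient = is_quotient M CARD('n) k (vol_form M) (pullback N p (vol_form N))"

lemma smooth_p: "smooth_wrt (atlas M) (atlas N) p"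
  using p by (simp add: submersion_def)

lemma continuous_p: "continuous_on S p"
  using smooth_p continuous_on_subset by (auto simp: smooth_wrt_def)

lemma linear_dp: "c \<in> atlas M \<Longrightarrow> d \<in> atlas N \<Longrightarrow> x \<in> fst c \<Longrightarrow> p x \<in> fst d \<Longrightarrow> linear (differential c d p x)"
  by (rule linear_differential[OF smooth_p])

lemma surj_dp: "c \<in> atlas M \<Longrightarrow> d \<in> atlas N \<Longrightarrow> x \<in> fst c \<Longrightarrow> p x \<in> fst d \<Longrightarrow> surj (differential c d p x)"
  using p by (auto simp: submersion_def)

lemma card_le: "CARD('n) \<le> CARD('m)"
proof -
  fix x :: 'p
  let ?c = "chart_at M x" and ?d = "chart_at N (p x)"
  have "linear (differential ?c ?d p x)" "surj (differential ?c ?d p x)"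
    by (rule linear_dp surj_dp; rule M.chart_at N.chart_at)+
  then show ?thesis using dim_kernel_surj[of "differential ?c ?d p x"] by simp
qed

text \<open>\<open>pullback\<close> is evaluated in the chart that \<open>chart_at\<close> selects
  at the image point, and this choice may jump from point to point. The invariance of the volume
  form lets any other chart take its place.\<close>

lemma pullback_eq:
  assumes c: "c \<in> atlas M" and d: "d \<in> atlas N" and x: "x \<in> fst c" "p x \<in> fst d"
  shows "pullback N p (vol_form N) c x v = vol_form N d (p x) (\<lambda>i. differential c d p x (v i))"
proof -
  let ?d = "chart_at N (p x)"
  have "differential c d (id \<circ> p) x = differential ?d d id (p x) \<circ> differential c ?d p x"
    by (rule differential_comp[OF smooth_p N.smooth_id M.chart N.chart c N.chart_at(1) d x(1) N.chart_at(2)])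
      (simp_all add: x)
  then have D: "differential c d p x w = differential ?d d id (p x) (differential c ?d p x w)" for w by simp
  have "vol_form N ?d (p x) w = vol_form N d (p x) (\<lambda>i. differential ?d d id (p x) (w i))" for w
    using N.differential_form_vol[unfolded differential_form_def, THEN bspec, OF N.chart_at(1), THEN bspec, OF N.chart_at(2),
      THEN conjunct2, THEN bspec, OF d] x(2) by blast
  then show ?thesis by (simp add: pullback_def Let_def D)
qed

lemma pullback_change:
  assumes c: "c \<in> atlas M" "e \<in> atlas M" and x: "x \<in> fst c" "x \<in> fst e"
  shows "pullback N p (vol_form N) c x v = pullback N p (vol_form N) e x (\<lambda>i. differential c e id x (v i))"
proof -
  let ?d = "chart_at N (p x)"
  have "differential c ?d (p \<circ> id) x = differential e ?d p (id x) \<circ> differential c e id x"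
    by (rule differential_comp[OF M.smooth_id smooth_p M.chart M.chart c N.chart_at(1) x(1)])
      (simp_all add: x N.chart_at)
  then have "differential c ?d p x w = differential e ?d p x (differential c e id x w)" for w by simp
  then show ?thesis by (simp add: pullback_def Let_def)
qed

lemma sqrt_N_pos: "d \<in> atlas N \<Longrightarrow> y \<in> fst d \<Longrightarrow> sqrt (det (metric N d y)) > 0"
  using N.metric_pos by simp

text \<open>Forms need no regularity in the base point, so a quotient is chosen at each point
  separately, in the chart \<open>chart_at M x\<close>, and carried to the other charts by the
  transition differential.\<close>

lemma ex_quotient: "\<exists>\<xi>. quotient \<xi>"
proof -
  let ?c = "\<lambda>x. chart_at M x" and ?d = "\<lambda>x. chart_at N (p x)"
  let ?\<beta> = "pullback N p (vol_form N)"
  have nm: "CARD('m) = CARD('n) + k" using card_le k by simp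
  have "\<exists>\<eta>. alternating k \<eta> \<and> (\<forall>v. vol_form M (?c x) x v = wedge CARD('n) k (?\<beta> (?c x) x) \<eta> v)" for x
  proof -
    let ?D = "differential (?c x) (?d x) p x"
    have D: "linear ?D" "surj ?D"
      by (rule linear_dp surj_dp; rule M.chart_at N.chart_at)+
    have b: "sqrt (det (metric N (?d x) (p x))) \<noteq> 0"
      using sqrt_N_pos[OF N.chart_at] by (metis less_irrefl)
    have "?\<beta> (?c x) x = (\<lambda>v. sqrt (det (metric N (?d x) (p x))) * vdet (\<lambda>i. ?D (v i)))"
      by (simp add: pullback_def Let_def N.vol_form_vdet fun_eq_iff)
    then show ?thesis
      using exists_quotient[OF D nm b] by (simp add: M.vol_form_vdet)
  qed
  then obtain \<eta> where \<eta>: "\<And>x. alternating k (\<eta> x)"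
    "\<And>x v. vol_form M (?c x) x v = wedge CARD('n) k (?\<beta> (?c x) x) (\<eta> x) v" by metis
  define \<xi> :: "('p, 'm) form" where "\<xi> c x v = \<eta> x (\<lambda>i. differential c (?c x) id x (v i))" for c x v
  have "differential_form M k \<xi>"
    unfolding differential_form_def
  proof (intro ballI conjI impI allI)
    fix c x assume c: "c \<in> atlas M" and x: "x \<in> fst c"
    show "alternating k (\<xi> c x)"
      unfolding \<xi>_def[abs_def]
      by (rule alternating_compose_linear[OF \<eta>(1) M.linear_diff_id[OF c M.chart_at(1) x M.chart_at(2)]])
    fix e v assume e: "e \<in> atlas M" "x \<in> fst e"
    show "\<xi> c x v = \<xi> e x (\<lambda>i. differential c e id x (v i))"
      unfolding \<xi>_def using M.differential_id_comp[OF c e(1) M.chart_at(1) x e(2) M.chart_at(2)] by simp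
  qed
  moreover have "vol_form M c x v = wedge CARD('n) k (?\<beta> c x) (\<xi> c x) v" if c: "c \<in> atlas M" and x: "x \<in> fst c" for c x v
  proof -
    let ?D = "differential c (?c x) id x"
    have "vol_form M c x v = vol_form M (?c x) x (\<lambda>i. ?D (v i))"
      using M.differential_form_vol[unfolded differential_form_def, THEN bspec, OF c, THEN bspec, OF x,
        THEN conjunct2, THEN bspec, OF M.chart_at(1)] M.chart_at(2) by blast
    also have "\<dots> = wedge CARD('n) k (?\<beta> (?c x) x) (\<eta> x) (\<lambda>i. ?D (v i))" by (rule \<eta>(2))
    also have "\<dots> = wedge CARD('n) k (?\<beta> c x) (\<xi> c x) v"
      unfolding wedge_def \<xi>_def pullback_change[OF c M.chart_at(1) x M.chart_at(2)] by (rule refl)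
    finally show ?thesis .
  qed
  ultimately have "quotient \<xi>" unfolding quotient_def is_quotient_def by blast
  then show ?thesis by blast
qed

lemma quotient_form: "quotient \<xi> \<Longrightarrow> differential_form M k \<xi>"
  unfolding quotient_def is_quotient_def by blast

lemma quotient_alternating: "quotient \<xi> \<Longrightarrow> c \<in> atlas M \<Longrightarrow> x \<in> fst c \<Longrightarrow> alternating k (\<xi> c x)"
  using quotient_form unfolding differential_form_def by blast

text \<open>When all vectors after the first n are tangent to the fiber, \<open>wedge_eval\<close>
  reduces the wedge to a single product. Hence all quotients have the same restriction to the
  fiber.\<close>

lemma quotient_eval:
  assumes \<xi>: "quotient \<xi>" and c: "c \<in> atlas M" and d: "d \<in> atlas N" and x: "x \<in> fst c" "p x \<in> fst d"
    and v: "\<And>i. CARD('n) \<le> i \<Longrightarrow> i < CARD('m) \<Longrightarrow> differential c d p x (v i) = 0"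
  shows "sqrt (det (metric M c x)) * vdet v =
    sqrt (det (metric N d (p x))) * vdet (\<lambda>i. differential c d p x (v i)) * \<xi> c x (\<lambda>i. v (CARD('n) + i))"
proof -
  let ?D = "differential c d p x"
  have \<beta>: "pullback N p (vol_form N) c x = (\<lambda>v. sqrt (det (metric N d (p x))) * vdet (\<lambda>i. ?D (v i)))"
    by (simp add: fun_eq_iff pullback_eq[OF c d x] N.vol_form_vdet)
  have "vol_form M c x v = wedge CARD('n) k (pullback N p (vol_form N) c x) (\<xi> c x) v"
    by (rule \<xi>[unfolded quotient_def is_quotient_def, THEN conjunct2, THEN bspec, OF c, THEN bspec, OF x(1), THEN spec])
  also have "\<dots> = pullback N p (vol_form N) c x v * \<xi> c x (\<lambda>i. v (CARD('n) + i))"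
  proof (rule wedge_eval[where K = "{z. ?D z = 0}"])
    show "alternating CARD('n) (pullback N p (vol_form N) c x)"
      unfolding \<beta> by (rule alternating_cmult[OF alternating_compose_linear[OF alternating_vdet linear_dp[OF c d x]]])
    show "alternating k (\<xi> c x)" by (rule quotient_alternating[OF \<xi> c x(1)])
    show "pullback N p (vol_form N) c x w = 0" if "i < CARD('n)" "w i \<in> {z. ?D z = 0}" for w i
      using alternating_zero[OF alternating_vdet that(1), of "\<lambda>i. ?D (w i)"] that(2) unfolding \<beta> by simp
    show "v i \<in> {z. ?D z = 0}" if "CARD('n) \<le> i" "i < CARD('n) + k" for i
      using v[of i] that card_le k by simp
  qed
  finally show ?thesis by (simp add: M.vol_form_vdet \<beta>)
qed

text \<open>\<open>param_coeff\<close> uses a chart that varies with the point, while the comparison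
  with G takes place in one fixed chart. The partial derivatives transform by the chain rule, and
  \<xi> transforms as a form.\<close>

lemma param_coeff_chart:
  assumes \<xi>: "quotient \<xi>" and lp: "local_param M k F W \<psi>" and w: "w \<in> W" and c: "c \<in> atlas M" "\<psi> w \<in> fst c"
  shows "param_coeff M \<xi> \<psi> w = \<xi> c (\<psi> w) (\<lambda>i. partial_deriv i (snd c \<circ> \<psi>) w)"
proof -
  let ?x = "\<psi> w" and ?e = "chart_at M (\<psi> w)"
  obtain \<phi> where hom: "homeomorphism W (\<psi> ` W) \<psi> \<phi>" and W: "openin (Euclidean_space k) W"
    using lp unfolding local_param_def by blast
  have cont: "continuous_on W \<psi>" using hom by (rule homeomorphism_cont1)
  have Ck: "Ck_nat_on k (Suc 0) (snd ?e \<circ> \<psi>) (W \<inter> \<psi> -` fst ?e)"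
    using lp M.chart_at(1) unfolding local_param_def by blast
  have tr: "differential ?e c id ?x (partial_deriv i (snd ?e \<circ> \<psi>) w) = partial_deriv i (snd c \<circ> \<psi>) w" if i: "i < k" for i
  proof -
    have d1: "((\<lambda>t. (snd ?e \<circ> \<psi>) (w(i := t))) has_vector_derivative partial_deriv i (snd ?e \<circ> \<psi>) w) (at (w i))"
      using Ck i w M.chart_at(2) unfolding partial_deriv_def by (auto simp: vector_derivative_works[symmetric])
    have "(local_rep ?e c id has_derivative differential ?e c id ?x) (at (snd ?e ?x))"
      by (rule has_derivative_differential[OF M.smooth_id M.chart_at(1) c(1) M.chart_at(2)]) (simp add: c)
    then have "(local_rep ?e c id has_derivative differential ?e c id ?x) (at ((snd ?e \<circ> \<psi>) (w(i := w i))))" by simp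
    from diff_chain_at[OF d1[unfolded has_vector_derivative_def] this]
    have d2: "((\<lambda>t. local_rep ?e c id ((snd ?e \<circ> \<psi>) (w(i := t)))) has_vector_derivative
        differential ?e c id ?x (partial_deriv i (snd ?e \<circ> \<psi>) w)) (at (w i))"
      unfolding has_vector_derivative_def
      by (simp add: o_def fun_upd_def linear_cmul[OF M.linear_diff_id[OF M.chart_at(1) c(1) M.chart_at(2) c(2)]])
    \<comment> \<open>The curve stays in the chart only for parameters near \<open>w i\<close>,
      which is enough for a derivative.\<close>
    obtain T where T: "open T" "w i \<in> T" "\<forall>t\<in>T. w(i := t) \<in> W \<inter> \<psi> -` fst ?e"
    proof -
      have "openin (Euclidean_space k) (W \<inter> \<psi> -` fst ?e)"
        by (rule openin_Euclidean_vimage[OF W cont is_chart_open(1)[OF M.chart[OF M.chart_at(1)]]])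
      from openin_Euclidean_space_upd[OF this _ i] w M.chart_at(2)[of ?x] that show thesis by blast
    qed
    have "((\<lambda>t. (snd c \<circ> \<psi>) (w(i := t))) has_vector_derivative
        differential ?e c id ?x (partial_deriv i (snd ?e \<circ> \<psi>) w)) (at (w i))"
    proof (rule has_vector_derivative_transform_within_open[OF d2 T(1,2)])
      show "local_rep ?e c id ((snd ?e \<circ> \<psi>) (w(i := t))) = (snd c \<circ> \<psi>) (w(i := t))" if "t \<in> T" for t
        using T(3) that local_rep_apply[OF M.chart[OF M.chart_at(1)], of "\<psi> (w(i := t))" ?x c id] by simp
    qed
    then show ?thesis unfolding partial_deriv_def by (rule vector_derivative_at[symmetric])
  qed
  have "param_coeff M \<xi> \<psi> w = \<xi> ?e ?x (\<lambda>i. partial_deriv i (snd ?e \<circ> \<psi>) w)"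
    by (simp add: param_coeff_def Let_def)
  also have "\<dots> = \<xi> c ?x (\<lambda>i. differential ?e c id ?x (partial_deriv i (snd ?e \<circ> \<psi>) w))"
    using quotient_form[OF \<xi>, unfolded differential_form_def, THEN bspec, OF M.chart_at(1), THEN bspec, OF M.chart_at(2),
      THEN conjunct2, THEN bspec, OF c(1)] c(2) by blast
  also have "\<dots> = \<xi> c ?x (\<lambda>i. partial_deriv i (snd c \<circ> \<psi>) w)"
    by (intro alternating_cong[OF quotient_alternating[OF \<xi> c]] tr)
  finally show ?thesis .
qed

end

section \<open>Straightened charts\<close>

text \<open>
  The coordinates are \<open>\<Theta> \<circ> snd c\<close>, and \<open>base_\<Theta>\<close> says that \<open>p\<close> becomes the projection to the first \<open>n\<close> of them.
\<close>

locale straight = subm M N p k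
  for M :: "('p::{second_countable_topology,t2_space}, 'm::{finite,wellorder}) manifold"
    and N :: "('q::{second_countable_topology,t2_space}, 'n::{finite,wellorder}) manifold"
    and p :: "'p \<Rightarrow> 'q" and k :: nat +
  fixes c :: "('p, 'm) chart" and d :: "('q, 'n) chart" and U :: "'p set" and \<Omega> :: "(real, 'm) vec set"
    and \<Theta> \<Psi> :: "(real, 'm) vec \<Rightarrow> (real, 'm) vec"
  assumes c: "c \<in> atlas M" and d: "d \<in> atlas N" and U: "open U" "U \<subseteq> fst c" "p ` U \<subseteq> fst d"
    and \<Omega>: "open \<Omega>" and hom: "homeomorphism (snd c ` U) \<Omega> \<Theta> \<Psi>"
    and smooth_\<Theta>: "smooth_on (snd c ` U) \<Theta>" and smooth_\<Psi>: "smooth_on \<Omega> \<Psi>"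
    and base_\<Theta>: "\<And>x. x \<in> U \<Longrightarrow> base (\<Theta> (snd c x)) = snd d (p x)"
begin

lemmas cc = M.chart[OF c]
lemmas dd = N.chart[OF d]

definition pt where "pt z = chart_inv c (\<Psi> z)"

lemma open_cU: "open (snd c ` U)" by (rule open_chart_image[OF cc U(1,2)])

lemma \<Psi>_in: "z \<in> \<Omega> \<Longrightarrow> \<Psi> z \<in> snd c ` U"
  using homeomorphism_image2[OF hom] by blast

lemma pt_in: assumes "z \<in> \<Omega>" shows "pt z \<in> U"
proof -
  obtain x where "x \<in> U" "\<Psi> z = snd c x" using \<Psi>_in[OF assms] by blast
  then show ?thesis using U(2) chart_inv_chart[OF cc, of x] by (auto simp: pt_def)
qed

lemma chart_pt: assumes "z \<in> \<Omega>" shows "snd c (pt z) = \<Psi> z"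
  unfolding pt_def using \<Psi>_in[OF assms] U(2) by (intro chart_chart_inv[OF cc]) auto

lemma \<Theta>_pt: "z \<in> \<Omega> \<Longrightarrow> \<Theta> (snd c (pt z)) = z"
  using homeomorphism_apply2[OF hom] by (simp add: chart_pt)

lemma \<Theta>_in: "x \<in> U \<Longrightarrow> \<Theta> (snd c x) \<in> \<Omega>"
  using homeomorphism_image1[OF hom] by blast

lemma pt_\<Theta>: assumes "x \<in> U" shows "pt (\<Theta> (snd c x)) = x"
proof -
  have "\<Psi> (\<Theta> (snd c x)) = snd c x" using assms by (intro homeomorphism_apply1[OF hom]) simp
  then show ?thesis using assms U(2) chart_inv_chart[OF cc, of x] by (auto simp: pt_def)
qed

lemma p_pt: assumes "z \<in> \<Omega>" shows "p (pt z) = chart_inv d (base z)" "p (pt z) \<in> fst d" "snd d (p (pt z)) = base z"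
proof -
  have "pt z \<in> U" by (rule pt_in[OF assms])
  then show pd: "p (pt z) \<in> fst d" using U(3) by blast
  show sd: "snd d (p (pt z)) = base z" using base_\<Theta>[OF \<open>pt z \<in> U\<close>] by (simp add: \<Theta>_pt[OF assms])
  show "p (pt z) = chart_inv d (base z)" unfolding sd[symmetric] using chart_inv_chart[OF dd pd] by simp
qed

lemma continuous_on_pt: "continuous_on \<Omega> pt"
  unfolding pt_def[abs_def]
  by (rule continuous_on_compose2[OF continuous_on_chart_inv[OF cc] homeomorphism_cont2[OF hom]])
    (use \<Psi>_in U(2) in auto)

abbreviation "D\<Psi> z \<equiv> frechet_derivative \<Psi> (at z)"
abbreviation "D\<Theta> a \<equiv> frechet_derivative \<Theta> (at a)"

lemma has_derivative_\<Psi>: "z \<in> \<Omega> \<Longrightarrow> (\<Psi> has_derivative D\<Psi> z) (at z)"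
  by (rule smooth_on_has_derivative[OF smooth_\<Psi>])

lemma has_derivative_\<Theta>: "a \<in> snd c ` U \<Longrightarrow> (\<Theta> has_derivative D\<Theta> a) (at a)"
  by (rule smooth_on_has_derivative[OF smooth_\<Theta>])

lemma linear_D\<Psi>: "z \<in> \<Omega> \<Longrightarrow> linear (D\<Psi> z)"
  using has_derivative_\<Psi> has_derivative_linear by blast

lemma linear_D\<Theta>: "a \<in> snd c ` U \<Longrightarrow> linear (D\<Theta> a)"
  using has_derivative_\<Theta> has_derivative_linear by blast

lemma D\<Psi>_D\<Theta>:
  assumes a: "a \<in> snd c ` U" shows "D\<Psi> (\<Theta> a) (D\<Theta> a v) = v"
proof -
  have "\<Theta> a \<in> \<Omega>" using homeomorphism_image1[OF hom] a by blast
  then have "(\<Psi> \<circ> \<Theta> has_derivative D\<Psi> (\<Theta> a) \<circ> D\<Theta> a) (at a)"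
    by (intro diff_chain_at has_derivative_\<Theta>[OF a] has_derivative_\<Psi>)
  then have "(id has_derivative D\<Psi> (\<Theta> a) \<circ> D\<Theta> a) (at a)"
    by (rule has_derivative_transform_within_open[OF _ open_cU a]) (simp add: homeomorphism_apply1[OF hom])
  moreover have "(id has_derivative id) (at a)" by (simp add: id_def)
  ultimately have "D\<Psi> (\<Theta> a) \<circ> D\<Theta> a = id" by (rule has_derivative_unique)
  then show ?thesis by (metis comp_apply id_apply)
qed

lemma dp_D\<Psi>:
  assumes z: "z \<in> \<Omega>" shows "differential c d p (pt z) (D\<Psi> z v) = base v"
proof -
  have "(local_rep c d p has_derivative differential c d p (pt z)) (at (snd c (pt z)))"
    by (rule has_derivative_differential[OF smooth_p c d]) (use pt_in[OF z] U in auto)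
  then have "(local_rep c d p \<circ> \<Psi> has_derivative differential c d p (pt z) \<circ> D\<Psi> z) (at z)"
    unfolding chart_pt[OF z] by (rule diff_chain_at[OF has_derivative_\<Psi>[OF z]])
  then have "(base has_derivative differential c d p (pt z) \<circ> D\<Psi> z) (at z)"
  proof (rule has_derivative_transform_within_open[OF _ \<Omega> z])
    fix y assume "y \<in> \<Omega>"
    then show "(local_rep c d p \<circ> \<Psi>) y = base y"
      using p_pt(3)[of y] by (simp add: local_rep_def pt_def)
  qed
  moreover have "(base has_derivative base) (at z)"
    by (intro bounded_linear_imp_has_derivative linear_conv_bounded_linear[THEN iffD1] linear_base)
  ultimately have "differential c d p (pt z) \<circ> D\<Psi> z = base" by (rule has_derivative_unique)
  then show ?thesis by (metis comp_apply)
qed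

lemma continuous_on_det_D\<Psi>: "continuous_on \<Omega> (\<lambda>z. det (matrix (D\<Psi> z)))"
proof (rule Ck_on_continuous[of 0], rule Ck_on_det[OF \<Omega>])
  fix i j
  have "Ck_on 0 (\<lambda>y. D\<Psi> y (axis j 1)) \<Omega>" using smooth_onD[OF smooth_\<Psi>, of "Suc 0"] by simp
  then have "Ck_on 0 (\<lambda>y. D\<Psi> y (axis j 1) $ i) \<Omega>"
    by (rule Ck_on_linear_comp[OF bounded_linear_vec_nth \<Omega>])
  then show "Ck_on 0 (\<lambda>y. matrix (D\<Psi> y) $ i $ j) \<Omega>" by (simp add: matrix_def)
qed

definition G where
  "G z = sqrt (det (metric M c (pt z))) * \<bar>det (matrix (D\<Psi> z))\<bar> / sqrt (det (metric N d (p (pt z))))"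

lemma G_nonneg: assumes z: "z \<in> \<Omega>" shows "G z \<ge> 0"
proof -
  have "pt z \<in> fst c" using pt_in[OF z] U(2) by blast
  then have "sqrt (det (metric M c (pt z))) \<ge> 0" using M.metric_pos[OF c, of "pt z"] by simp
  then show ?thesis unfolding G_def
    using sqrt_N_pos[OF d p_pt(2)[OF z]] by (intro divide_nonneg_nonneg mult_nonneg_nonneg) simp_all
qed

lemma continuous_on_G: "continuous_on \<Omega> G"
proof -
  have "continuous_on \<Omega> (\<lambda>z. sqrt (det (metric M c (chart_inv c (\<Psi> z)))))"
    by (rule continuous_on_compose2[OF M.continuous_on_sqrt_metric[OF c] homeomorphism_cont2[OF hom]])
      (use \<Psi>_in U(2) in auto)
  moreover have "continuous_on \<Omega> (\<lambda>z. sqrt (det (metric N d (chart_inv d (base z)))))"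
  proof (rule continuous_on_compose2[OF N.continuous_on_sqrt_metric[OF d] continuous_on_base])
    show "base ` \<Omega> \<subseteq> snd d ` fst d" using p_pt(2,3) by (metis image_eqI image_subsetI)
  qed
  then have "continuous_on \<Omega> (\<lambda>z. sqrt (det (metric N d (p (pt z)))))"
    by (rule continuous_on_cong[THEN iffD1, rotated -1]) (simp_all add: p_pt(1))
  moreover have "sqrt (det (metric N d (p (pt z)))) \<noteq> 0" if "z \<in> \<Omega>" for z
    using sqrt_N_pos[OF d p_pt(2)[OF that]] by simp
  ultimately show ?thesis
    unfolding G_def[abs_def] pt_def[symmetric]
    by (intro continuous_on_divide continuous_on_mult continuous_on_rabs continuous_on_det_D\<Psi>) auto
qed

text \<open>\<open>gdens\<close> and \<open>pt0\<close> extend \<open>G\<close> and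
  \<open>pt\<close> to Borel functions on the whole space. Since \<open>gdens\<close> is 0 outside
  \<Omega>, the default value of \<open>pt0\<close> never matters in a product with it.\<close>

definition gdens where "gdens z = (if z \<in> \<Omega> then ennreal (G z) else 0)"

lemma measurable_gdens: "gdens \<in> borel_measurable borel"
proof -
  have "(\<lambda>z. if z \<in> \<Omega> then G z else 0) \<in> borel_measurable borel"
    by (intro borel_measurable_continuous_on_if continuous_on_G continuous_on_const) (use \<Omega> in auto)
  then have "(\<lambda>z. ennreal (if z \<in> \<Omega> then G z else 0)) \<in> borel_measurable borel" by measurable
  also have "(\<lambda>z. ennreal (if z \<in> \<Omega> then G z else 0)) = gdens" by (auto simp: gdens_def)
  finally show ?thesis .
qed

definition pt0 where "pt0 z = (if z \<in> \<Omega> then pt z else undefined)"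

lemma measurable_pt0: "pt0 \<in> borel \<rightarrow>\<^sub>M borel"
  unfolding pt0_def[abs_def]
  by (intro borel_measurable_continuous_on_if continuous_on_pt continuous_on_const) (use \<Omega> in auto)

text \<open>The inner integral of Tonelli's theorem: \<open>f\<close> integrated over the slice
  above \<open>y\<close> with density G. The value 0 outside \<open>fst d\<close> reflects that U
  lies over \<open>fst d\<close>.\<close>

definition K :: "('p \<Rightarrow> ennreal) \<Rightarrow> 'q \<Rightarrow> ennreal" where
  "K f y = (if y \<in> fst d then \<integral>\<^sup>+w. f (pt0 (join (snd d y) w)) * gdens (join (snd d y) w) \<partial>lborel_nat k else 0)"

lemma measurable_K_integrand:
  assumes f: "f \<in> borel_measurable borel"
  shows "(\<lambda>z. f (pt0 z) * gdens z) \<in> borel_measurable borel"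
  using measurable_compose[OF measurable_pt0 f] measurable_gdens by simp

lemma measurable_K_inner:
  assumes f: "f \<in> borel_measurable borel"
  shows "(\<lambda>u. \<integral>\<^sup>+w. f (pt0 (join u w)) * gdens (join u w) \<partial>lborel_nat k) \<in> borel_measurable borel"
proof (rule measurable_nn_integral_lborel_nat)
  show "(\<lambda>(u, w). f (pt0 (join u w)) * gdens (join u w)) \<in> borel_measurable (borel \<Otimes>\<^sub>M borel)"
    using measurable_compose[OF measurable_join measurable_K_integrand[OF f]] by (simp add: case_prod_unfold)
qed

lemma measurable_K:
  assumes f: "f \<in> borel_measurable borel"
  shows "K f \<in> borel_measurable borel"
proof -
  have m: "(\<lambda>y. if y \<in> fst d then snd d y else 0) \<in> borel_measurable borel"
    by (intro borel_measurable_continuous_on_if continuous_on_chart[OF dd] continuous_on_const)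
      (use is_chart_open(1)[OF dd] in auto)
  have "(\<lambda>y. if y \<in> fst d then (\<integral>\<^sup>+w. f (pt0 (join (if y \<in> fst d then snd d y else 0) w)) * gdens (join (if y \<in> fst d then snd d y else 0) w) \<partial>lborel_nat k) else 0)
      \<in> borel_measurable borel"
    using is_chart_open(1)[OF dd] measurable_compose[OF m measurable_K_inner[OF f]]
    by (intro measurable_If) auto
  also have "(\<lambda>y. if y \<in> fst d then (\<integral>\<^sup>+w. f (pt0 (join (if y \<in> fst d then snd d y else 0) w)) * gdens (join (if y \<in> fst d then snd d y else 0) w) \<partial>lborel_nat k) else 0) = K f"
    by (auto simp: K_def fun_eq_iff)
  finally show ?thesis .
qed

text \<open>Pulled back by \<Psi>, the density of M is G times the density of N at the base point.
  The condition that p maps into \<open>B\<close> also concerns base coordinates only, so the inner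
  integral of \<open>nn_integral_join\<close> retains just \<open>indicator A\<close> and G.\<close>

lemma emeasure_straight:
  assumes A: "A \<in> sets borel" "A \<subseteq> U" and B: "B \<in> sets borel"
  shows "emeasure M.vol (A \<inter> p -` B) = (\<integral>\<^sup>+y\<in>B. K (indicator A) y \<partial>N.vol)"
proof -
  define E where "E = {z \<in> \<Omega>. pt z \<in> A \<inter> p -` B}"
  have pB: "p -` B \<in> sets borel"
    using measurable_sets[OF borel_measurable_continuous_onI[OF continuous_p] B] by simp
  then have AB: "A \<inter> p -` B \<in> sets borel" using A by simp
  have Ebor: "E \<in> sets borel"
    using borel_preimage_open[OF \<Omega> continuous_on_pt AB] by (simp add: E_def Int_def vimage_def)
  have E\<Omega>: "E \<subseteq> \<Omega>" by (auto simp: E_def)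
  have im: "snd c ` (A \<inter> p -` B) = \<Psi> ` E"
  proof (intro set_eqI iffI)
    fix a assume "a \<in> snd c ` (A \<inter> p -` B)"
    then obtain x where x: "x \<in> A" "p x \<in> B" "a = snd c x" by auto
    then have xU: "x \<in> U" using A by auto
    have "\<Theta> (snd c x) \<in> E" using x \<Theta>_in[OF xU] pt_\<Theta>[OF xU] by (simp add: E_def)
    moreover have "\<Psi> (\<Theta> (snd c x)) = a" using x(3) xU homeomorphism_apply1[OF hom, of "snd c x"] by simp
    ultimately show "a \<in> \<Psi> ` E" by (metis imageI)
  next
    fix a assume "a \<in> \<Psi> ` E"
    then obtain z where z: "z \<in> E" "a = \<Psi> z" by auto
    then show "a \<in> snd c ` (A \<inter> p -` B)" using chart_pt[of z] by (auto simp: E_def intro!: image_eqI[of _ _ "pt z"])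
  qed
  have "emeasure M.vol (A \<inter> p -` B) = (\<integral>\<^sup>+ a \<in> snd c ` (A \<inter> p -` B). M.density_in c a \<partial>lborel)"
    using A U(2) by (intro M.emeasure_vol c AB) auto
  also have "\<dots> = (\<integral>\<^sup>+ a \<in> \<Psi> ` E. M.density_in c a \<partial>lborel)" by (simp only: im)
  also have "\<dots> = (\<integral>\<^sup>+ z \<in> E. M.density_in c (\<Psi> z) * ennreal \<bar>det (matrix (D\<Psi> z))\<bar> \<partial>lborel)"
  proof (rule nn_integral_change_of_variables[OF Ebor])
    fix B assume B: "B \<in> sets borel" "B \<subseteq> E"
    have "\<Psi> ` B = snd c ` U \<inter> \<Theta> -` B"
    proof (intro set_eqI iffI)
      fix a assume "a \<in> \<Psi> ` B"
      then obtain z where z: "z \<in> B" "a = \<Psi> z" by blast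
      then have "z \<in> \<Omega>" using B(2) E\<Omega> by blast
      then show "a \<in> snd c ` U \<inter> \<Theta> -` B"
        using z \<Psi>_in[of z] homeomorphism_apply2[OF hom, of z] by simp
    next
      fix a assume a: "a \<in> snd c ` U \<inter> \<Theta> -` B"
      then have "\<Psi> (\<Theta> a) = a" using homeomorphism_apply1[OF hom, of a] by blast
      then show "a \<in> \<Psi> ` B" using a by (intro image_eqI[of _ _ "\<Theta> a"]) auto
    qed
    then show "\<Psi> ` B \<in> sets borel"
      using borel_preimage_open[OF open_cU homeomorphism_cont1[OF hom] B(1)] by simp
  next
    fix z assume "z \<in> E"
    then show "(\<Psi> has_derivative D\<Psi> z) (at z within E)"
      using E\<Omega> has_derivative_\<Psi> has_derivative_at_withinI by blast
  next
    show "inj_on \<Psi> E" by (rule inj_on_inverseI[of _ \<Theta>]) (use E\<Omega> homeomorphism_apply2[OF hom] in auto)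
  next
    have "continuous_on E (\<lambda>z. det (matrix (D\<Psi> z)))" using continuous_on_subset[OF continuous_on_det_D\<Psi> E\<Omega>] .
    then have "(\<lambda>z. indicator E z *\<^sub>R det (matrix (D\<Psi> z))) \<in> borel_measurable borel"
      by (rule borel_measurable_continuous_on_indicator[OF Ebor])
    then show "(\<lambda>z. det (matrix (D\<Psi> z)) * indicator E z) \<in> borel_measurable borel" by (simp add: mult.commute)
  qed (rule M.measurable_density_in[OF c])
  also have "\<dots> = (\<integral>\<^sup>+ z. (indicator A (pt0 z) * gdens z) * (indicator (snd d ` (B \<inter> fst d)) (base z) * N.density_in d (base z)) \<partial>lborel)"
  proof (intro nn_integral_cong)
    fix z
    show "M.density_in c (\<Psi> z) * ennreal \<bar>det (matrix (D\<Psi> z))\<bar> * indicator E z =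
      (indicator A (pt0 z) * gdens z) * (indicator (snd d ` (B \<inter> fst d)) (base z) * N.density_in d (base z))"
    proof (cases "z \<in> \<Omega>")
      case True
      have yd: "p (pt z) \<in> fst d" "base z = snd d (p (pt z))" using p_pt[OF True] by simp_all
      have mem: "base z \<in> snd d ` (B \<inter> fst d) \<longleftrightarrow> p (pt z) \<in> B"
      proof
        assume "base z \<in> snd d ` (B \<inter> fst d)"
        then obtain y where y: "y \<in> B" "y \<in> fst d" "base z = snd d y" by auto
        have "chart_inv d (snd d (p (pt z))) = chart_inv d (snd d y)" using y(3) yd(2) by simp
        then show "p (pt z) \<in> B" using y chart_inv_chart[OF dd] yd(1) by simp
      qed (use yd in auto)
      have bi: "base z \<in> snd d ` fst d" using yd by simp
      have \<Psi>i: "\<Psi> z \<in> snd c ` fst c" using \<Psi>_in[OF True] U(2) by auto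
      have s: "sqrt (det (metric N d (p (pt z)))) > 0" by (rule sqrt_N_pos[OF d yd(1)])
      have g: "sqrt (det (metric M c (pt z))) \<ge> 0" using M.metric_pos[OF c, of "pt z"] pt_in[OF True] U(2) by auto
      have "gdens z * N.density_in d (base z) = ennreal (G z * sqrt (det (metric N d (p (pt z)))))"
        using True G_nonneg[OF True] s bi by (simp add: gdens_def N.density_in_def p_pt(1)[OF True, symmetric] ennreal_mult)
      also have "\<dots> = ennreal (sqrt (det (metric M c (pt z))) * \<bar>det (matrix (D\<Psi> z))\<bar>)"
        using s by (simp add: G_def)
      also have "\<dots> = M.density_in c (\<Psi> z) * ennreal \<bar>det (matrix (D\<Psi> z))\<bar>"
        using \<Psi>i g by (simp add: M.density_in_def ennreal_mult pt_def)
      finally have eq: "gdens z * N.density_in d (base z) = M.density_in c (\<Psi> z) * ennreal \<bar>det (matrix (D\<Psi> z))\<bar>" .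
      show ?thesis unfolding eq[symmetric] using True mem
        by (auto simp: indicator_def E_def pt0_def)
    next
      case False
      then show ?thesis using E\<Omega> by (auto simp: gdens_def indicator_def)
    qed
  qed
  also have "\<dots> = (\<integral>\<^sup>+u. \<integral>\<^sup>+w. (indicator A (pt0 (join u w)) * gdens (join u w)) * (indicator (snd d ` (B \<inter> fst d)) u * N.density_in d u) \<partial>lborel_nat k \<partial>lborel)"
  proof (subst nn_integral_join[OF card_le k])
    have dB: "snd d ` (B \<inter> fst d) \<in> sets borel"
      using B is_chart_open(1)[OF dd] by (intro borel_chart_image[OF dd]) auto
    have "(base :: (real,'m) vec \<Rightarrow> (real,'n) vec) \<in> borel_measurable borel" by (rule borel_measurable_continuous_onI[OF continuous_on_base])
    note mb = this
    have "(\<lambda>u. indicator (snd d ` (B \<inter> fst d)) u * N.density_in d u) \<in> borel_measurable borel"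
      using dB N.measurable_density_in[OF d] by simp
    from measurable_compose[OF mb this] measurable_K_integrand[of "indicator A"] A(1)
    show "(\<lambda>z. (indicator A (pt0 z) * gdens z) * (indicator (snd d ` (B \<inter> fst d)) (base z) * N.density_in d (base z))) \<in> borel_measurable borel"
      by simp
  qed (simp add: card_le)
  also have "\<dots> = (\<integral>\<^sup>+u. (\<integral>\<^sup>+w. indicator A (pt0 (join u w)) * gdens (join u w) \<partial>lborel_nat k) * (indicator (snd d ` (B \<inter> fst d)) u * N.density_in d u) \<partial>lborel)"
  proof (intro nn_integral_cong nn_integral_multc)
    fix u
    have "continuous_on UNIV (\<lambda>w. join u w)" using continuous_on_join[of UNIV "\<lambda>_. u" "\<lambda>w. w"] by simp
    from measurable_compose[OF borel_measurable_continuous_onI[OF this] measurable_K_integrand[of "indicator A"]] A(1)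
    show "(\<lambda>w. indicator A (pt0 (join u w)) * gdens (join u w)) \<in> borel_measurable (lborel_nat k)" by simp
  qed
  also have "\<dots> = (\<integral>\<^sup>+u\<in>snd d ` (B \<inter> fst d). K (indicator A) (chart_inv d u) * N.density_in d u \<partial>lborel)"
  proof (intro nn_integral_cong)
    fix u
    show "(\<integral>\<^sup>+w. indicator A (pt0 (join u w)) * gdens (join u w) \<partial>lborel_nat k) * (indicator (snd d ` (B \<inter> fst d)) u * N.density_in d u) =
      K (indicator A) (chart_inv d u) * N.density_in d u * indicator (snd d ` (B \<inter> fst d)) u"
    proof (cases "u \<in> snd d ` (B \<inter> fst d)")
      case True
      then have u: "u \<in> snd d ` fst d" by blast
      then show ?thesis using True chart_inv_in[OF dd u] chart_chart_inv[OF dd u]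
        by (simp add: K_def)
    qed simp
  qed
  also have "\<dots> = (\<integral>\<^sup>+y\<in>B \<inter> fst d. K (indicator A) y \<partial>N.vol)"
    using B is_chart_open(1)[OF dd] A(1) by (intro N.nn_integral_vol[symmetric] d measurable_K) auto
  also have "\<dots> = (\<integral>\<^sup>+y\<in>B. K (indicator A) y \<partial>N.vol)"
    by (intro nn_integral_cong) (auto simp: K_def indicator_def)
  finally show ?thesis .
qed

end

section \<open>Parametrisations of a fiber in a straightened chart\<close>

locale sparam = straight M N p k c d U \<Omega> \<Theta> \<Psi>
  for M :: "('p::{second_countable_topology,t2_space}, 'm::{finite,wellorder}) manifold"
    and N :: "('q::{second_countable_topology,t2_space}, 'n::{finite,wellorder}) manifold"
    and p :: "'p \<Rightarrow> 'q" and k :: nat and c :: "('p, 'm) chart" and d :: "('q, 'n) chart"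
    and U :: "'p set" and \<Omega> :: "(real, 'm) vec set" and \<Theta> \<Psi> :: "(real, 'm) vec \<Rightarrow> (real, 'm) vec" +
  fixes \<xi> :: "('p, 'm) form" and y :: 'q and W :: "(nat \<Rightarrow> real) set" and \<psi> :: "(nat \<Rightarrow> real) \<Rightarrow> 'p"
  assumes \<xi>: "quotient \<xi>" and lp: "local_param M k (p -` {y}) W \<psi>"
begin


definition "\<phi> = (SOME \<phi>. homeomorphism W (\<psi> ` W) \<psi> \<phi>)"

lemma hom_\<psi>: "homeomorphism W (\<psi> ` W) \<psi> \<phi>"
  unfolding \<phi>_def
  by (rule someI_ex[OF lp[unfolded local_param_def, THEN conjunct2, THEN conjunct2, THEN conjunct1]])

lemma openin_W: "openin (Euclidean_space k) W"
  by (rule lp[unfolded local_param_def, THEN conjunct1])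

lemma openin_\<psi>: "openin (top_of_set (p -` {y})) (\<psi> ` W)"
  by (rule lp[unfolded local_param_def, THEN conjunct2, THEN conjunct1])

lemma p_\<psi>: "w \<in> W \<Longrightarrow> p (\<psi> w) = y"
  using openin_imp_subset[OF openin_\<psi>] by blast

lemma Ck_\<psi>: "Ck_nat_on k (Suc 0) (snd c \<circ> \<psi>) (W \<inter> \<psi> -` fst c)"
  by (rule lp[unfolded local_param_def, THEN conjunct2, THEN conjunct2, THEN conjunct2, THEN bspec, OF c, THEN conjunct1, THEN spec])

definition "W1 = W \<inter> \<psi> -` U"

lemma W1: "w \<in> W1 \<Longrightarrow> w \<in> W" "w \<in> W1 \<Longrightarrow> \<psi> w \<in> U" "w \<in> W1 \<Longrightarrow> \<psi> w \<in> fst c"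
  using U(2) by (auto simp: W1_def)

lemma openin_W1: "openin (Euclidean_space k) W1"
  unfolding W1_def by (rule openin_Euclidean_vimage[OF openin_W homeomorphism_cont1[OF hom_\<psi>] U(1)])

lemma openin_Wc: "openin (Euclidean_space k) (W \<inter> \<psi> -` fst c)"
  by (rule openin_Euclidean_vimage[OF openin_W homeomorphism_cont1[OF hom_\<psi>] is_chart_open(1)[OF cc]])

lemma W1_zero: "w \<in> W1 \<Longrightarrow> i \<ge> k \<Longrightarrow> w i = 0"
  using openin_W1 unfolding openin_Euclidean_space_iff by auto

text \<open>The product of \<real>^n with \<open>W1\<close>, seen as an open subset of
  \<real>^m.\<close>

definition Z :: "(real, 'm) vec set" where "Z = {z. fib CARD('n) z \<in> W1}"

lemma open_Z: "open Z"
  unfolding Z_def by (rule open_fib_vimage) (use openin_W1 k in simp)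

definition q :: "(real, 'm) vec \<Rightarrow> (real, 'm) vec" where "q z = snd c (\<psi> (fib CARD('n) z))"

definition Dq :: "(real, 'm) vec \<Rightarrow> (real, 'm) vec \<Rightarrow> (real, 'm) vec" where
  "Dq z v = (\<Sum>j\<in>UNIV. v $ j *\<^sub>R (if pos j < CARD('n) then 0 else partial_deriv (pos j - CARD('n)) (snd c \<circ> \<psi>) (fib CARD('n) z)))"

text \<open>The transition from a parameter \<open>w\<close> to the fiber coordinates of
  \<open>\<psi> w\<close>, extended by the identity on base coordinates; the determinant of
  \<open>S'\<close> is thus the Jacobian determinant of the transition.\<close>

definition S :: "(real, 'm) vec \<Rightarrow> (real, 'm) vec" where
  "S z = join (base z :: (real, 'n) vec) (fib CARD('n) (\<Theta> (q z)))"

definition S' :: "(real, 'm) vec \<Rightarrow> (real, 'm) vec \<Rightarrow> (real, 'm) vec" where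
  "S' z v = join (base v :: (real, 'n) vec) (fib CARD('n) (D\<Theta> (q z) (Dq z v)))"

lemma has_derivative_q: assumes "z \<in> Z" shows "(q has_derivative Dq z) (at z)"
proof -
  have "fib CARD('n) z \<in> W \<inter> \<psi> -` fst c" using assms W1 by (auto simp: Z_def)
  from has_derivative_fib[OF card_le k openin_Wc Ck_\<psi> this]
  show ?thesis by (simp add: q_def[abs_def] Dq_def[abs_def])
qed

lemma Dq_axis: "Dq z (axis j 1) = (if pos j < CARD('n) then 0 else partial_deriv (pos j - CARD('n)) (snd c \<circ> \<psi>) (fib CARD('n) z))"
proof -
  have "Dq z (axis j 1) = (\<Sum>i\<in>UNIV. if i = j then (if pos j < CARD('n) then 0 else partial_deriv (pos j - CARD('n)) (snd c \<circ> \<psi>) (fib CARD('n) z)) else 0)"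
    unfolding Dq_def by (intro sum.cong) (auto simp: axis_def)
  then show ?thesis by simp
qed

lemma q_in: "z \<in> Z \<Longrightarrow> q z \<in> snd c ` U"
  using W1 by (auto simp: Z_def q_def)

lemma \<Theta>q_in: "z \<in> Z \<Longrightarrow> \<Theta> (q z) \<in> \<Omega>"
  using W1 \<Theta>_in by (auto simp: Z_def q_def)

lemma pt_\<Theta>q: "z \<in> Z \<Longrightarrow> pt (\<Theta> (q z)) = \<psi> (fib CARD('n) z)"
  using W1 pt_\<Theta> by (auto simp: Z_def q_def)

lemma base_\<Theta>q: "z \<in> Z \<Longrightarrow> base (\<Theta> (q z)) = snd d y"
  using W1 base_\<Theta> p_\<psi> by (auto simp: Z_def q_def)

lemma has_derivative_\<Theta>q:
  assumes z: "z \<in> Z" shows "((\<lambda>z. \<Theta> (q z)) has_derivative (\<lambda>v. D\<Theta> (q z) (Dq z v))) (at z)"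
  using diff_chain_at[OF has_derivative_q[OF z] has_derivative_\<Theta>[OF q_in[OF z]]] by (simp add: o_def)

lemma bounded_linear_base: "bounded_linear (base :: (real,'m) vec \<Rightarrow> (real,'n) vec)"
  using linear_base linear_conv_bounded_linear by blast

text \<open>\<psi> stays in one fiber, so the base coordinates of \<open>\<Theta> (q z)\<close> do
  not change. In fiber directions \<open>S'\<close> is therefore the full derivative of
  \<open>\<Theta>\<close> along \<open>q\<close>.\<close>

lemma base_D\<Theta>q:
  assumes z: "z \<in> Z" shows "base (D\<Theta> (q z) (Dq z v)) = (0 :: (real,'n) vec)"
proof -
  have "((\<lambda>z. base (\<Theta> (q z)) :: (real,'n) vec) has_derivative (\<lambda>v. base (D\<Theta> (q z) (Dq z v)))) (at z)"
    by (rule bounded_linear.has_derivative[OF bounded_linear_base has_derivative_\<Theta>q[OF z]])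
  moreover have "((\<lambda>z. base (\<Theta> (q z)) :: (real,'n) vec) has_derivative (\<lambda>v. 0)) (at z)"
    by (rule has_derivative_transform_within_open[OF has_derivative_const open_Z z]) (simp add: base_\<Theta>q)
  ultimately have "(\<lambda>v. base (D\<Theta> (q z) (Dq z v)) :: (real,'n) vec) = (\<lambda>v. 0)" by (rule has_derivative_unique)
  then show ?thesis by (rule fun_cong)
qed

lemma linear_join_base: "linear (\<lambda>a :: (real,'m) vec. join (base a :: (real,'n) vec) (\<lambda>_. 0) :: (real,'m) vec)"
  by (rule linearI) (auto simp: join_def base_def vec_eq_iff)

lemma has_derivative_S: assumes z: "z \<in> Z" shows "(S has_derivative S' z) (at z)"
proof -
  have b: "bounded_linear (\<lambda>a :: (real,'m) vec. join (base a :: (real,'n) vec) (\<lambda>_. 0) :: (real,'m) vec)"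
    "bounded_linear (\<lambda>b :: (real,'m) vec. join (0 :: (real,'n) vec) (fib CARD('n) b) :: (real,'m) vec)"
    using linear_join_base linear_join_0_fib linear_conv_bounded_linear by blast+
  have split: "join (base a :: (real,'n) vec) (fib CARD('n) b) =
      join (base a :: (real,'n) vec) (\<lambda>_. 0) + (join (0 :: (real,'n) vec) (fib CARD('n) b) :: (real,'m) vec)"
    for a b :: "(real,'m) vec" by (rule join_add)
  show ?thesis
    unfolding S_def[abs_def] S'_def[abs_def] split
    by (intro has_derivative_add bounded_linear.has_derivative[OF b(1)] bounded_linear.has_derivative[OF b(2)]
        has_derivative_\<Theta>q[OF z] has_derivative_ident)
qed

lemma linear_S': "z \<in> Z \<Longrightarrow> linear (S' z)"
  using has_derivative_S has_derivative_linear by blast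

text \<open>\<open>quotient_eval\<close> is applied to the images \<open>vv\<close> of the standard
  basis under \<open>S'\<close> followed by \<open>D\<Psi>\<close>. The differential of p maps the
  first n of them to the standard basis of \<real>^n and the others to 0, and these others are the
  partial derivatives of \<psi>.\<close>

lemma coeff_eq:
  assumes z: "z \<in> Z"
  shows "\<bar>param_coeff M \<xi> \<psi> (fib CARD('n) z)\<bar> = G (\<Theta> (q z)) * \<bar>det (matrix (S' z))\<bar>"
proof -
  let ?w = "fib CARD('n) z" and ?\<zeta> = "\<Theta> (q z)"
  have w: "?w \<in> W" "\<psi> ?w \<in> U" "\<psi> ?w \<in> fst c" using z W1 by (auto simp: Z_def)
  have pd: "p (\<psi> ?w) \<in> fst d" using w U(3) by blast
  have \<zeta>: "?\<zeta> \<in> \<Omega>" by (rule \<Theta>q_in[OF z])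
  define vv where "vv i = D\<Psi> ?\<zeta> (S' z (axis (coord i) 1))" for i
  have "vdet vv = det (matrix (D\<Psi> ?\<zeta>)) * vdet (\<lambda>i. S' z (axis (coord i) 1))"
    unfolding vv_def by (rule vdet_linear[OF linear_D\<Psi>[OF \<zeta>]])
  also have "vdet (\<lambda>i. S' z (axis (coord i) 1)) = det (matrix (S' z))"
    using vdet_linear[OF linear_S'[OF z], of "\<lambda>i. axis (coord i) 1"] by simp
  finally have vv: "vdet vv = det (matrix (D\<Psi> ?\<zeta>)) * det (matrix (S' z))" .
  have Dvv: "differential c d p (\<psi> ?w) (vv i) = base (axis (coord i) 1 :: (real,'m) vec)" for i
  proof -
    have "differential c d p (pt ?\<zeta>) (vv i) = base (S' z (axis (coord i) 1))"
      unfolding vv_def by (rule dp_D\<Psi>[OF \<zeta>])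
    then show ?thesis by (simp add: pt_\<Theta>q[OF z] S'_def base_join[OF card_le])
  qed
  have "sqrt (det (metric M c (\<psi> ?w))) * vdet vv =
      sqrt (det (metric N d (p (\<psi> ?w)))) * vdet (\<lambda>i. differential c d p (\<psi> ?w) (vv i)) * \<xi> c (\<psi> ?w) (\<lambda>i. vv (CARD('n) + i))"
  proof (rule quotient_eval[OF \<xi> c d w(3) pd])
    fix i assume "CARD('n) \<le> i" "i < CARD('m)"
    then show "differential c d p (\<psi> ?w) (vv i) = 0" unfolding Dvv by (rule base_axis_0)
  qed
  also have "vdet (\<lambda>i. differential c d p (\<psi> ?w) (vv i)) = vdet (\<lambda>i. axis (coord i) 1 :: (real,'n) vec)"
    by (intro alternating_cong[OF alternating_vdet]) (simp add: Dvv base_axis[OF card_le])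
  also have "\<xi> c (\<psi> ?w) (\<lambda>i. vv (CARD('n) + i)) = \<xi> c (\<psi> ?w) (\<lambda>i. partial_deriv i (snd c \<circ> \<psi>) ?w)"
  proof (rule alternating_cong[OF quotient_alternating[OF \<xi> c w(3)]])
    fix i assume i: "i < k"
    then have ni: "CARD('n) + i < CARD('m)" using k card_le by linarith
    let ?a = "axis (coord (CARD('n) + i)) 1 :: (real,'m) vec"
    let ?b = "D\<Theta> (q z) (Dq z ?a)"
    \<comment> \<open>Both base parts are 0, so joining the base part of \<open>?a\<close> with the
      fiber part of \<open>?b\<close> gives back \<open>?b\<close>.\<close>
    have "base ?a = (base ?b :: (real,'n) vec)" unfolding base_D\<Theta>q[OF z] using ni by (intro base_axis_0) auto
    then have "S' z ?a = ?b" by (simp add: S'_def)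
    then have "vv (CARD('n) + i) = Dq z ?a" unfolding vv_def using D\<Psi>_D\<Theta>[OF q_in[OF z]] by simp
    then show "vv (CARD('n) + i) = partial_deriv i (snd c \<circ> \<psi>) ?w" using ni by (simp add: Dq_axis)
  qed
  also have "\<dots> = param_coeff M \<xi> \<psi> ?w" by (rule param_coeff_chart[OF \<xi> lp w(1) c w(3), symmetric])
  finally have "sqrt (det (metric M c (\<psi> ?w))) * (det (matrix (D\<Psi> ?\<zeta>)) * det (matrix (S' z)))
    = sqrt (det (metric N d (p (\<psi> ?w)))) * param_coeff M \<xi> \<psi> ?w" by (simp add: vv)
  then have "param_coeff M \<xi> \<psi> ?w = sqrt (det (metric M c (\<psi> ?w))) * det (matrix (D\<Psi> ?\<zeta>)) * det (matrix (S' z))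
      / sqrt (det (metric N d (p (\<psi> ?w))))"
    using sqrt_N_pos[OF d pd] by (simp add: field_simps)
  then show ?thesis
    using sqrt_N_pos[OF d pd] M.metric_pos[OF c w(3)] by (simp add: G_def pt_\<Theta>q[OF z] abs_mult)
qed

lemma continuous_on_q: "continuous_on Z q"
  using has_derivative_q has_derivative_continuous by (metis continuous_at_imp_continuous_on)

lemma continuous_on_S: "continuous_on Z S"
  using has_derivative_S has_derivative_continuous by (metis continuous_at_imp_continuous_on)

lemma continuous_on_det_S': "continuous_on Z (\<lambda>z. det (matrix (S' z)))"
proof -
  have Dq: "continuous_on Z (\<lambda>z. Dq z (axis j 1))" for j
  proof (cases "pos j < CARD('n)")
    case False
    then have "pos j - CARD('n) < k" using k pos_less[of j] card_le by linarith
    then have "continuous_on (W \<inter> \<psi> -` fst c) (partial_deriv (pos j - CARD('n)) (snd c \<circ> \<psi>))" using Ck_\<psi> by simp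
    then have "continuous_on Z (\<lambda>z. partial_deriv (pos j - CARD('n)) (snd c \<circ> \<psi>) (fib CARD('n) z))"
      by (rule continuous_on_compose2[OF _ continuous_on_fib]) (use W1 in \<open>auto simp: Z_def\<close>)
    then show ?thesis using False by (simp add: Dq_axis)
  qed (simp add: Dq_axis)
  have "continuous_on Z (\<lambda>z. D\<Theta> (q z) (Dq z (axis j 1)))" for j
  proof -
    have "continuous_on Z (\<lambda>z. D\<Theta> (q z) b)" for b
    proof (rule continuous_on_compose2[OF _ continuous_on_q])
      show "continuous_on (snd c ` U) (\<lambda>a. D\<Theta> a b)"
        using smooth_onD[OF smooth_\<Theta>, of "Suc 0"] by simp
    qed (use q_in in auto)
    \<comment> \<open>The direction moves with \<open>z\<close>; expanding it in
      \<open>Basis\<close> leaves derivatives in fixed directions, whose continuity is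
      known.\<close>
    then have "continuous_on Z (\<lambda>z. \<Sum>b\<in>Basis. (Dq z (axis j 1) \<bullet> b) *\<^sub>R D\<Theta> (q z) b)"
      by (intro continuous_intros Dq)
    then show ?thesis
    proof (rule continuous_on_cong[THEN iffD1, rotated -1])
      fix z assume z: "z \<in> Z"
      let ?v = "Dq z (axis j 1)"
      have "D\<Theta> (q z) ?v = D\<Theta> (q z) (\<Sum>b\<in>Basis. (?v \<bullet> b) *\<^sub>R b)" by (simp add: euclidean_representation)
      also have "\<dots> = (\<Sum>b\<in>Basis. (?v \<bullet> b) *\<^sub>R D\<Theta> (q z) b)"
        by (simp add: linear_sum[OF linear_D\<Theta>[OF q_in[OF z]]] linear_cmul[OF linear_D\<Theta>[OF q_in[OF z]]])
      finally show "(\<Sum>b\<in>Basis. (?v \<bullet> b) *\<^sub>R D\<Theta> (q z) b) = D\<Theta> (q z) ?v" by simp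
    qed simp
  qed
  then have "continuous_on Z (\<lambda>z. S' z (axis j 1))" for j
    unfolding S'_def
    by (intro continuous_on_join continuous_on_const continuous_on_compose2[OF continuous_on_fib[of UNIV]]) auto
  then have "continuous_on Z (\<lambda>z. S' z (axis j 1) $ i)" for i j by (intro continuous_on_component)
  then have ent: "Ck_on 0 (\<lambda>z. matrix (S' z) $ i $ j) Z" for i j by (simp add: matrix_def)
  show ?thesis by (rule Ck_on_continuous[of 0], rule Ck_on_det[OF open_Z ent])
qed

text \<open>\<xi> may be discontinuous, but \<open>coeff_eq\<close> expresses the absolute value of
  its coefficient through G and the determinant of \<open>S'\<close>, which are continuous. Setting
  the base coordinates to 0 leads back from \<open>Z\<close> to \<open>W1\<close>.\<close>

lemma continuous_on_coeff: "continuous_on W1 (\<lambda>w. \<bar>param_coeff M \<xi> \<psi> w\<bar>)"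
proof -
  let ?j = "\<lambda>w. join (0 :: (real,'n) vec) w :: (real,'m) vec"
  have f: "fib CARD('n) (?j w) = w" if "w \<in> W1" for w
    using W1_zero[OF that] k by (intro fib_join card_le) simp
  have jZ: "?j w \<in> Z" if "w \<in> W1" for w using f[OF that] that by (simp add: Z_def)
  have cj: "continuous_on W1 ?j" by (intro continuous_on_join continuous_on_const continuous_on_id)
  have c\<Theta>: "continuous_on Z (\<lambda>z. \<Theta> (q z))"
    by (rule continuous_on_compose2[OF homeomorphism_cont1[OF hom] continuous_on_q]) (use q_in in auto)
  have "continuous_on Z (\<lambda>z. G (\<Theta> (q z)))"
    by (rule continuous_on_compose2[OF continuous_on_G c\<Theta>]) (use \<Theta>q_in in auto)
  then have "continuous_on Z (\<lambda>z. G (\<Theta> (q z)) * \<bar>det (matrix (S' z))\<bar>)"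
    by (intro continuous_intros continuous_on_det_S')
  then have "continuous_on W1 (\<lambda>w. G (\<Theta> (q (?j w))) * \<bar>det (matrix (S' (?j w)))\<bar>)"
    by (rule continuous_on_compose2[OF _ cj]) (use jZ in auto)
  then show ?thesis
    by (rule continuous_on_cong[THEN iffD1, rotated -1]) (use coeff_eq[OF jZ] f in auto)
qed

text \<open>
  The transition between two parametrisations of the fiber lives in \<open>k\<close> dimensions, for which there is no index
  type. So the unit cube of the base coordinates is added as a factor, and the change of variables is carried out
  for the map \<open>S\<close> in \<open>m\<close> dimensions.
\<close>

lemma nn_integral_param:
  assumes A: "A \<in> sets borel" "A \<subseteq> U" and H: "H \<in> borel_measurable borel" and \<psi>W: "\<psi> ` W \<in> sets borel"
  shows "(\<integral>\<^sup>+w. indicator {w \<in> W. \<psi> w \<in> A} w * (H (\<psi> w) * ennreal \<bar>param_coeff M \<xi> \<psi> w\<bar>) \<partial>lborel_nat k)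
    = K (\<lambda>x. H x * indicator (A \<inter> \<psi> ` W) x) y" (is "?L = ?R")
proof (cases "W1 = {}")
  \<comment> \<open>\<psi> misses U, and \<open>y\<close> need not lie in \<open>fst d\<close>; both
    sides are 0.\<close>
  case True
  then have "{w \<in> W. \<psi> w \<in> A} = {}" "A \<inter> \<psi> ` W = {}" using A by (auto simp: W1_def)
  then show ?thesis by (simp add: K_def)
next
  case False
  then have yd: "y \<in> fst d" using W1(1,2) p_\<psi> U(3) by (metis ex_in_conv image_subset_iff)
  obtain V where V: "open V" "\<psi> ` W = p -` {y} \<inter> V" using openin_\<psi> by (auto simp: openin_open)
  let ?yd = "snd d y" and ?Q = "cbox 0 1 :: (real,'n) vec set"
  \<comment> \<open>Replacing the base coordinates by those of \<open>y\<close> moves a point of the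
    chart into the fiber over \<open>y\<close>.\<close>
  let ?J = "\<lambda>z :: (real,'m) vec. join ?yd (fib CARD('n) z) :: (real,'m) vec"
  have pJ: "p (pt (?J z)) = y" if "?J z \<in> \<Omega>" for z
    using p_pt(1)[OF that] yd dd by (simp add: base_join[OF card_le])
  have cJ: "continuous_on X ?J" for X
    by (intro continuous_on_join continuous_on_const continuous_on_fib)
  \<comment> \<open>This will be the image of \<open>Z\<close> under \<open>S\<close>: the points
    whose fiber part, placed above \<open>y\<close>, lies in \<Omega> and represents a point in the
    image of \<psi>.\<close>
  define Z2 where "Z2 = (?J -` \<Omega>) \<inter> (pt \<circ> ?J) -` V"
  have Z2: "open Z2"
  proof -
    have o: "open (?J -` \<Omega>)" by (rule open_vimage[OF \<Omega> cJ])
    have "continuous_on (?J -` \<Omega>) (pt \<circ> ?J)"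
      by (intro continuous_on_compose cJ continuous_on_subset[OF continuous_on_pt]) auto
    from continuous_open_preimage[OF this o V(1)] show ?thesis by (simp add: Z2_def)
  qed
  \<comment> \<open>The inverse of \<open>S\<close>: a point of the fiber is read back as a
    parameter by \<open>\<phi>\<close>.\<close>
  define R where "R z = (join (base z :: (real,'n) vec) (\<phi> (pt (?J z))) :: (real,'m) vec)" for z :: "(real,'m) vec"
  have R: "R z \<in> Z \<and> S (R z) = z \<and> \<psi> (fib CARD('n) (R z)) = pt (?J z) \<and> base (R z) = (base z :: (real,'n) vec)" if z: "z \<in> Z2" for z
  proof -
    have J: "?J z \<in> \<Omega>" "pt (?J z) \<in> V" using z by (auto simp: Z2_def)
    have "pt (?J z) \<in> \<psi> ` W" using J pJ[OF J(1)] V(2) by auto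
    then have w: "\<phi> (pt (?J z)) \<in> W" "\<psi> (\<phi> (pt (?J z))) = pt (?J z)"
      using homeomorphism_image2[OF hom_\<psi>] homeomorphism_apply2[OF hom_\<psi>] by blast+
    have w1: "\<phi> (pt (?J z)) \<in> W1" using w pt_in[OF J(1)] by (simp add: W1_def)
    have f: "fib CARD('n) (R z) = \<phi> (pt (?J z))"
      unfolding R_def using W1_zero[OF w1] k by (intro fib_join card_le) simp
    have b: "base (R z) = (base z :: (real,'n) vec)" unfolding R_def by (rule base_join[OF card_le])
    have "\<Theta> (q (R z)) = ?J z" unfolding q_def f w(2) by (rule \<Theta>_pt[OF J(1)])
    moreover have "fib CARD('n) (?J z) = fib CARD('n) z" by (rule fib_join[OF card_le]) simp
    ultimately have "S (R z) = z" unfolding S_def b by simp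
    then show ?thesis using w1 f b w(2) by (simp add: Z_def)
  qed
  have JS: "?J (S z) = \<Theta> (q z)" if z: "z \<in> Z" for z
  proof -
    have "fib CARD('n) (S z) = fib CARD('n) (\<Theta> (q z))" unfolding S_def by (rule fib_join[OF card_le]) simp
    then have "?J (S z) = join (base (\<Theta> (q z)) :: (real,'n) vec) (fib CARD('n) (\<Theta> (q z)))" by (simp add: base_\<Theta>q[OF z])
    then show ?thesis by simp
  qed
  have bS: "base (S z) = (base z :: (real,'n) vec)" for z unfolding S_def by (rule base_join[OF card_le])
  have SZ2: "S z \<in> Z2" and RS: "R (S z) = z" if z: "z \<in> Z" for z
  proof -
    have w: "fib CARD('n) z \<in> W" using z W1 by (auto simp: Z_def)
    then have "\<psi> (fib CARD('n) z) \<in> V" using V(2) by blast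
    then show "S z \<in> Z2" using \<Theta>q_in[OF z] by (simp add: Z2_def JS[OF z] pt_\<Theta>q[OF z])
    have "\<phi> (\<psi> (fib CARD('n) z)) = fib CARD('n) z" using w homeomorphism_apply1[OF hom_\<psi>] by blast
    then show "R (S z) = z" unfolding R_def JS[OF z] pt_\<Theta>q[OF z] bS by simp
  qed
  have contR: "continuous_on Z2 R"
    unfolding R_def
  proof (intro continuous_on_join continuous_on_base)
    have 1: "continuous_on Z2 (\<lambda>z. pt (?J z))"
      by (rule continuous_on_compose2[OF continuous_on_pt cJ]) (auto simp: Z2_def)
    show "continuous_on Z2 (\<lambda>z. \<phi> (pt (?J z)))"
    proof (rule continuous_on_compose2[OF homeomorphism_cont2[OF hom_\<psi>] 1])
      show "(\<lambda>z. pt (?J z)) ` Z2 \<subseteq> \<psi> ` W" using pJ V(2) by (auto simp: Z2_def)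
    qed
  qed
  have imS: "S ` B = Z2 \<inter> R -` B" if B: "B \<subseteq> Z" for B
  proof (intro set_eqI iffI)
    fix z assume "z \<in> S ` B"
    then obtain b where "b \<in> B" "z = S b" by blast
    then show "z \<in> Z2 \<inter> R -` B" using SZ2[of b] RS[of b] B by auto
  next
    fix z assume z: "z \<in> Z2 \<inter> R -` B"
    then show "z \<in> S ` B" using R[of z] by (intro image_eqI[of _ _ "R z"]) auto
  qed
  \<comment> \<open>The unit cube of base coordinates times the parameters of the points in
    \<open>A\<close>.\<close>
  define ZA where "ZA = {z \<in> Z. base z \<in> ?Q \<and> \<psi> (fib CARD('n) z) \<in> A}"
  have ZA: "ZA \<in> sets borel"
  proof -
    have "continuous_on Z (\<lambda>z. \<psi> (fib CARD('n) z))"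
      by (rule continuous_on_compose2[OF homeomorphism_cont1[OF hom_\<psi>] continuous_on_fib]) (use W1 in \<open>auto simp: Z_def\<close>)
    note 1 = borel_preimage_open[OF open_Z this A(1)]
    have "?Q \<in> sets borel" by simp
    note 2 = borel_preimage_open[OF open_Z continuous_on_base this]
    from 1 2 have "(Z \<inter> (\<lambda>z. \<psi> (fib CARD('n) z)) -` A) \<inter> (Z \<inter> base -` ?Q) \<in> sets borel" by (rule sets.Int)
    also have "(Z \<inter> (\<lambda>z. \<psi> (fib CARD('n) z)) -` A) \<inter> (Z \<inter> base -` ?Q) = ZA" by (auto simp: ZA_def)
    finally show ?thesis .
  qed
  have ZAZ: "ZA \<subseteq> Z" by (auto simp: ZA_def)
  define f1 where "f1 z = H (pt0 (?J z)) * gdens (?J z)" for z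
  have f1: "f1 \<in> borel_measurable borel"
    unfolding f1_def using measurable_compose[OF borel_measurable_continuous_onI[OF cJ] measurable_K_integrand[OF H]] .
  define f0 where "f0 z = indicator ZA z * (f1 (S z) * ennreal \<bar>det (matrix (S' z))\<bar>)" for z
  have mdet: "(\<lambda>z. det (matrix (S' z)) * indicator ZA z) \<in> borel_measurable borel"
    using borel_measurable_continuous_on_indicator[OF ZA continuous_on_subset[OF continuous_on_det_S' ZAZ]]
    by (simp add: mult.commute)
  have f0: "f0 \<in> borel_measurable borel"
  proof -
    have "(\<lambda>z. if z \<in> ZA then S z else 0) \<in> borel_measurable borel"
      by (intro borel_measurable_continuous_on_if ZA continuous_on_subset[OF continuous_on_S ZAZ] continuous_on_const)
    from measurable_compose[OF this f1]
    have "(\<lambda>z. indicator ZA z * (f1 (if z \<in> ZA then S z else 0) * ennreal \<bar>det (matrix (S' z)) * indicator ZA z\<bar>)) \<in> borel_measurable borel"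
      using mdet ZA by measurable
    also have "(\<lambda>z. indicator ZA z * (f1 (if z \<in> ZA then S z else 0) * ennreal \<bar>det (matrix (S' z)) * indicator ZA z\<bar>)) = f0"
      by (auto simp: f0_def indicator_def)
    finally show ?thesis .
  qed
  \<comment> \<open>Here and in \<open>SA_join\<close> the integrand splits into the indicator of
    the cube and a function of \<open>w\<close>. This is claimed for sequences vanishing from
    \<open>k\<close> on, which is enough almost everywhere.\<close>
  have f0_join: "f0 (join u w) = indicator ?Q u * (indicator {w \<in> W. \<psi> w \<in> A} w * (H (\<psi> w) * ennreal \<bar>param_coeff M \<xi> \<psi> w\<bar>))"
    if w0: "\<forall>i\<ge>k. w i = 0" for u :: "(real,'n) vec" and w
  proof -
    let ?z = "join u w :: (real,'m) vec"
    have f: "fib CARD('n) ?z = w" using w0 k by (intro fib_join card_le) simp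
    have b: "base ?z = u" by (rule base_join[OF card_le])
    have mem: "?z \<in> ZA \<longleftrightarrow> u \<in> ?Q \<and> w \<in> W \<and> \<psi> w \<in> A"
      using A(2) by (auto simp: ZA_def Z_def f b W1_def)
    show ?thesis
    proof (cases "?z \<in> ZA")
      case True
      then have z: "?z \<in> Z" using ZAZ by blast
      have "f1 (S ?z) = H (\<psi> w) * ennreal (G (\<Theta> (q ?z)))"
        using \<Theta>q_in[OF z] by (simp add: f1_def JS[OF z] pt0_def gdens_def pt_\<Theta>q[OF z] f)
      then have "f1 (S ?z) * ennreal \<bar>det (matrix (S' ?z))\<bar> = H (\<psi> w) * ennreal \<bar>param_coeff M \<xi> \<psi> w\<bar>"
        using coeff_eq[OF z] G_nonneg[OF \<Theta>q_in[OF z]] by (simp add: f ennreal_mult mult.assoc)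
      then show ?thesis using True mem by (simp add: f0_def)
    next
      case False
      then show ?thesis using mem by (auto simp: f0_def indicator_def)
    qed
  qed
  have SA_join: "f1 (join u w) * indicator (S ` ZA) (join u w) = indicator ?Q u * (H (pt0 (join ?yd w)) * indicator (A \<inter> \<psi> ` W) (pt0 (join ?yd w)) * gdens (join ?yd w))"
    if w0: "\<forall>i\<ge>k. w i = 0" for u :: "(real,'n) vec" and w
  proof -
    let ?z = "join u w :: (real,'m) vec"
    have f: "fib CARD('n) ?z = w" using w0 k by (intro fib_join card_le) simp
    have b: "base ?z = u" by (rule base_join[OF card_le])
    show ?thesis
    proof (cases "join ?yd w \<in> \<Omega>")
      case True
      have "?z \<in> S ` ZA \<longleftrightarrow> ?z \<in> Z2 \<and> R ?z \<in> ZA" using imS[OF ZAZ] by blast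
      also have "\<dots> \<longleftrightarrow> ?z \<in> Z2 \<and> u \<in> ?Q \<and> pt (join ?yd w) \<in> A"
        using R[of ?z] by (auto simp: ZA_def b f)
      also have "\<dots> \<longleftrightarrow> u \<in> ?Q \<and> pt (join ?yd w) \<in> A \<inter> \<psi> ` W"
        using True pJ[of ?z] V(2) by (auto simp: Z2_def f)
      finally show ?thesis using True by (simp add: f1_def f pt0_def indicator_def)
    next
      case False
      then show ?thesis by (simp add: f1_def f gdens_def)
    qed
  qed
  have Q1: "emeasure lborel ?Q = 1"
  proof -
    have b: "(1 :: (real,'n) vec) \<bullet> b = 1" if "b \<in> Basis" for b
      using that by (auto simp: Basis_vec_def inner_axis)
    then have "emeasure lborel ?Q = ennreal (\<Prod>b\<in>Basis. ((1 :: (real,'n) vec) - 0) \<bullet> b)"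
      by (intro emeasure_lborel_cbox) simp
    then show ?thesis using b by simp
  qed
  have ind: "(\<integral>\<^sup>+u. indicator ?Q u * X \<partial>lborel) = X" for X
    using Q1 by (simp add: nn_integral_multc)
  have "?L = (\<integral>\<^sup>+u. indicator ?Q u * ?L \<partial>lborel)" by (rule ind[symmetric])
  also have "\<dots> = (\<integral>\<^sup>+(u :: (real,'n) vec). \<integral>\<^sup>+w. f0 (join u w) \<partial>lborel_nat k \<partial>lborel)"
  proof (intro nn_integral_cong)
    fix u :: "(real,'n) vec"
    have "(\<integral>\<^sup>+w. f0 (join u w) \<partial>lborel_nat k) = (\<integral>\<^sup>+w. indicator ?Q u * (indicator {w \<in> W. \<psi> w \<in> A} w * (H (\<psi> w) * ennreal \<bar>param_coeff M \<xi> \<psi> w\<bar>)) \<partial>lborel_nat k)"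
      by (rule nn_integral_cong_AE, rule eventually_mono[OF AE_lborel_nat], rule f0_join)
    then show "indicator ?Q u * ?L = (\<integral>\<^sup>+w. f0 (join u w) \<partial>lborel_nat k)"
      by (cases "u \<in> ?Q") simp_all
  qed
  also have "\<dots> = (\<integral>\<^sup>+z. f0 z \<partial>lborel)" by (rule nn_integral_join[OF card_le k f0, symmetric])
  also have "\<dots> = (\<integral>\<^sup>+z\<in>ZA. f1 (S z) * ennreal \<bar>det (matrix (S' z))\<bar> \<partial>lborel)"
    by (simp add: f0_def mult.commute)
  also have "\<dots> = (\<integral>\<^sup>+z\<in>S ` ZA. f1 z \<partial>lborel)"
  proof (rule nn_integral_change_of_variables[symmetric, OF ZA _ _ _ mdet f1])
    show "S ` B \<in> sets borel" if "B \<in> sets borel" "B \<subseteq> ZA" for B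
      using imS[of B] that ZAZ borel_preimage_open[OF Z2 contR that(1)] by auto
    show "(S has_derivative S' z) (at z within ZA)" if "z \<in> ZA" for z
      using has_derivative_S[of z] that ZAZ has_derivative_at_withinI by blast
    show "inj_on S ZA" by (rule inj_on_inverseI[of _ R]) (use RS ZAZ in auto)
  qed
  also have "\<dots> = (\<integral>\<^sup>+(u :: (real,'n) vec). \<integral>\<^sup>+w. f1 (join u w) * indicator (S ` ZA) (join u w) \<partial>lborel_nat k \<partial>lborel)"
  proof (rule nn_integral_join[OF card_le k])
    have "S ` ZA \<in> sets borel" using imS[OF ZAZ] borel_preimage_open[OF Z2 contR ZA] by simp
    then show "(\<lambda>z. f1 z * indicator (S ` ZA) z) \<in> borel_measurable borel" using f1 by simp
  qed
  also have "\<dots> = (\<integral>\<^sup>+u. indicator ?Q u * ?R \<partial>lborel)"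
  proof (intro nn_integral_cong)
    fix u :: "(real,'n) vec"
    have "(\<integral>\<^sup>+w. f1 (join u w) * indicator (S ` ZA) (join u w) \<partial>lborel_nat k) =
       (\<integral>\<^sup>+w. indicator ?Q u * (H (pt0 (join ?yd w)) * indicator (A \<inter> \<psi> ` W) (pt0 (join ?yd w)) * gdens (join ?yd w)) \<partial>lborel_nat k)"
      by (rule nn_integral_cong_AE, rule eventually_mono[OF AE_lborel_nat], rule SA_join)
    then show "(\<integral>\<^sup>+w. f1 (join u w) * indicator (S ` ZA) (join u w) \<partial>lborel_nat k) = indicator ?Q u * ?R"
      using yd by (cases "u \<in> ?Q") (simp_all add: K_def)
  qed
  also have "\<dots> = ?R" by (rule ind)
  finally show ?thesis .
qed

end

section \<open>Existence of straightened charts\<close>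

context subm
begin

text \<open>With \<open>B\<close> straightening the differential of p and \<open>L\<close> its
  inverse, \<open>f\<close> takes p for its base coordinates and the fiber part of \<open>L\<close>
  for the others. Its derivative at the point is \<open>L\<close>, hence invertible, and
  \<open>smooth_inverse_function\<close> applies.\<close>

lemma ex_straight:
  "\<exists>c d U \<Omega> \<Theta> \<Psi>. straight M N p k c d U \<Omega> \<Theta> \<Psi> \<and> x \<in> U \<and> emeasure M.vol U < \<infinity>"
proof -
  define c where "c = chart_at M x"
  define d where "d = chart_at N (p x)"
  have c: "c \<in> atlas M" "x \<in> fst c" and d: "d \<in> atlas N" "p x \<in> fst d"
    by (simp_all add: c_def d_def M.chart_at N.chart_at)
  note cc = M.chart[OF c(1)] and dd = N.chart[OF d(1)]
  obtain V where V: "open V" "x \<in> V" "V \<subseteq> fst c" "emeasure M.vol V < \<infinity>"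
    by (rule M.finite_nhd[OF c])
  let ?D = "differential c d p x" and ?a = "snd c x"
  have D: "linear ?D" "surj ?D" using linear_dp surj_dp c d by blast+
  obtain B where B: "linear B" "bij B" "\<And>z :: (real,'m) vec. ?D (B z) = base z"
    by (rule straighten_linear[OF D card_le]) (rule that)
  define L where "L = inv B"
  have L: "linear L" unfolding L_def by (rule inj_linear_imp_inv_linear[OF B(1) bij_is_inj[OF B(2)]])
  have BL: "B (L v) = v" for v unfolding L_def by (rule surj_f_inv_f[OF bij_is_surj[OF B(2)]])
  define f where "f a = (join (local_rep c d p a) (\<lambda>_. 0) + join (0 :: (real,'n) vec) (fib CARD('n) (L a)) :: (real,'m) vec)" for a
  define U0 where "U0 = snd c ` (V \<inter> p -` fst d)"
  have U0: "open U0"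
    unfolding U0_def using V by (intro open_chart_image[OF cc] open_Int open_vimage continuous_p is_chart_open(1)[OF dd]) auto
  have aU0: "?a \<in> U0" using V d by (auto simp: U0_def)
  have U0sub: "U0 \<subseteq> snd c ` (fst c \<inter> p -` fst d)" using V(3) by (auto simp: U0_def)
  have smp: "smooth_on (snd c ` (fst c \<inter> p -` fst d)) (local_rep c d p)"
    using smooth_p c d by (simp add: smooth_wrt_def)
  have bl1: "bounded_linear (\<lambda>u :: (real,'n) vec. join u (\<lambda>_. 0) :: (real,'m) vec)"
    using linear_join_0 linear_conv_bounded_linear by blast
  have bl2: "bounded_linear (\<lambda>a. join (0 :: (real,'n) vec) (fib CARD('n) (L a)) :: (real,'m) vec)"
    using linear_compose[OF L linear_join_0_fib[where 'n='n]] linear_conv_bounded_linear by (auto simp: o_def)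
  have "Ck_on r f U0" for r
    unfolding f_def[abs_def]
    by (intro Ck_on_add[OF U0] Ck_on_linear_comp[OF bl1 U0] Ck_on_subset[OF smooth_onD[OF smp] U0sub] Ck_on_linear[OF bl2 U0])
  then have smf: "smooth_on U0 f" by (simp add: smooth_on_def)
  have "(local_rep c d p has_derivative ?D) (at ?a)"
    by (rule has_derivative_differential[OF smooth_p c(1) d(1) c(2) d(2)])
  then have "(f has_derivative (\<lambda>v. join (?D v) (\<lambda>_. 0) + join (0 :: (real,'n) vec) (fib CARD('n) (L v)))) (at ?a)"
    unfolding f_def[abs_def]
    by (intro has_derivative_add bounded_linear.has_derivative[OF bl1] bounded_linear_imp_has_derivative[OF bl2])
  \<comment> \<open>The differential of p is \<open>base\<close> composed with \<open>L\<close>, so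
    the two parts reassemble to \<open>L v\<close>.\<close>
  moreover have "join (?D v) (\<lambda>_. 0) + join (0 :: (real,'n) vec) (fib CARD('n) (L v)) = L v" for v
  proof -
    have "?D v = base (L v)" using B(3)[of "L v"] by (simp add: BL)
    then show ?thesis by (simp add: join_add[symmetric])
  qed
  ultimately have "(f has_derivative L) (at ?a)" by simp
  then have "frechet_derivative f (at ?a) = L" by (rule frechet_derivative_at[symmetric])
  then have bij: "bij (frechet_derivative f (at ?a))" using B(2) by (simp add: L_def bij_imp_bij_inv)
  obtain U' \<Omega> \<Psi> where U': "open U'" "U' \<subseteq> U0" "?a \<in> U'" and \<Omega>: "open \<Omega>" and hom: "homeomorphism U' \<Omega> f \<Psi>"
    and sm\<Psi>: "smooth_on \<Omega> \<Psi>"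
    by (rule smooth_inverse_function[OF U0 smf aU0 bij]) (rule that)
  have U'c: "U' \<subseteq> snd c ` fst c" using U'(2) U0sub by blast
  define U where "U = chart_inv c ` U'"
  have cU: "snd c ` U = U'"
  proof -
    have "snd c (chart_inv c a) = a" if "a \<in> U'" for a using that U'c chart_chart_inv[OF cc] by blast
    then show ?thesis by (simp add: U_def image_image)
  qed
  have UV: "U \<subseteq> V \<inter> p -` fst d"
  proof
    fix z assume "z \<in> U"
    then obtain a where "a \<in> U'" "z = chart_inv c a" by (auto simp: U_def)
    then obtain z' where "z' \<in> V \<inter> p -` fst d" "a = snd c z'" using U'(2) by (auto simp: U0_def)
    then show "z \<in> V \<inter> p -` fst d" using \<open>z = chart_inv c a\<close> V(3) chart_inv_chart[OF cc, of z'] by auto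
  qed
  have "straight M N p k c d U \<Omega> f \<Psi>"
  proof (unfold_locales)
    show "c \<in> atlas M" "d \<in> atlas N" using c d by auto
    show "open U" unfolding U_def by (rule open_chart_inv_image[OF cc U'(1) U'c])
    show "U \<subseteq> fst c" "p ` U \<subseteq> fst d" using UV V(3) by auto
    show "open \<Omega>" by fact
    show "homeomorphism (snd c ` U) \<Omega> f \<Psi>" unfolding cU by fact
    show "smooth_on (snd c ` U) f"
      unfolding cU smooth_on_def using Ck_on_subset[OF smooth_onD[OF smf] U'(2)] by blast
    show "smooth_on \<Omega> \<Psi>" by fact
    fix z assume "z \<in> U"
    then have "z \<in> fst c" using UV V(3) by blast
    then show "base (f (snd c z)) = snd d (p z)"
      by (simp add: f_def join_add[symmetric] base_join[OF card_le] local_rep_apply[OF cc])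
  qed
  moreover have "x \<in> U" unfolding U_def using U'(3) chart_inv_chart[OF cc c(2)] by (metis imageI)
  moreover have "emeasure M.vol U < \<infinity>"
  proof -
    have "emeasure M.vol U \<le> emeasure M.vol V" using UV V(1) by (intro emeasure_mono) auto
    then show ?thesis using V(4) by (rule le_less_trans)
  qed
  ultimately show ?thesis by blast
qed

end

section \<open>Slices of a straightened chart as local parametrisations of fibers\<close>

context straight
begin

lemma inj_D\<Psi>: assumes z: "z \<in> \<Omega>" shows "inj (D\<Psi> z)"
proof -
  have a: "snd c (pt z) \<in> snd c ` U" using pt_in[OF z] by blast
  have "D\<Psi> z (D\<Theta> (snd c (pt z)) v) = v" for v
    using D\<Psi>_D\<Theta>[OF a, of v] by (simp only: \<Theta>_pt[OF z])
  then have "surj (D\<Psi> z)" by (rule surjI)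
  then show ?thesis using linear_surjective_imp_injective[OF linear_D\<Psi>[OF z]] by simp
qed

text \<open>With base coordinates fixed at those of \<open>y\<close>, \<Psi> parametrises the part
  of the fiber in U. \<open>local_param\<close> asks for independent partial derivatives in every
  chart \<open>e\<close>; they are the images of distinct coordinate vectors under the injective
  \<open>D\<Psi>\<close>, followed by an invertible transition differential.\<close>

lemma local_param_straight:
  assumes y: "y \<in> fst d"
  defines "W \<equiv> {w. (\<forall>i\<ge>k. w i = 0) \<and> join (snd d y) w \<in> \<Omega>}"
  shows "local_param M k (p -` {y}) W (\<lambda>w. pt (join (snd d y) w)) \<and> (\<lambda>w. pt (join (snd d y) w)) ` W = p -` {y} \<inter> U"
proof -
  let ?J = "\<lambda>w. join (snd d y) w :: (real,'m) vec"
  let ?\<psi> = "\<lambda>w. pt (?J w)" and ?\<phi> = "\<lambda>x. fib CARD('n) (\<Theta> (snd c x))"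
  have J: "?J w \<in> \<Omega>" "\<And>i. i \<ge> k \<Longrightarrow> w i = 0" if "w \<in> W" for w using that by (auto simp: W_def)
  have p\<psi>: "p (?\<psi> w) = y" if "w \<in> W" for w
    using p_pt(1)[OF J(1)[OF that]] chart_inv_chart[OF dd y] by (simp add: base_join[OF card_le])
  have \<phi>\<psi>: "?\<phi> (?\<psi> w) = w" if "w \<in> W" for w
    unfolding \<Theta>_pt[OF J(1)[OF that]] using J(2)[OF that] k by (intro fib_join card_le) simp
  have J\<phi>: "?J (?\<phi> x) = \<Theta> (snd c x)" if "x \<in> U" "p x = y" for x
    using base_\<Theta>[OF that(1)] join_base_fib[of "\<Theta> (snd c x)", where 'n='n] that(2) by simp
  have \<phi>W: "?\<phi> x \<in> W" if "x \<in> U" "p x = y" for x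
    using \<Theta>_in[OF that(1)] k by (simp add: W_def J\<phi>[OF that])
  have \<psi>\<phi>: "?\<psi> (?\<phi> x) = x" if "x \<in> U" "p x = y" for x
    unfolding J\<phi>[OF that] by (rule pt_\<Theta>[OF that(1)])
  have im: "?\<psi> ` W = p -` {y} \<inter> U"
  proof (intro set_eqI iffI)
    fix x assume "x \<in> ?\<psi> ` W"
    then show "x \<in> p -` {y} \<inter> U" using p\<psi> pt_in[OF J(1)] by auto
  next
    fix x assume "x \<in> p -` {y} \<inter> U"
    then show "x \<in> ?\<psi> ` W" using \<psi>\<phi>[of x] \<phi>W[of x] by (intro image_eqI[of _ _ "?\<phi> x"]) auto
  qed
  have cJ: "continuous_on X ?J" for X by (intro continuous_on_join continuous_on_const continuous_on_id)
  have W: "openin (Euclidean_space k) W" unfolding W_def by (rule openin_join_vimage[OF \<Omega>])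
  have c\<psi>: "continuous_on W ?\<psi>"
    by (rule continuous_on_compose2[OF continuous_on_pt cJ]) (use J in auto)
  have hom: "homeomorphism W (?\<psi> ` W) ?\<psi> ?\<phi>"
  proof (rule homeomorphismI)
    show "continuous_on W ?\<psi>" by (rule c\<psi>)
    have "continuous_on (?\<psi> ` W) (\<lambda>x. \<Theta> (snd c x))"
      by (rule continuous_on_compose2[OF homeomorphism_cont1[OF hom] continuous_on_subset[OF continuous_on_chart[OF cc]]])
        (use im U(2) in auto)
    then show "continuous_on (?\<psi> ` W) ?\<phi>"
      by (rule continuous_on_compose2[OF continuous_on_fib[of UNIV]]) simp
  qed (use \<phi>\<psi> \<psi>\<phi> in auto)
  have chart_part: "(\<forall>r. Ck_nat_on k r (snd e \<circ> ?\<psi>) (W \<inter> ?\<psi> -` fst e)) \<and>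
      (\<forall>w \<in> W \<inter> ?\<psi> -` fst e. \<forall>a::nat \<Rightarrow> real.
         (\<Sum>i<k. a i *\<^sub>R partial_deriv i (snd e \<circ> ?\<psi>) w) = 0 \<longrightarrow> (\<forall>i<k. a i = 0))" if e: "e \<in> atlas M" for e
  proof -
    note ee = M.chart[OF e]
    define f where "f z = local_rep c e id (\<Psi> z)" for z
    define \<Omega>e where "\<Omega>e = \<Omega> \<inter> pt -` fst e"
    have \<Omega>e: "open \<Omega>e" unfolding \<Omega>e_def by (rule continuous_open_preimage[OF continuous_on_pt \<Omega> is_chart_open(1)[OF ee]])
    have fe: "snd e \<circ> ?\<psi> = (\<lambda>w. f (?J w))" by (simp add: f_def local_rep_def pt_def o_def)
    have We: "W \<inter> ?\<psi> -` fst e = {w. (\<forall>i\<ge>k. w i = 0) \<and> ?J w \<in> \<Omega>e}" by (auto simp: W_def \<Omega>e_def)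
    let ?T = "snd c ` (fst c \<inter> id -` fst e)"
    have T: "open ?T" by (rule open_transition_domain[OF cc ee]) (simp add: id_def)
    have sub: "\<Psi> ` \<Omega>e \<subseteq> ?T"
    proof (rule image_subsetI)
      fix z assume z: "z \<in> \<Omega>e"
      then have z1: "z \<in> \<Omega>" "pt z \<in> fst e" by (auto simp: \<Omega>e_def)
      then have "pt z \<in> fst c \<inter> id -` fst e" using pt_in U(2) by auto
      then show "\<Psi> z \<in> ?T" unfolding chart_pt[OF z1(1), symmetric] by (rule imageI)
    qed
    have smT: "smooth_on ?T (local_rep c e id)" using M.smooth_id c e by (simp add: smooth_wrt_def)
    have sm\<Psi>: "smooth_on \<Omega>e \<Psi>" using smooth_\<Psi> Ck_on_subset[of _ \<Psi> \<Omega> \<Omega>e] by (auto simp: smooth_on_def \<Omega>e_def)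
    have smf: "smooth_on \<Omega>e f" unfolding f_def[abs_def] by (rule smooth_on_compose[OF \<Omega>e T sub smT sm\<Psi>])
    have 1: "Ck_nat_on k r (snd e \<circ> ?\<psi>) (W \<inter> ?\<psi> -` fst e)" for r
      unfolding fe We by (rule Ck_nat_on_join[OF card_le k \<Omega>e smooth_onD[OF smf]])
    have 2: "\<forall>i<k. a i = 0" if w: "w \<in> W \<inter> ?\<psi> -` fst e" and sum0: "(\<Sum>i<k. a i *\<^sub>R partial_deriv i (snd e \<circ> ?\<psi>) w) = 0" for w a
    proof -
      let ?z = "?J w"
      have z: "?z \<in> \<Omega>e" "?z \<in> \<Omega>" "pt ?z \<in> fst e" "pt ?z \<in> fst c"
        using w We pt_in[of ?z] U(2) by (auto simp: \<Omega>e_def)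
      let ?E = "differential c e id (pt ?z)"
      have "(local_rep c e id has_derivative ?E) (at (\<Psi> ?z))"
        using has_derivative_differential[OF M.smooth_id c e z(4)] z(3) by (simp add: chart_pt[OF z(2)])
      from diff_chain_at[OF has_derivative_\<Psi>[OF z(2)] this]
      have df: "(f has_derivative ?E \<circ> D\<Psi> ?z) (at ?z)" by (simp add: f_def[abs_def] o_def)
      have pdv: "partial_deriv i (snd e \<circ> ?\<psi>) w = (?E \<circ> D\<Psi> ?z) (axis (coord (CARD('n) + i)) 1)" if "i < k" for i
        unfolding partial_deriv_def fe
        by (rule vector_derivative_at[OF has_vector_derivative_join[OF card_le _ df]]) (use that k in simp)
      define v where "v = (\<Sum>i<k. a i *\<^sub>R axis (coord (CARD('n) + i)) 1 :: (real,'m) vec)"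
      have linE: "linear ?E" by (rule M.linear_diff_id[OF c e z(4,3)])
      have lin: "linear (?E \<circ> D\<Psi> ?z)" by (rule linear_compose[OF linear_D\<Psi>[OF z(2)] linE])
      have "(?E \<circ> D\<Psi> ?z) v = (\<Sum>i<k. a i *\<^sub>R partial_deriv i (snd e \<circ> ?\<psi>) w)"
        unfolding v_def linear_sum[OF lin] linear_cmul[OF lin] by (intro sum.cong) (simp_all add: pdv)
      then have "?E (D\<Psi> ?z v) = 0" using sum0 by simp
      \<comment> \<open>The transition differential from \<open>e\<close> back to \<open>c\<close>
        undoes \<open>?E\<close>.\<close>
      then have "differential e c id (pt ?z) (?E (D\<Psi> ?z v)) = 0"
        using linear_0[OF M.linear_diff_id[OF e c z(3,4)]] by simp
      then have "D\<Psi> ?z v = 0"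
        using M.differential_id_comp[OF c e c z(4,3,4), of "D\<Psi> ?z v"] differential_same[OF cc z(4)] by simp
      then have v0: "v = 0" using inj_D\<Psi>[OF z(2)] linear_injective_0[OF linear_D\<Psi>[OF z(2)]] by blast
      show ?thesis
      proof (intro allI impI)
        fix i assume i: "i < k"
        have "0 = v $ coord (CARD('n) + i)" by (simp add: v0)
        also have "\<dots> = (\<Sum>i'<k. if i' = i then a i else 0)"
          unfolding v_def sum_component
        proof (rule sum.cong[OF refl])
          fix i' assume "i' \<in> {..<k}"
          then have "CARD('n) + i' < CARD('m)" "CARD('n) + i < CARD('m)" using i k by auto
          then show "(a i' *\<^sub>R axis (coord (CARD('n) + i')) 1 :: (real,'m) vec) $ coord (CARD('n) + i) = (if i' = i then a i else 0)"
            by (simp add: axis_def coord_inj_iff)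
        qed
        also have "\<dots> = a i" using i by simp
        finally show "a i = 0" by simp
      qed
    qed
    show ?thesis using 1 2 by blast
  qed
  have "openin (top_of_set (p -` {y})) (?\<psi> ` W)" unfolding im using U(1) by (auto simp: openin_open)
  then have "local_param M k (p -` {y}) W ?\<psi>"
    unfolding local_param_def using W hom chart_part by blast
  then show ?thesis using im by blast
qed

end

section \<open>Integration over the fibers\<close>

text \<open>A tent function in a chart suffices, because \<open>has_form_integral\<close> asks for a
  continuous partition of unity. The image \<open>Kc\<close> of the closed ball is compact and hence
  closed, so the extension by 0 is continuous on each of the open sets \<open>B\<close> and
  \<open>- Kc\<close>, which cover the manifold.\<close>

lemma (in riem) ex_bump:
  assumes O: "open O'" and x: "x \<in> O'"
  shows "\<exists>b :: 'p \<Rightarrow> real. continuous_on UNIV b \<and> (\<forall>z. 0 \<le> b z) \<and> 0 < b x \<and> closure {z. b z \<noteq> 0} \<subseteq> O'"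
proof -
  obtain c where c: "c \<in> atlas M" "x \<in> fst c" using ex_chart by blast
  note cc = chart[OF c(1)]
  define B where "B = O' \<inter> fst c"
  have B: "open B" "B \<subseteq> fst c" "x \<in> B" using O x c is_chart_open(1)[OF cc] by (auto simp: B_def)
  have "open (snd c ` B)" by (rule open_chart_image[OF cc B(1,2)])
  then obtain r where r: "r > 0" "cball (snd c x) r \<subseteq> snd c ` B"
    using B(3) open_contains_cball by blast
  let ?C = "cball (snd c x) r"
  define Kc where "Kc = chart_inv c ` ?C"
  have Csub: "?C \<subseteq> snd c ` fst c" using r(2) B(2) by blast
  have "compact Kc"
    unfolding Kc_def by (intro compact_continuous_image continuous_on_subset[OF continuous_on_chart_inv[OF cc] Csub] compact_cball)
  then have Kc: "closed Kc" by (rule compact_imp_closed)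
  have KB: "Kc \<subseteq> B"
  proof
    fix z assume "z \<in> Kc"
    then obtain a where "a \<in> ?C" "z = chart_inv c a" by (auto simp: Kc_def)
    then obtain z' where "z' \<in> B" "a = snd c z'" using r(2) by blast
    then show "z \<in> B" using \<open>z = chart_inv c a\<close> B(2) chart_inv_chart[OF cc, of z'] by auto
  qed
  define b where "b z = (if z \<in> B then max 0 (r - dist (snd c z) (snd c x)) else 0)" for z
  have bK: "b z = 0" if "z \<notin> Kc" for z
  proof (cases "z \<in> B")
    case True
    then have "chart_inv c (snd c z) = z" using B(2) chart_inv_chart[OF cc] by blast
    then have "snd c z \<notin> ?C" using that unfolding Kc_def by (metis imageI)
    then show ?thesis using True by (simp add: b_def dist_commute)
  qed (simp add: b_def)
  have "continuous_on B b"
  proof -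
    have "continuous_on B (\<lambda>z. max 0 (r - dist (snd c z) (snd c x)))"
      by (intro continuous_intros continuous_on_subset[OF continuous_on_chart[OF cc] B(2)])
    then show ?thesis by (rule continuous_on_cong[THEN iffD1, rotated -1]) (simp_all add: b_def)
  qed
  moreover have "continuous_on (- Kc) b"
    by (rule continuous_on_cong[THEN iffD1, rotated -1, OF continuous_on_const[of _ 0]]) (simp_all add: bK)
  ultimately have "continuous_on (B \<union> - Kc) b"
    using B(1) Kc by (intro continuous_on_open_Un) auto
  moreover have "B \<union> - Kc = UNIV" using KB by blast
  ultimately have "continuous_on UNIV b" by simp
  moreover have "closure {z. b z \<noteq> 0} \<subseteq> Kc" using bK Kc by (intro closure_minimal) auto
  then have "closure {z. b z \<noteq> 0} \<subseteq> O'" using KB by (auto simp: B_def)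
  moreover have "b x > 0" using r(1) B(3) by (simp add: b_def)
  moreover have "\<forall>z. 0 \<le> b z" by (simp add: b_def)
  ultimately show ?thesis by blast
qed

context subm
begin

text \<open>
  \<open>K f y\<close> is to be thought of as the integral of \<open>f\<close> over the part of the fiber of \<open>y\<close> that lies in \<open>U\<close>.
\<close>

definition fiber_kernel :: "'p set \<Rightarrow> (('p \<Rightarrow> ennreal) \<Rightarrow> 'q \<Rightarrow> ennreal) \<Rightarrow> bool" where
  "fiber_kernel U K \<longleftrightarrow> open U \<and> emeasure M.vol U < \<infinity> \<and>
   (\<forall>f\<in>borel_measurable borel. K f \<in> borel_measurable borel) \<and>
   (\<forall>A B. A \<in> sets borel \<longrightarrow> A \<subseteq> U \<longrightarrow> B \<in> sets borel \<longrightarrow>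
      emeasure M.vol (A \<inter> p -` B) = (\<integral>\<^sup>+y\<in>B. K (indicator A) y \<partial>N.vol)) \<and>
   (\<forall>f g y. (\<forall>x. p x = y \<longrightarrow> f x = g x) \<longrightarrow> K f y = K g y) \<and>
   (\<forall>(l::nat) f y. (\<forall>j<l. f j \<in> borel_measurable borel) \<longrightarrow> K (\<lambda>x. \<Sum>j<l. f j x) y = (\<Sum>j<l. K (f j) y)) \<and>
   (\<forall>\<xi> y W \<psi> A H. quotient \<xi> \<longrightarrow> local_param M k (p -` {y}) W \<psi> \<longrightarrow> A \<in> sets borel \<longrightarrow> A \<subseteq> U \<longrightarrow>
      H \<in> borel_measurable borel \<longrightarrow> \<psi> ` W \<in> sets borel \<longrightarrow>
      (\<integral>\<^sup>+w. indicator {w \<in> W. \<psi> w \<in> A} w * (H (\<psi> w) * ennreal \<bar>param_coeff M \<xi> \<psi> w\<bar>) \<partial>lborel_nat k)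
        = K (\<lambda>x. H x * indicator (A \<inter> \<psi> ` W) x) y) \<and>
   (\<forall>\<xi> y W \<psi>. quotient \<xi> \<longrightarrow> local_param M k (p -` {y}) W \<psi> \<longrightarrow>
      continuous_on (W \<inter> \<psi> -` U) (\<lambda>w. \<bar>param_coeff M \<xi> \<psi> w\<bar>)) \<and>
   (\<forall>x\<in>U. \<exists>W \<psi>. local_param M k (p -` {p x}) W \<psi> \<and> \<psi> ` W = p -` {p x} \<inter> U)"

text \<open>From here on only the properties listed in \<open>fiber_kernel\<close> are used, so
  countably many kernels can be chosen without carrying their coordinates along.\<close>

lemma ex_fiber_kernel: "\<exists>U K. x \<in> U \<and> fiber_kernel U K"
proof -
  obtain c d U \<Omega> \<Theta> \<Psi> where st: "straight M N p k c d U \<Omega> \<Theta> \<Psi>" and x: "x \<in> U" and fin: "emeasure M.vol U < \<infinity>"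
    using ex_straight[of x] by (elim exE conjE)
  interpret st: straight M N p k c d U \<Omega> \<Theta> \<Psi> by (rule st)
  have pt0: "p (st.pt0 (join (snd d y) w)) = y" if "y \<in> fst d" "join (snd d y) w \<in> \<Omega>" for y w
    using st.p_pt(1)[OF that(2)] chart_inv_chart[OF st.dd that(1)] that(2)
    by (simp add: base_join[OF card_le] st.pt0_def)
  have cong: "st.K f y = st.K g y" if "\<forall>x. p x = y \<longrightarrow> f x = g x" for f g y
  proof -
    have "f (st.pt0 (join (snd d y) w)) * st.gdens (join (snd d y) w) = g (st.pt0 (join (snd d y) w)) * st.gdens (join (snd d y) w)"
      if "y \<in> fst d" for w
      using pt0[OF that, of w] \<open>\<forall>x. p x = y \<longrightarrow> f x = g x\<close> by (cases "join (snd d y) w \<in> \<Omega>") (auto simp: st.gdens_def)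
    then show ?thesis by (simp add: st.K_def)
  qed
  have sum: "st.K (\<lambda>x. \<Sum>j<l. f j x) y = (\<Sum>j<l. st.K (f j) y)" if f: "\<forall>j<l. f j \<in> borel_measurable borel" for l :: nat and f y
  proof (cases "y \<in> fst d")
    case True
    have "continuous_on UNIV (\<lambda>w. join (snd d y) w :: (real,'m) vec)"
      by (intro continuous_on_join continuous_on_const continuous_on_id)
    note mj = borel_measurable_continuous_onI[OF this]
    have m: "(\<lambda>w. f j (st.pt0 (join (snd d y) w)) * st.gdens (join (snd d y) w)) \<in> borel_measurable (lborel_nat k)" if "j \<in> {..<l}" for j
      using measurable_compose[OF mj st.measurable_K_integrand[of "f j"]] f that by simp
    have "st.K (\<lambda>x. \<Sum>j<l. f j x) y = (\<integral>\<^sup>+w. (\<Sum>j<l. f j (st.pt0 (join (snd d y) w)) * st.gdens (join (snd d y) w)) \<partial>lborel_nat k)"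
      using True by (simp add: st.K_def sum_distrib_right)
    also have "\<dots> = (\<Sum>j<l. \<integral>\<^sup>+w. f j (st.pt0 (join (snd d y) w)) * st.gdens (join (snd d y) w) \<partial>lborel_nat k)"
      by (rule nn_integral_sum[OF m])
    also have "\<dots> = (\<Sum>j<l. st.K (f j) y)" using True by (simp add: st.K_def)
    finally show ?thesis .
  qed (simp add: st.K_def)
  have par: "(\<integral>\<^sup>+w. indicator {w \<in> W. \<psi> w \<in> A} w * (H (\<psi> w) * ennreal \<bar>param_coeff M \<xi> \<psi> w\<bar>) \<partial>lborel_nat k)
        = st.K (\<lambda>x. H x * indicator (A \<inter> \<psi> ` W) x) y"
    if "quotient \<xi>" "local_param M k (p -` {y}) W \<psi>" "A \<in> sets borel" "A \<subseteq> U" "H \<in> borel_measurable borel" "\<psi> ` W \<in> sets borel"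
    for \<xi> y W \<psi> A H
  proof -
    interpret sp: sparam M N p k c d U \<Omega> \<Theta> \<Psi> \<xi> y W \<psi>
      by (intro sparam.intro st sparam_axioms.intro that)
    show ?thesis by (rule sp.nn_integral_param[OF that(3-6)])
  qed
  have cont: "continuous_on (W \<inter> \<psi> -` U) (\<lambda>w. \<bar>param_coeff M \<xi> \<psi> w\<bar>)"
    if "quotient \<xi>" "local_param M k (p -` {y}) W \<psi>" for \<xi> y W \<psi>
  proof -
    interpret sp: sparam M N p k c d U \<Omega> \<Theta> \<Psi> \<xi> y W \<psi>
      by (intro sparam.intro st sparam_axioms.intro that)
    show ?thesis using sp.continuous_on_coeff unfolding sp.W1_def .
  qed
  have ex: "\<exists>W \<psi>. local_param M k (p -` {p x}) W \<psi> \<and> \<psi> ` W = p -` {p x} \<inter> U" if "x \<in> U" for x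
  proof -
    have "p x \<in> fst d" using that st.U(3) by blast
    from st.local_param_straight[OF this] show ?thesis by (intro exI)
  qed
  have "fiber_kernel U st.K"
    unfolding fiber_kernel_def
    by (intro conjI st.U(1) fin ballI st.measurable_K allI impI st.emeasure_straight cong sum par cont ex) simp_all
  then show ?thesis using x by blast
qed

lemma ex_kernel_cover:
  "\<exists>(Us :: nat \<Rightarrow> 'p set) Ks. (\<forall>i. fiber_kernel (Us i) (Ks i)) \<and> (\<Union>i. Us i) = UNIV"
proof -
  let ?\<U> = "{U. \<exists>K. fiber_kernel U K}"
  have "\<And>S. S \<in> ?\<U> \<Longrightarrow> openin (top_of_set UNIV) S" by (auto simp: fiber_kernel_def)
  then obtain F where F: "F \<subseteq> ?\<U>" "countable F" "\<Union>F = \<Union>?\<U>" by (rule Lindelof_openin)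
  have U: "\<Union>?\<U> = UNIV"
  proof (rule UNIV_eq_I[symmetric])
    fix x show "x \<in> \<Union>?\<U>" using ex_fiber_kernel[of x] by auto
  qed
  have ne: "F \<noteq> {}" using F(3) unfolding U by auto
  define Us where "Us = from_nat_into F"
  define Ks where "Ks i = (SOME K. fiber_kernel (Us i) K)" for i
  have "fiber_kernel (Us i) (Ks i)" for i
  proof -
    have "\<exists>K. fiber_kernel (Us i) K" using from_nat_into[OF ne, of i] F(1) unfolding Us_def by blast
    from someI_ex[OF this] show ?thesis unfolding Ks_def .
  qed
  moreover have "(\<Union>i. Us i) = UNIV" using F(3) U range_from_nat_into[OF ne F(2)] by (simp add: Us_def)
  ultimately show ?thesis by blast
qed

lemma closed_fiber: "closed (p -` {y})"
  by (intro closed_vimage continuous_p) simp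

end

section \<open>Gluing the local kernels: the density of the push-forward and its identification with
  the fiber integral\<close>

locale kernel_cover = subm M N p k
  for M :: "('p::{second_countable_topology,t2_space}, 'm::{finite,wellorder}) manifold"
    and N :: "('q::{second_countable_topology,t2_space}, 'n::{finite,wellorder}) manifold"
    and p :: "'p \<Rightarrow> 'q" and k :: nat +
  fixes Us :: "nat \<Rightarrow> 'p set" and Ks :: "nat \<Rightarrow> ('p \<Rightarrow> ennreal) \<Rightarrow> 'q \<Rightarrow> ennreal"
  assumes ker: "fiber_kernel (Us i) (Ks i)" and cover: "(\<Union>i. Us i) = UNIV"
    and proper: "proper_map euclidean euclidean p"
begin

lemmas kernel = ker[unfolded fiber_kernel_def]

lemma open_Us: "open (Us i)" using kernel[of i] by (elim conjE)

lemma finite_Us: "emeasure M.vol (Us i) < \<infinity>" using kernel[of i] by (elim conjE)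

lemma measurable_Ks: "f \<in> borel_measurable borel \<Longrightarrow> Ks i f \<in> borel_measurable borel"
  using kernel[of i] by (elim conjE) (drule bspec, assumption+)

lemma emeasure_Ks: "A \<in> sets borel \<Longrightarrow> A \<subseteq> Us i \<Longrightarrow> B \<in> sets borel \<Longrightarrow>
    emeasure M.vol (A \<inter> p -` B) = (\<integral>\<^sup>+y\<in>B. Ks i (indicator A) y \<partial>N.vol)"
  using kernel[of i, THEN conjunct2, THEN conjunct2, THEN conjunct2, THEN conjunct1] by simp

lemma Ks_cong: "(\<And>x. p x = y \<Longrightarrow> f x = g x) \<Longrightarrow> Ks i f y = Ks i g y"
  using kernel[of i, THEN conjunct2, THEN conjunct2, THEN conjunct2, THEN conjunct2, THEN conjunct1, THEN spec, THEN spec, THEN spec] by simp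

lemma Ks_sum: "(\<And>j. j < l \<Longrightarrow> f j \<in> borel_measurable borel) \<Longrightarrow> Ks i (\<lambda>x. \<Sum>j<(l::nat). f j x) y = (\<Sum>j<l. Ks i (f j) y)"
  using kernel[of i, THEN conjunct2, THEN conjunct2, THEN conjunct2, THEN conjunct2, THEN conjunct2, THEN conjunct1, THEN spec, THEN spec, THEN spec] by simp

lemma Ks_0: "Ks i (\<lambda>x. 0) y = 0"
  using Ks_sum[of 0 "\<lambda>_ _. 0" i y] by simp

lemma Ks_param: "quotient \<xi> \<Longrightarrow> local_param M k (p -` {y}) W \<psi> \<Longrightarrow> A \<in> sets borel \<Longrightarrow> A \<subseteq> Us i \<Longrightarrow>
      H \<in> borel_measurable borel \<Longrightarrow> \<psi> ` W \<in> sets borel \<Longrightarrow>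
      (\<integral>\<^sup>+w. indicator {w \<in> W. \<psi> w \<in> A} w * (H (\<psi> w) * ennreal \<bar>param_coeff M \<xi> \<psi> w\<bar>) \<partial>lborel_nat k)
        = Ks i (\<lambda>x. H x * indicator (A \<inter> \<psi> ` W) x) y"
  using kernel[of i, THEN conjunct2, THEN conjunct2, THEN conjunct2, THEN conjunct2, THEN conjunct2, THEN conjunct2,
      THEN conjunct1, THEN spec, THEN spec, THEN spec, THEN spec, THEN spec, THEN spec] by simp

lemma continuous_coeff_Us: "quotient \<xi> \<Longrightarrow> local_param M k (p -` {y}) W \<psi> \<Longrightarrow>
      continuous_on (W \<inter> \<psi> -` Us i) (\<lambda>w. \<bar>param_coeff M \<xi> \<psi> w\<bar>)"
  using kernel[of i, THEN conjunct2, THEN conjunct2, THEN conjunct2, THEN conjunct2, THEN conjunct2, THEN conjunct2,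
      THEN conjunct2, THEN conjunct1, THEN spec, THEN spec, THEN spec, THEN spec] by simp

lemma ex_local_param: "x \<in> Us i \<Longrightarrow> \<exists>W \<psi>. local_param M k (p -` {p x}) W \<psi> \<and> \<psi> ` W = p -` {p x} \<inter> Us i"
  using kernel[of i, THEN conjunct2, THEN conjunct2, THEN conjunct2, THEN conjunct2, THEN conjunct2, THEN conjunct2,
      THEN conjunct2, THEN conjunct2, THEN bspec] .

lemma compact_fiber: "compact (p -` {y})"
proof -
  have "compactin euclidean {x \<in> topspace euclidean. p x = y}"
    using proper unfolding proper_map_def by simp
  also have "{x \<in> topspace euclidean. p x = y} = p -` {y}" by auto
  finally show ?thesis by simp
qed

definition A :: "nat \<Rightarrow> 'p set" where "A = disjointed Us"

lemma A: "A i \<in> sets borel" "A i \<subseteq> Us i" "disjoint_family A" "(\<Union>i. A i) = UNIV"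
proof -
  have "range Us \<subseteq> sets borel" using open_Us by auto
  from sets.range_disjointed_sets[OF this] show "A i \<in> sets borel" by (auto simp: A_def)
  show "A i \<subseteq> Us i" unfolding A_def by (rule disjointed_subset)
  show "disjoint_family A" unfolding A_def by (rule disjoint_family_disjointed)
  show "(\<Union>i. A i) = UNIV" unfolding A_def UN_disjointed_eq by (rule cover)
qed

text \<open>The density of the push-forward, assembled from disjoint pieces. No quotient occurs in
  it, so the null set where it is infinite does not depend on \<xi>.\<close>

definition F :: "'q \<Rightarrow> ennreal" where "F y = (\<Sum>i. Ks i (indicator (A i)) y)"

lemma measurable_F: "F \<in> borel_measurable borel"
  unfolding F_def[abs_def] using A(1) by (intro borel_measurable_suminf_order measurable_Ks) auto

lemma distr_eq_density: "distr M.vol borel p = density N.vol F"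
proof (rule measure_eqI)
  fix B assume "B \<in> sets (distr M.vol borel p)"
  then have B: "B \<in> sets borel" by simp
  have mp: "p \<in> borel_measurable borel" by (rule borel_measurable_continuous_onI[OF continuous_p])
  then have mp': "p \<in> M.vol \<rightarrow>\<^sub>M borel" by simp
  have pB: "p -` B \<in> sets borel" using measurable_sets[OF mp B] by simp
  have "emeasure (distr M.vol borel p) B = emeasure M.vol (p -` B)"
    using emeasure_distr[OF mp' B] by simp
  also have "p -` B = (\<Union>i. A i \<inter> p -` B)" using A(4) by auto
  also have "emeasure M.vol \<dots> = (\<Sum>i. emeasure M.vol (A i \<inter> p -` B))"
    using A(1,3) pB by (intro suminf_emeasure[symmetric]) (auto simp: disjoint_family_on_def)
  also have "\<dots> = (\<Sum>i. \<integral>\<^sup>+y. Ks i (indicator (A i)) y * indicator B y \<partial>N.vol)"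
    using emeasure_Ks[OF A(1,2) B] by simp
  also have "\<dots> = (\<integral>\<^sup>+y. (\<Sum>i. Ks i (indicator (A i)) y * indicator B y) \<partial>N.vol)"
  proof (rule nn_integral_suminf[symmetric])
    fix i
    have "Ks i (indicator (A i)) \<in> borel_measurable borel" using A(1) by (intro measurable_Ks) simp
    then show "(\<lambda>y. Ks i (indicator (A i)) y * indicator B y) \<in> borel_measurable N.vol" using B by simp
  qed
  also have "\<dots> = (\<integral>\<^sup>+y\<in>B. F y \<partial>N.vol)" by (simp add: F_def ennreal_suminf_multc)
  also have "\<dots> = emeasure (density N.vol F) B" using measurable_F B by (simp add: emeasure_density)
  finally show "emeasure (distr M.vol borel p) B = emeasure (density N.vol F) B" .
qed simp

text \<open>By properness finitely many \<open>Us j\<close> cover the fiber, and \<open>A i\<close>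
  misses all the earlier ones.\<close>

lemma fiber_finite_cover: "\<exists>m. \<forall>i\<ge>m. A i \<inter> p -` {y} = {}"
proof -
  have sub: "p -` {y} \<subseteq> (\<Union>i\<in>UNIV. Us i)" using cover by simp
  obtain I where I': "I \<subseteq> UNIV" and I: "finite I" "p -` {y} \<subseteq> (\<Union>i\<in>I. Us i)"
    by (rule compactE_image[OF compact_fiber open_Us sub]) (rule that)
  obtain m where m: "\<forall>i\<in>I. i < m" using I(1) finite_nat_set_iff_bounded by blast
  have "A i \<inter> p -` {y} = {}" if "i \<ge> m" for i
  proof -
    have d: "A i \<inter> Us j = {}" if "j < i" for j using that by (auto simp: A_def disjointed_def)
    show ?thesis
    proof (rule equals0I)
      fix x assume x: "x \<in> A i \<inter> p -` {y}"
      then obtain j where j: "j \<in> I" "x \<in> Us j" using I(2) by blast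
      then have "j < i" using m that by (meson less_le_trans)
      then show False using d[of j] x j(2) by blast
    qed
  qed
  then show ?thesis by blast
qed

lemma F_finite:
  assumes "\<And>i. Ks i (indicator (A i)) y < \<infinity>"
  shows "F y < \<infinity>"
proof -
  obtain m where m: "\<forall>i\<ge>m. A i \<inter> p -` {y} = {}" using fiber_finite_cover by blast
  have 0: "Ks i (indicator (A i)) y = 0" if "i \<notin> {..<m}" for i
  proof -
    have "Ks i (indicator (A i)) y = Ks i (\<lambda>x. 0) y"
    proof (rule Ks_cong)
      fix x assume "p x = y"
      moreover have "A i \<inter> p -` {y} = {}" using m that by (simp add: not_less)
      ultimately have "x \<notin> A i" by blast
      then show "indicator (A i) x = (0::ennreal)" by simp
    qed
    then show ?thesis by (simp add: Ks_0)
  qed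
  have "F y = (\<Sum>i<m. Ks i (indicator (A i)) y)" unfolding F_def by (rule suminf_finite[OF _ 0]) simp
  also have "\<dots> < \<infinity>" using assms by simp
  finally show ?thesis .
qed

text \<open>The kernel of \<open>A i\<close> integrates over N to the finite volume of
  \<open>A i\<close>, so each summand is finite almost everywhere. After countably many null sets
  are discarded, \<open>F_finite\<close> handles the sum.\<close>

lemma AE_F_finite: "AE y in N.vol. F y < \<infinity>"
proof -
  have "AE y in N.vol. Ks i (indicator (A i)) y < \<infinity>" for i
  proof -
    have m: "Ks i (indicator (A i)) \<in> borel_measurable N.vol"
      using measurable_Ks[of "indicator (A i)" i] A(1) by simp
    have "(\<integral>\<^sup>+y. Ks i (indicator (A i)) y \<partial>N.vol) = emeasure M.vol (A i)"
      using emeasure_Ks[OF A(1,2), of UNIV i] by simp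
    also have "\<dots> \<le> emeasure M.vol (Us i)" using A(2) open_Us by (intro emeasure_mono) auto
    also have "\<dots> < \<infinity>" by (rule finite_Us)
    finally have "(\<integral>\<^sup>+y. Ks i (indicator (A i)) y \<partial>N.vol) \<noteq> \<infinity>" by simp
    from nn_integral_PInf_AE[OF m this] show ?thesis by (auto simp: less_top)
  qed
  then have "AE y in N.vol. \<forall>i. Ks i (indicator (A i)) y < \<infinity>" by (subst AE_all_countable) simp
  then show ?thesis by (rule eventually_mono) (rule F_finite, blast)
qed

lemma F_outside: assumes "y \<notin> range p" shows "F y = 0"
proof -
  have "Ks i (indicator (A i)) y = Ks i (\<lambda>x. 0) y" for i by (rule Ks_cong) (use assms in auto)
  then show ?thesis by (simp add: F_def Ks_0)
qed

text \<open>The sign turns the coefficient into its absolute value, so the integrands are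
  nonnegative. Cut along the \<open>A i\<close> and transported by \<open>Ks_param\<close>, they
  become kernel integrals of the functions \<rho>, which add up to F because the \<rho> sum to 1.
  Finiteness of \<open>F y\<close> excludes nonintegrable summands, to which the Bochner integral
  would assign 0.\<close>

lemma form_integral_unique:
  assumes \<xi>: "quotient \<xi>" and fin: "F y < \<infinity>" and I: "has_form_integral M k (p -` {y}) \<xi> \<xi> I"
  shows "I = enn2real (F y)"
proof -
  let ?Y = "p -` {y}"
  obtain l :: nat and \<rho> W \<psi> where
    lp: "\<And>j. j < l \<Longrightarrow> local_param M k ?Y (W j) (\<psi> j)"
    and \<rho>: "\<And>j. j < l \<Longrightarrow> continuous_on ?Y (\<rho> j)" "\<And>j x. j < l \<Longrightarrow> x \<in> ?Y \<Longrightarrow> 0 \<le> \<rho> j x"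
    and supp: "\<And>j. j < l \<Longrightarrow> closure {x\<in>?Y. \<rho> j x \<noteq> 0} \<subseteq> \<psi> j ` W j"
    and one: "\<And>x. x \<in> ?Y \<Longrightarrow> (\<Sum>j<l. \<rho> j x) = 1"
    and I: "I = (\<Sum>j<l. LINT w:W j|lborel_nat k.
               \<rho> j (\<psi> j w) * sgn (param_coeff M \<xi> (\<psi> j) w) * param_coeff M \<xi> (\<psi> j) w)"
    using I unfolding has_form_integral_def by (elim exE conjE) (rule that, simp_all)
  \<comment> \<open>\<open>\<rho> j\<close> is controlled on the fiber only. Its extension by 0 is
    Borel measurable, and by \<open>Ks_cong\<close> the kernel at \<open>y\<close> sees only the
    values on the fiber.\<close>
  define H where "H j x = (if x \<in> ?Y then ennreal (\<rho> j x) else 0)" for j x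
  have H: "H j \<in> borel_measurable borel" if "j < l" for j
  proof -
    have "(\<lambda>x. if x \<in> ?Y then \<rho> j x else 0) \<in> borel_measurable borel"
      by (intro borel_measurable_continuous_on_if \<rho>(1)[OF that] continuous_on_const) (simp add: closed_fiber)
    then have "(\<lambda>x. ennreal (if x \<in> ?Y then \<rho> j x else 0)) \<in> borel_measurable borel" by measurable
    also have "(\<lambda>x. ennreal (if x \<in> ?Y then \<rho> j x else 0)) = H j" by (auto simp: H_def)
    finally show ?thesis .
  qed
  define T where "T j = (\<Sum>i. Ks i (\<lambda>x. H j x * indicator (A i) x) y)" for j
  have int: "(LINT w:W j|lborel_nat k. \<rho> j (\<psi> j w) * sgn (param_coeff M \<xi> (\<psi> j) w) * param_coeff M \<xi> (\<psi> j) w) = enn2real (T j)"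
    if j: "j < l" for j
  proof -
    let ?W = "W j" and ?\<psi> = "\<psi> j"
    let ?c = "\<lambda>w. \<bar>param_coeff M \<xi> ?\<psi> w\<bar>"
    note lpj = lp[OF j]
    have oW: "openin (Euclidean_space k) ?W" by (rule lpj[unfolded local_param_def, THEN conjunct1])
    have o\<psi>: "openin (top_of_set ?Y) (?\<psi> ` ?W)" by (rule lpj[unfolded local_param_def, THEN conjunct2, THEN conjunct1])
    obtain \<phi> where hom: "homeomorphism ?W (?\<psi> ` ?W) ?\<psi> \<phi>"
      using lpj[unfolded local_param_def, THEN conjunct2, THEN conjunct2, THEN conjunct1] by (elim exE)
    note c\<psi> = homeomorphism_cont1[OF hom]
    have \<psi>Y: "?\<psi> w \<in> ?Y" if "w \<in> ?W" for w using openin_imp_subset[OF o\<psi>] that by blast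
    have W: "?W \<in> sets borel" by (rule openin_Euclidean_space_borel[OF oW])
    have \<psi>W: "?\<psi> ` ?W \<in> sets borel"
    proof -
      obtain V where "open V" "?\<psi> ` ?W = ?Y \<inter> V" using o\<psi> by (auto simp: openin_open)
      then show ?thesis using closed_fiber[of y] by simp
    qed
    \<comment> \<open>Continuity is local, and the preimages of the sets \<open>Us i\<close> form a
      relatively open cover of the parameter domain.\<close>
    have cc: "continuous_on ?W ?c"
    proof -
      have op: "openin (top_of_set ?W) (?W \<inter> ?\<psi> -` Us i)" for i
        by (rule continuous_openin_preimage_gen[OF c\<psi> open_Us])
      have "\<exists>i. x \<in> Us i" for x using cover by blast
      then have Wcov: "(\<Union>i\<in>UNIV. ?W \<inter> ?\<psi> -` Us i) = ?W" by auto
      moreover have "continuous_on (\<Union>i\<in>UNIV. ?W \<inter> ?\<psi> -` Us i) ?c"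
        unfolding continuous_on_def
      proof
        fix w assume w: "w \<in> (\<Union>i\<in>UNIV. ?W \<inter> ?\<psi> -` Us i)"
        then obtain i where i: "w \<in> ?W \<inter> ?\<psi> -` Us i" by blast
        obtain T where T: "open T" "?W \<inter> ?\<psi> -` Us i = ?W \<inter> T" using op[of i] by (auto simp: openin_open)
        have "(?c \<longlongrightarrow> ?c w) (at w within ?W \<inter> T)"
          using continuous_coeff_Us[OF \<xi> lpj, of i] i unfolding continuous_on_def T(2)[symmetric] by blast
        moreover have "at w within ?W \<inter> T = at w within ?W"
          using T i by (intro at_within_nhd[of w T]) auto
        ultimately show "(?c \<longlongrightarrow> ?c w) (at w within (\<Union>i\<in>UNIV. ?W \<inter> ?\<psi> -` Us i))"
          unfolding Wcov by simp
      qed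
      ultimately show ?thesis by simp
    qed
    have c\<rho>: "continuous_on ?W (\<lambda>w. \<rho> j (?\<psi> w))"
      by (rule continuous_on_compose2[OF \<rho>(1)[OF j] c\<psi>]) (use \<psi>Y in auto)
    define g where "g w = indicator ?W w *\<^sub>R (\<rho> j (?\<psi> w) * ?c w)" for w
    have g: "g \<in> borel_measurable borel"
      unfolding g_def[abs_def] by (intro borel_measurable_continuous_on_indicator W continuous_on_mult c\<rho> cc)
    have g0: "0 \<le> g w" for w using \<rho>(2)[OF j \<psi>Y, of w] by (auto simp: g_def indicator_def)
    have WA: "{w \<in> ?W. ?\<psi> w \<in> A i} \<in> sets borel" for i
    proof -
      have "(\<lambda>w. if w \<in> ?W then ?\<psi> w else undefined) \<in> borel_measurable borel"
        by (intro borel_measurable_continuous_on_if W c\<psi> continuous_on_const)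
      from measurable_sets[OF this A(1)[of i]] W
      have "?W \<inter> (\<lambda>w. if w \<in> ?W then ?\<psi> w else undefined) -` A i \<in> sets borel" by simp
      also have "?W \<inter> (\<lambda>w. if w \<in> ?W then ?\<psi> w else undefined) -` A i = {w \<in> ?W. ?\<psi> w \<in> A i}" by auto
      finally show ?thesis .
    qed
    have gsum: "ennreal (g w) = (\<Sum>i. indicator {w \<in> ?W. ?\<psi> w \<in> A i} w * ennreal (g w))" for w
    proof -
      have "(\<Sum>i. indicator {w \<in> ?W. ?\<psi> w \<in> A i} w * ennreal (g w)) = (\<Sum>i. indicator {w \<in> ?W. ?\<psi> w \<in> A i} w) * ennreal (g w)"
        by (rule ennreal_suminf_multc)
      also have "(\<Sum>i. indicator {w \<in> ?W. ?\<psi> w \<in> A i} w :: ennreal) = indicator (\<Union>i. {w \<in> ?W. ?\<psi> w \<in> A i}) w"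
      proof (rule suminf_indicator)
        show "disjoint_family (\<lambda>i. {w \<in> ?W. ?\<psi> w \<in> A i})"
          using A(3) by (auto simp: disjoint_family_on_def)
      qed
      also have "(\<Union>i. {w \<in> ?W. ?\<psi> w \<in> A i}) = ?W"
      proof -
        have "\<exists>i. x \<in> A i" for x using A(4) by blast
        then show ?thesis by auto
      qed
      finally show ?thesis by (auto simp: g_def indicator_def)
    qed
    have "(LINT w:?W|lborel_nat k. \<rho> j (?\<psi> w) * sgn (param_coeff M \<xi> ?\<psi> w) * param_coeff M \<xi> ?\<psi> w) = (\<integral>w. g w \<partial>lborel_nat k)"
      unfolding set_lebesgue_integral_def g_def by (simp add: mult.assoc abs_sgn mult.commute[of "sgn _"])
    also have "\<dots> = enn2real (\<integral>\<^sup>+w. ennreal (g w) \<partial>lborel_nat k)"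
      using g g0 by (intro integral_eq_nn_integral) simp_all
    also have "(\<integral>\<^sup>+w. ennreal (g w) \<partial>lborel_nat k) = (\<integral>\<^sup>+w. (\<Sum>i. indicator {w \<in> ?W. ?\<psi> w \<in> A i} w * ennreal (g w)) \<partial>lborel_nat k)"
      by (intro nn_integral_cong gsum)
    also have "\<dots> = (\<Sum>i. \<integral>\<^sup>+w. indicator {w \<in> ?W. ?\<psi> w \<in> A i} w * ennreal (g w) \<partial>lborel_nat k)"
    proof (rule nn_integral_suminf)
      fix i
      show "(\<lambda>w. indicator {w \<in> ?W. ?\<psi> w \<in> A i} w * ennreal (g w)) \<in> borel_measurable (lborel_nat k)"
        using WA[of i] g by simp
    qed
    also have "\<dots> = T j"
      unfolding T_def
    proof (rule suminf_cong)
      fix i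
      have "(\<integral>\<^sup>+w. indicator {w \<in> ?W. ?\<psi> w \<in> A i} w * ennreal (g w) \<partial>lborel_nat k)
          = (\<integral>\<^sup>+w. indicator {w \<in> ?W. ?\<psi> w \<in> A i} w * (H j (?\<psi> w) * ennreal (?c w)) \<partial>lborel_nat k)"
      proof (intro nn_integral_cong)
        fix w
        show "indicator {w \<in> ?W. ?\<psi> w \<in> A i} w * ennreal (g w) = indicator {w \<in> ?W. ?\<psi> w \<in> A i} w * (H j (?\<psi> w) * ennreal (?c w))"
        proof (cases "w \<in> ?W")
          case True
          then show ?thesis using \<psi>Y[OF True] \<rho>(2)[OF j \<psi>Y[OF True]] by (simp add: g_def H_def ennreal_mult)
        qed simp
      qed
      also have "\<dots> = Ks i (\<lambda>x. H j x * indicator (A i \<inter> ?\<psi> ` ?W) x) y"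
        by (rule Ks_param[OF \<xi> lpj A(1,2) H[OF j] \<psi>W])
      also have "\<dots> = Ks i (\<lambda>x. H j x * indicator (A i) x) y"
      proof (rule Ks_cong)
        fix x assume "p x = y"
        then have xY: "x \<in> ?Y" by simp
        have "x \<in> ?\<psi> ` ?W" if "\<rho> j x \<noteq> 0"
        proof -
          have "x \<in> {x\<in>?Y. \<rho> j x \<noteq> 0}" using xY that by simp
          then have "x \<in> closure {x\<in>?Y. \<rho> j x \<noteq> 0}" by (rule subsetD[OF closure_subset])
          then show ?thesis using supp[OF j] by blast
        qed
        then show "H j x * indicator (A i \<inter> ?\<psi> ` ?W) x = H j x * indicator (A i) x"
          by (cases "\<rho> j x = 0") (auto simp: H_def indicator_def)
      qed
      finally show "(\<integral>\<^sup>+w. indicator {w \<in> ?W. ?\<psi> w \<in> A i} w * ennreal (g w) \<partial>lborel_nat k) = Ks i (\<lambda>x. H j x * indicator (A i) x) y" .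
    qed
    finally show ?thesis .
  qed
  have "(\<Sum>j<l. T j) = (\<Sum>i. \<Sum>j<l. Ks i (\<lambda>x. H j x * indicator (A i) x) y)"
    unfolding T_def by (rule suminf_sum[symmetric]) simp
  also have "\<dots> = (\<Sum>i. Ks i (indicator (A i)) y)"
  proof (rule suminf_cong)
    fix i
    have "(\<Sum>j<l. Ks i (\<lambda>x. H j x * indicator (A i) x) y) = Ks i (\<lambda>x. \<Sum>j<l. H j x * indicator (A i) x) y"
      using H A(1) by (intro Ks_sum[symmetric]) simp
    also have "\<dots> = Ks i (indicator (A i)) y"
    proof (rule Ks_cong)
      fix x assume "p x = y"
      then have xY: "x \<in> ?Y" by simp
      have "(\<Sum>j<l. H j x) = (\<Sum>j<l. ennreal (\<rho> j x))" using xY by (simp add: H_def)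
      also have "\<dots> = ennreal (\<Sum>j<l. \<rho> j x)" using \<rho>(2) xY by (intro sum_ennreal) simp
      finally have "(\<Sum>j<l. H j x) = 1" using one[OF xY] by simp
      then show "(\<Sum>j<l. H j x * indicator (A i) x) = indicator (A i) x"
        by (simp add: sum_distrib_right[symmetric])
    qed
    finally show "(\<Sum>j<l. Ks i (\<lambda>x. H j x * indicator (A i) x) y) = Ks i (indicator (A i)) y" .
  qed
  finally have sumT: "(\<Sum>j<l. T j) = F y" by (simp add: F_def)
  \<comment> \<open>\<open>enn2real\<close> sends an infinite value to 0, so each \<open>T j\<close>
    has to be finite before the sum can be recovered.\<close>
  have Tfin: "T j < \<infinity>" if "j < l" for j
  proof -
    have "T j \<le> (\<Sum>j<l. T j)" using that by (intro member_le_sum) auto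
    then show ?thesis unfolding sumT using fin by (rule le_less_trans)
  qed
  have "I = (\<Sum>j<l. enn2real (T j))" unfolding I by (intro sum.cong) (simp_all add: int)
  then have "ennreal I = (\<Sum>j<l. ennreal (enn2real (T j)))" by (simp add: sum_ennreal)
  also have "\<dots> = (\<Sum>j<l. T j)" using Tfin by (intro sum.cong) simp_all
  finally have eq: "ennreal I = F y" by (simp add: sumT)
  have "0 \<le> I" unfolding \<open>I = (\<Sum>j<l. enn2real (T j))\<close> by (intro sum_nonneg) simp
  then show ?thesis unfolding eq[symmetric] by simp
qed

text \<open>Finitely many bump functions centred at points of the compact fiber have a positive sum
  on it and are divided by this sum. For an empty fiber the family is empty and the value is
  0.\<close>

lemma form_integral_exists: "\<exists>I. has_form_integral M k (p -` {y}) \<xi> \<xi> I"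
proof -
  let ?Y = "p -` {y}"
  have "\<forall>x. \<exists>i. x \<in> Us i" using cover by blast
  from choice[OF this] obtain i where i: "\<And>x. x \<in> Us (i x)" by blast
  have "\<forall>x. \<exists>b. continuous_on UNIV b \<and> (\<forall>z. 0 \<le> b z) \<and> (0::real) < b x \<and> closure {z. b z \<noteq> 0} \<subseteq> Us (i x)"
    by (intro allI M.ex_bump open_Us i)
  from choice[OF this] obtain b where "\<forall>x. continuous_on UNIV (b x) \<and> (\<forall>z. 0 \<le> b x z) \<and> (0::real) < b x x \<and> closure {z. b x z \<noteq> 0} \<subseteq> Us (i x)"
    by (rule exE)
  then have b: "\<And>x. continuous_on UNIV (b x)" "\<And>x z. 0 \<le> b x z" "\<And>x. (0::real) < b x x"
    "\<And>x. closure {z. b x z \<noteq> 0} \<subseteq> Us (i x)" by simp_all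
  have op: "open {z. 0 < b x z}" for x
    by (intro open_Collect_less continuous_on_const b(1))
  have sub: "?Y \<subseteq> (\<Union>x\<in>?Y. {z. 0 < b x z})" using b(3) by blast
  obtain D where D: "D \<subseteq> ?Y" "finite D" "?Y \<subseteq> (\<Union>x\<in>D. {z. 0 < b x z})"
    by (rule compactE_image[OF compact_fiber op sub]) (rule that)
  obtain h where h: "bij_betw h {0..<card D} D" using ex_bij_betw_nat_finite[OF D(2)] by blast
  define l where "l = card D"
  have hD: "h j \<in> D" if "j < l" for j using h that bij_betwE unfolding l_def by fastforce
  define s where "s z = (\<Sum>j<l. b (h j) z)" for z
  have s: "0 < s z" if z: "z \<in> ?Y" for z
  proof -
    obtain x where x: "x \<in> D" "0 < b x z" using D(3) z by blast
    then obtain j where j: "j < l" "h j = x" using h unfolding bij_betw_def l_def by (metis atLeastLessThan_iff imageE)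
    have "b x z \<le> s z" unfolding s_def j(2)[symmetric] using j(1) b(2) by (intro member_le_sum) auto
    then show ?thesis using x(2) by simp
  qed
  define \<rho> where "\<rho> j z = b (h j) z / s z" for j z
  have "\<exists>W \<psi>. local_param M k ?Y W \<psi> \<and> \<psi> ` W = ?Y \<inter> Us (i (h j))" if "j < l" for j
  proof -
    have hY: "p (h j) = y" using hD[OF that] D(1) by blast
    have "h j \<in> {z. b (h j) z \<noteq> 0}" using b(3)[of "h j"] by simp
    then have "h j \<in> closure {z. b (h j) z \<noteq> 0}" by (rule subsetD[OF closure_subset])
    then have "h j \<in> Us (i (h j))" using b(4) by blast
    from ex_local_param[OF this] show ?thesis by (simp add: hY)
  qed
  then obtain W \<psi> where W: "\<And>j. j < l \<Longrightarrow> local_param M k ?Y (W j) (\<psi> j)" "\<And>j. j < l \<Longrightarrow> \<psi> j ` W j = ?Y \<inter> Us (i (h j))"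
    by metis
  have c\<rho>: "continuous_on ?Y (\<rho> j)" for j
  proof -
    have "continuous_on ?Y (b x)" for x by (rule continuous_on_subset[OF b(1)]) simp
    then show ?thesis unfolding \<rho>_def s_def
      using s unfolding s_def by (intro continuous_intros) force+
  qed
  have supp: "compact (closure {x\<in>?Y. \<rho> j x \<noteq> 0}) \<and> closure {x\<in>?Y. \<rho> j x \<noteq> 0} \<subseteq> ?Y \<inter> Us (i (h j))" for j
  proof -
    have "closure {x\<in>?Y. \<rho> j x \<noteq> 0} \<subseteq> closure {z. b (h j) z \<noteq> 0}"
      by (rule closure_mono) (auto simp: \<rho>_def)
    moreover have cY: "closure {x\<in>?Y. \<rho> j x \<noteq> 0} \<subseteq> ?Y" by (rule closure_minimal) (auto simp: closed_fiber)
    moreover have "compact (closure {x\<in>?Y. \<rho> j x \<noteq> 0})"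
    proof -
      have "compact (?Y \<inter> closure {x\<in>?Y. \<rho> j x \<noteq> 0})"
        by (rule compact_Int_closed[OF compact_fiber closed_closure])
      also have "?Y \<inter> closure {x\<in>?Y. \<rho> j x \<noteq> 0} = closure {x\<in>?Y. \<rho> j x \<noteq> 0}"
        by (rule Int_absorb1[OF cY])
      finally show ?thesis .
    qed
    ultimately show ?thesis using b(4)[of "h j"] by blast
  qed
  have one: "(\<Sum>j<l. \<rho> j x) = 1" if "x \<in> ?Y" for x
    unfolding \<rho>_def sum_divide_distrib[symmetric] s_def[symmetric] using s[OF that] by simp
  have pos: "0 \<le> \<rho> j x" if "x \<in> ?Y" for j x using b(2) s[OF that] by (simp add: \<rho>_def)
  show ?thesis unfolding has_form_integral_def
  proof (intro exI conjI)
    show "\<forall>j<l. local_param M k ?Y (W j) (\<psi> j) \<and> continuous_on ?Y (\<rho> j) \<and> (\<forall>x\<in>?Y. 0 \<le> \<rho> j x) \<and>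
        compact (closure {x\<in>?Y. \<rho> j x \<noteq> 0}) \<and> closure {x\<in>?Y. \<rho> j x \<noteq> 0} \<subseteq> \<psi> j ` W j"
      using W c\<rho> pos supp by simp
    show "\<forall>x\<in>?Y. (\<Sum>j<l. \<rho> j x) = 1" using one by blast
    show "(\<Sum>j<l. LINT w:W j|lborel_nat k. \<rho> j (\<psi> j w) * sgn (param_coeff M \<xi> (\<psi> j) w) * param_coeff M \<xi> (\<psi> j) w) =
      (\<Sum>j<l. LINT w:W j|lborel_nat k. \<rho> j (\<psi> j w) * sgn (param_coeff M \<xi> (\<psi> j) w) * param_coeff M \<xi> (\<psi> j) w)" by (rule refl)
  qed
qed

lemma fiber_integral_eq_F:
  assumes \<xi>: "quotient \<xi>" and fin: "F y < \<infinity>"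
  shows "ennreal (fiber_integral M k p \<xi> y) = F y"
proof -
  obtain I where I: "has_form_integral M k (p -` {y}) \<xi> \<xi> I" using form_integral_exists by blast
  have "(THE I. has_form_integral M k (p -` {y}) \<xi> \<xi> I) = enn2real (F y)"
  proof (rule the_equality)
    show "has_form_integral M k (p -` {y}) \<xi> \<xi> (enn2real (F y))"
      using I form_integral_unique[OF \<xi> fin I] by simp
  qed (rule form_integral_unique[OF \<xi> fin])
  then show ?thesis using fin by (simp add: fiber_integral_def form_integral_def)
qed

text \<open>F shows that the push-forward has a density, so \<open>RN_deriv\<close> is one as well;
  the sigma-finiteness of the measure of N makes it agree with F almost everywhere.\<close>

lemma fiber_volume_eq:
  "density N.vol (fiber_volume M N p) = distr M.vol borel p"
  "AE y in N.vol. fiber_volume M N p y = F y"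
proof -
  interpret sf: sigma_finite_measure N.vol by (rule N.sigma_finite_vol)
  have F: "F \<in> borel_measurable N.vol" using measurable_F by simp
  show "density N.vol (fiber_volume M N p) = distr M.vol borel p"
    unfolding fiber_volume_def distr_eq_density by (rule density_RN_deriv_density[OF F])
  have "AE y in N.vol. F y = RN_deriv N.vol (distr M.vol borel p) y"
    by (rule sf.RN_deriv_unique[OF F distr_eq_density[symmetric]])
  then show "AE y in N.vol. fiber_volume M N p y = F y"
    unfolding fiber_volume_def by (rule eventually_mono) simp
qed

end

theorem proposition1p3p12:
  fixes M :: "('p::{second_countable_topology,t2_space}, 'm::{finite,wellorder}) manifold"
    and N :: "('q::{second_countable_topology,t2_space}, 'n::{finite,wellorder}) manifold"
    and p :: "'p \<Rightarrow> 'q"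
  assumes "oriented_riemannian_manifold M"
    and "oriented_riemannian_manifold N"
    and "submersion M N p"
    and "proper_map euclidean euclidean p"
    and "riemannian_lipschitz M N p"
  defines "k \<equiv> CARD('m) - CARD('n)"
  defines "Q \<equiv> is_quotient M CARD('n) k (vol_form M) (pullback N p (vol_form N))"
  shows "density (riemannian_measure N) (fiber_volume M N p) = distr (riemannian_measure M) borel p
    \<and> (\<exists>\<xi>. Q \<xi>)
    \<and> (\<forall>\<xi>. Q \<xi> \<longrightarrow>
         (AE y in riemannian_measure N.
            fiber_volume M N p y =
              (if y \<in> range p then ennreal (fiber_integral M k p \<xi> y) else 0)))"
proof -
  interpret subm M N p k
    by (rule subm.intro[OF assms(1-3)]) (simp add: k_def)
  obtain Us :: "nat \<Rightarrow> 'p set" and Ks where "\<forall>i. fiber_kernel (Us i) (Ks i)" "(\<Union>i. Us i) = UNIV"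
    using ex_kernel_cover by (elim exE conjE)
  then interpret kernel_cover M N p k Us Ks
    using assms(4) by unfold_locales simp_all
  have Q: "Q = quotient" by (simp add: Q_def quotient_def)
  have "AE y in riemannian_measure N. fiber_volume M N p y = (if y \<in> range p then ennreal (fiber_integral M k p \<xi> y) else 0)"
    if "Q \<xi>" for \<xi>
    using fiber_volume_eq(2) AE_F_finite
  proof eventually_elim
    case (elim y)
    then show ?case
      using fiber_integral_eq_F[of \<xi> y] that F_outside[of y] by (simp add: Q)
  qed
  then show ?thesis using fiber_volume_eq(1) ex_quotient by (simp add: Q)
qed

end
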